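(* Let $X$ be the interval $I=[0,1)$ or the circle $\mathbb{T}=\mathbb{R}/\mathbb{Z}$, and let $\lambda$ denote the uniform probability measure on $X$. Then for all $p\in[1,\infty]$ and all Borel probability measures $\mu$ on $X$, $$W_p^X(\mu,\lambda)=\|\mu-\lambda\|_{\dot W^{-1,p}(X)}.$$
   Context: The metric $d_X$ is the usual distance $|x-y|$ on $I=[0,1)$, and the arc-length (quotient) distance $\min_{k\in\mathbb{Z}}|x-y+k|$ on $\mathbb{T}=\mathbb{R}/\mathbb{Z}$. For Borel probability measures $\mu,\nu$ on $X$ and $p\in[1,\infty]$, the Wasserstein-$p$ distance is $$W_p^X(\mu,\nu)=\inf_{\pi\in\Pi(\mu,\nu)}\|d_X\|_{L^p(\pi)},$$ where $\Pi(\mu,\nu)$ is the set of Borel probability measures on $X\times X$ with marginals $\mu$ and $\nu$ (for $p=\infty$, the norm is the $\pi$-essential supremum of $d_X$). For $q\in[1,\infty]$ and $f\colon X\to\mathbb{R}$ with weak derivative $f'$, set $\|f\|_{\dot W^{1,q}(X)}=\|f'\|_{L^q(X)}$; such $f$ with $f'\in L^q(X)$ is identified with its (absolutely) continuous representative. For Hölder-conjugate $(p,q)$ (i.e. $\frac1p+\frac1q=1$), $$\|\mu-\lambda\|_{\dot W^{-1,p}(X)}=\sup\Big\{\int_X f\,d(\mu-\lambda)\ :\ \|f\|_{\dot W^{1,q}(X)}\le 1\Big\}.$$ *)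

theory Defs
  imports "HOL-Probability.Probability"
begin

section \<open>The circle as a metric space\<close>

definition int_apart :: "real \<Rightarrow> real \<Rightarrow> bool" where
  "int_apart x y \<longleftrightarrow> x - y \<in> \<int>"

lemma equivp_int_apart: "equivp int_apart"
proof (rule equivpI)
  show "reflp int_apart" by (simp add: reflp_def int_apart_def)
  show "symp int_apart"
    unfolding symp_def int_apart_def by (metis Ints_minus minus_diff_eq)
  show "transp int_apart"
    unfolding transp_def int_apart_def
  proof (intro allI impI)
    fix x y z :: real assume "x - y \<in> \<int>" "y - z \<in> \<int>"
    then have "(x - y) + (y - z) \<in> \<int>" by (rule Ints_add)
    then show "x - z \<in> \<int>" by simp
  qed
qed

quotient_type circle = real / int_apart
  by (rule equivp_int_apart)

lift_definition circle_proj :: "real \<Rightarrow> circle" is "\<lambda>x. x" .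

definition arc_dist :: "real \<Rightarrow> real \<Rightarrow> real" where
  "arc_dist x y = (INF k::int. \<bar>x - y + of_int k\<bar>)"

lemma arc_dist_le: "arc_dist x y \<le> \<bar>x - y + of_int k\<bar>"
  unfolding arc_dist_def by (rule cINF_lower) (auto intro!: bdd_belowI[of _ 0])

text \<open>The infimum is a minimum.\<close>

lemma arc_dist_attained: "\<exists>k::int. arc_dist x y = \<bar>x - y + of_int k\<bar>"
proof
  let ?k = "- round (x - y)"
  have "\<bar>x - y + of_int ?k\<bar> \<le> arc_dist x y"
    unfolding arc_dist_def
  proof (rule cINF_greatest)
    fix k :: int
    show "\<bar>x - y + of_int ?k\<bar> \<le> \<bar>x - y + of_int k\<bar>"
      using round_diff_minimal[of "x - y" "- k"] by simp
  qed simp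
  then show "arc_dist x y = \<bar>x - y + of_int ?k\<bar>"
    using arc_dist_le[of x y ?k] by simp
qed

lemma arc_dist_cong:
  assumes "x - x' \<in> \<int>" "y - y' \<in> \<int>"
  shows "arc_dist x y = arc_dist x' y'"
proof -
  have le: "arc_dist u v \<le> arc_dist u' v'" if d: "u - u' \<in> \<int>" "v - v' \<in> \<int>" for u u' v v'
  proof -
    obtain k where k: "arc_dist u' v' = \<bar>u' - v' + of_int k\<bar>" using arc_dist_attained by blast
    obtain i j where ij: "u - u' = of_int i" "v - v' = of_int j" using d by (auto elim!: Ints_cases)
    have "arc_dist u v \<le> \<bar>u - v + of_int (k - i + j)\<bar>" by (rule arc_dist_le)
    also have "u - v + of_int (k - i + j) = u' - v' + of_int k" using ij by simp
    finally show ?thesis using k by simp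
  qed
  have "x' - x \<in> \<int>" "y' - y \<in> \<int>" using assms by (metis Ints_minus minus_diff_eq)+
  then show ?thesis using le assms by (metis order_antisym)
qed

lemma arc_dist_eq_0: "arc_dist x y = 0 \<longleftrightarrow> x - y \<in> \<int>"
proof
  assume "arc_dist x y = 0"
  then obtain k where "x - y + of_int k = 0" using arc_dist_attained[of x y] by auto
  then have "x - y = of_int (- k)" by simp
  then show "x - y \<in> \<int>" by (metis Ints_of_int)
next
  assume "x - y \<in> \<int>"
  then have "arc_dist x y = arc_dist y y" by (intro arc_dist_cong) auto
  also have "\<dots> = 0"
    using arc_dist_le[of y y 0] arc_dist_attained[of y y] by (metis abs_ge_zero antisym abs_zero
        add.right_neutral diff_self of_int_0)
  finally show "arc_dist x y = 0" .
qed

lemma arc_dist_triangle2: "arc_dist x y \<le> arc_dist x z + arc_dist y z"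
proof -
  obtain i where i: "arc_dist x z = \<bar>x - z + of_int i\<bar>" using arc_dist_attained by blast
  obtain j where j: "arc_dist y z = \<bar>y - z + of_int j\<bar>" using arc_dist_attained by blast
  have "arc_dist x y \<le> \<bar>x - y + of_int (i - j)\<bar>" by (rule arc_dist_le)
  also have "\<dots> \<le> \<bar>x - z + of_int i\<bar> + \<bar>y - z + of_int j\<bar>" by simp
  finally show ?thesis using i j by simp
qed

instantiation circle :: metric_space
begin

lift_definition dist_circle :: "circle \<Rightarrow> circle \<Rightarrow> real" is arc_dist
  unfolding int_apart_def by (rule arc_dist_cong)

definition uniformity_circle :: "(circle \<times> circle) filter" where
  "uniformity_circle = (INF e\<in>{0<..}. principal {(x, y). dist x y < e})"

definition open_circle :: "circle set \<Rightarrow> bool" where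
  "open_circle U \<longleftrightarrow> (\<forall>x\<in>U. eventually (\<lambda>(x', y). x' = x \<longrightarrow> y \<in> U) uniformity)"

instance
proof
  fix x y z :: circle
  show "dist x y = 0 \<longleftrightarrow> x = y"
    by transfer (simp add: arc_dist_eq_0 int_apart_def)
  show "dist x y \<le> dist x z + dist y z"
    by transfer (rule arc_dist_triangle2)
qed (simp_all add: uniformity_circle_def open_circle_def)

end

section \<open>Uniform measures\<close>

definition unif_interval :: "real measure" where
  "unif_interval = restrict_space lborel {0..<1}"

definition unif_circle :: "circle measure" where
  "unif_circle = distr unif_interval borel circle_proj"

section \<open>Lp norms and Wasserstein distances\<close>

text \<open>Here \<open>p = \<infinity>\<close> is allowed. The function \<open>f\<close> is meant to be measurable.\<close>

definition Lp_norm :: "ennreal \<Rightarrow> 'a measure \<Rightarrow> ('a \<Rightarrow> real) \<Rightarrow> ennreal" where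
  "Lp_norm p M f =
     (if p = \<infinity> then esssup M (\<lambda>x. ennreal \<bar>f x\<bar>)
      else let I = (\<integral>\<^sup>+x. ennreal (\<bar>f x\<bar> powr enn2real p) \<partial>M)
           in if I = \<infinity> then \<infinity> else ennreal (enn2real I powr (1 / enn2real p)))"

text \<open>On the separable metric spaces considered here, the product sigma-algebra is the
  Borel sigma-algebra of the product space.\<close>

definition couplings :: "'a measure \<Rightarrow> 'b measure \<Rightarrow> ('a \<times> 'b) measure set" where
  "couplings M N =
     {\<pi>. prob_space \<pi> \<and> sets \<pi> = sets (M \<Otimes>\<^sub>M N) \<and> distr \<pi> M fst = M \<and> distr \<pi> N snd = N}"

definition wasserstein ::
    "ennreal \<Rightarrow> 'a::metric_space measure \<Rightarrow> 'a measure \<Rightarrow> ennreal" where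
  "wasserstein p M N = (INF \<pi>\<in>couplings M N. Lp_norm p \<pi> (\<lambda>(x, y). dist x y))"

section \<open>Weak derivatives and the dual Sobolev norm\<close>

definition test_function :: "real set \<Rightarrow> (real \<Rightarrow> real) \<Rightarrow> bool" where
  "test_function U \<phi> \<longleftrightarrow>
     (\<forall>n. (deriv ^^ n) \<phi> differentiable_on UNIV) \<and>
     compact (closure {x. \<phi> x \<noteq> 0}) \<and> closure {x. \<phi> x \<noteq> 0} \<subseteq> U"

definition locally_integrable :: "real set \<Rightarrow> (real \<Rightarrow> real) \<Rightarrow> bool" where
  "locally_integrable U f \<longleftrightarrow> (\<forall>K. compact K \<and> K \<subseteq> U \<longrightarrow> set_integrable lborel K f)"

definition has_weak_deriv_on :: "real set \<Rightarrow> (real \<Rightarrow> real) \<Rightarrow> (real \<Rightarrow> real) \<Rightarrow> bool" where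
  "has_weak_deriv_on U f g \<longleftrightarrow>
     locally_integrable U f \<and> locally_integrable U g \<and>
     (\<forall>\<phi>. test_function U \<phi> \<longrightarrow>
        set_lebesgue_integral lborel U (\<lambda>x. f x * deriv \<phi> x) =
        - set_lebesgue_integral lborel U (\<lambda>x. g x * \<phi> x))"

text \<open>In the next two predicates \<open>f\<close> is the continuous representative and \<open>g\<close> is a weak
  derivative of \<open>f\<close>. On the interval only the values on \<open>{0..<1}\<close> matter, and test functions
  live in its interior. On the circle the derivative is taken in the coordinates given by
  the projection from the real line, that is, for the periodic lifts.\<close>

definition weak_deriv_interval :: "(real \<Rightarrow> real) \<Rightarrow> (real \<Rightarrow> real) \<Rightarrow> bool" where
  "weak_deriv_interval f g \<longleftrightarrow>
     continuous_on {0..<1} f \<and> has_weak_deriv_on {0<..<1} f g"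

definition weak_deriv_circle :: "(circle \<Rightarrow> real) \<Rightarrow> (circle \<Rightarrow> real) \<Rightarrow> bool" where
  "weak_deriv_circle f g \<longleftrightarrow>
     continuous_on UNIV f \<and> has_weak_deriv_on UNIV (f \<circ> circle_proj) (g \<circ> circle_proj)"

definition holder_conjugate :: "ennreal \<Rightarrow> ennreal \<Rightarrow> bool" where
  "holder_conjugate p q \<longleftrightarrow> 1 \<le> p \<and> 1 \<le> q \<and> inverse p + inverse q = 1"

text \<open>\<open>sobolev_ball D L q\<close> consists of the \<open>f\<close> whose weak derivative (in the sense of the
  relation \<open>D\<close>) has norm at most \<open>1\<close> in \<open>L\<^sup>q\<close> of the measure \<open>L\<close>.\<close>

definition sobolev_ball ::
    "(('a \<Rightarrow> real) \<Rightarrow> ('a \<Rightarrow> real) \<Rightarrow> bool) \<Rightarrow> 'a measure \<Rightarrow> ennreal \<Rightarrow> ('a \<Rightarrow> real) set" where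
  "sobolev_ball D L q = {f. \<exists>g. D f g \<and> g \<in> borel_measurable L \<and> Lp_norm q L g \<le> 1}"

text \<open>\<open>dual_sobolev_norm D L p M\<close> is the norm of \<open>M - L\<close> in the dual space with exponent \<open>p\<close>;
  the exponent \<open>q\<close> is determined by \<open>p\<close>.\<close>

definition dual_sobolev_norm ::
    "(('a \<Rightarrow> real) \<Rightarrow> ('a \<Rightarrow> real) \<Rightarrow> bool) \<Rightarrow> 'a measure \<Rightarrow> ennreal \<Rightarrow> 'a measure \<Rightarrow> ereal" where
  "dual_sobolev_norm D L p M =
     Sup {ereal (integral\<^sup>L M f - integral\<^sup>L L f) | f q.
            holder_conjugate p q \<and> f \<in> sobolev_ball D L q}"

end

theory Submission
  imports Defs
begin

text \<open>Let \<open>F\<close> be the distribution function of \<open>\<mu>\<close> on \<open>[0,1)\<close>, extended to the line by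
  \<open>F (s + 1) = F s + 1\<close>, and put \<open>H s = s - F s + a\<close>, a periodic function; \<open>a = 0\<close> for the interval,
  while \<open>a\<close> is free for the circle. Both sides are shown to equal \<open>\<parallel>H\<parallel>\<^sub>p\<close> for a suitable \<open>a\<close>.

  Integration by parts gives \<open>\<integral>f d(\<mu> - \<lambda>) = \<integral>f' H d\<lambda>\<close> (on the circle \<open>f'\<close> has mean zero, so \<open>a\<close> is
  irrelevant), hence the dual norm is at most \<open>\<parallel>H\<parallel>\<^sub>p\<close> for every \<open>a\<close>. The monotone coupling of
  \<open>\<lambda>\<close> and \<open>\<mu>\<close> shifted by \<open>a\<close> has cost at most \<open>\<parallel>H\<parallel>\<^sub>p\<close>, because \<open>|T y - y|\<^sup>p\<close> is the integral
  of the derivative of \<open>|.|\<^sup>p\<close> between \<open>y\<close> and \<open>T y\<close>, and Tonelli turns the area between the graph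
  of \<open>T\<close> and the diagonal into the same area seen from the other axis.

  For the converse inequalities with \<open>p < \<infinity>\<close>, let \<open>\<Phi>\<close> be a primitive of the derivative of \<open>|.|\<^sup>p\<close> at
  \<open>H\<close>, where on the circle \<open>a\<close> is chosen such that \<open>\<Phi>\<close> is periodic. A multiple of \<open>\<Phi>\<close> is an extremal
  \<open>f\<close> in the dual norm, and \<open>\<Phi>\<close> is a Kantorovich potential: \<open>|x - y|\<^sup>p \<ge> \<Phi> x - \<Phi> y - G y\<close> with
  \<open>\<integral>G d\<lambda> = (p - 1) \<parallel>H\<parallel>\<^sub>p\<^sup>p\<close>. The case \<open>p = \<infinity>\<close> follows by letting \<open>p\<close> tend to \<open>\<infinity>\<close> along a
  convergent subsequence of the shifts \<open>a\<close>.\<close>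

section \<open>Smooth cut-off functions\<close>

text \<open>No general duality theorem enters: the lower bound on the cost is proved for each
  coupling separately, by integrating the potential inequality. With \<open>S\<close> the p-th power
  of the norm of \<open>H\<close>, the terms in \<Phi> contribute \<open>p * S\<close> and
  \<open>G\<close> takes away \<open>(p - 1) * S\<close>, so exactly \<open>S\<close> is left for
  the cost. This rests on \<open>pow_grad p t z * z = p * \<bar>z\<bar> powr p\<close>, valid for
  every choice of subgradient.

  The delicate finite exponent is p = 1: the subdifferential of |z| at 0 is an interval and
  \<open>H\<close> may vanish on a set of positive measure, so the mean of the gradient can jump
  across 0 as the shift varies. The parameter \<open>t\<close> fills that jump and so makes \<Phi>
  periodic.

  For p = \<infinity> the optimal shifts depend on the exponent and only a limit of them is
  available. It suffices because the shifts stay bounded and because the coupling depends on the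
  shift alone, so that one plan is controlled for all exponents at once.

  Interval and circle differ only in which shifts are admissible, hence the argument is run once
  over an abstract space with a coordinate in [0,1). Smooth cut-offs are built by hand because weak
  derivatives are tested against smooth functions.\<close>

definition flat_exp :: "nat \<Rightarrow> real \<Rightarrow> real" where
  "flat_exp i x = (if x \<le> 0 then 0 else inverse x ^ i * exp (- inverse x))"

lemma flat_exp_tendsto_0: "(flat_exp i \<longlongrightarrow> 0) (at_right 0)"
proof -
  have "((\<lambda>x. inverse x ^ i / exp (inverse x)) \<longlongrightarrow> 0) (at_right (0::real))"
    by (rule filterlim_compose[OF tendsto_power_div_exp_0 filterlim_inverse_at_top_right])
  moreover have "\<forall>\<^sub>F x in at_right 0. inverse x ^ i / exp (inverse x) = flat_exp i x"
    using eventually_at_right_less[of "0::real"]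
    by eventually_elim (auto simp: flat_exp_def exp_minus field_simps)
  ultimately show ?thesis by (rule Lim_transform_eventually)
qed

text \<open>The factor exp(-1/x) survives differentiation and only the power of 1/x grows, so the
  family is closed under derivatives up to linear combinations. At 0 the right difference quotient
  of \<open>flat_exp i\<close> is \<open>flat_exp (Suc i)\<close>, which tends to 0.\<close>

lemma has_real_derivative_flat_exp:
  "(flat_exp i has_real_derivative (flat_exp (i + 2) x - real i * flat_exp (i + 1) x)) (at x)"
proof -
  consider "x > 0" | "x < 0" | "x = 0" by linarith
  then show ?thesis
  proof cases
    case 1
    have inv: "((\<lambda>x. inverse x) has_real_derivative - (inverse x ^ 2)) (at x)"
      unfolding numeral_2_eq_2 by (rule DERIV_inverse) (use 1 in simp)
    have "((\<lambda>x. inverse x ^ i) has_real_derivative - (real i * inverse x ^ (i + 1))) (at x)"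
      by (rule DERIV_cong[OF DERIV_power[OF inv]]) (cases i, auto simp: power2_eq_square)
    moreover have "((\<lambda>x. exp (- inverse x)) has_real_derivative exp (- inverse x) * inverse x ^ 2) (at x)"
      by (rule DERIV_cong[OF DERIV_fun_exp[OF DERIV_minus[OF inv]]]) simp
    ultimately have "((\<lambda>x. inverse x ^ i * exp (- inverse x)) has_real_derivative
        inverse x ^ i * (exp (- inverse x) * inverse x ^ 2) +
        - (real i * inverse x ^ (i + 1)) * exp (- inverse x)) (at x)"
      by (rule DERIV_mult')
    also have "inverse x ^ i * (exp (- inverse x) * inverse x ^ 2) +
        - (real i * inverse x ^ (i + 1)) * exp (- inverse x) =
        flat_exp (i + 2) x - real i * flat_exp (i + 1) x"
      using 1 by (simp add: flat_exp_def power_add power2_eq_square algebra_simps)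
    finally show ?thesis
      by (rule has_field_derivative_transform_within_open[where S = "{0<..}"])
        (use 1 in \<open>auto simp: flat_exp_def\<close>)
  next
    case 2
    have "((\<lambda>x. 0) has_real_derivative (flat_exp (i + 2) x - real i * flat_exp (i + 1) x)) (at x)"
      using 2 by (simp add: flat_exp_def)
    then show ?thesis
      by (rule has_field_derivative_transform_within_open[where S = "{..<0}"])
        (use 2 in \<open>auto simp: flat_exp_def\<close>)
  next
    case 3
    have "((\<lambda>y. flat_exp i y / y) \<longlongrightarrow> 0) (at_right 0)"
    proof (rule Lim_transform_eventually[OF flat_exp_tendsto_0[of "Suc i"]])
      show "\<forall>\<^sub>F x in at_right 0. flat_exp (Suc i) x = flat_exp i x / x"
        using eventually_at_right_less[of "0::real"]
        by eventually_elim (auto simp: flat_exp_def field_simps)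
    qed
    moreover have "((\<lambda>y. flat_exp i y / y) \<longlongrightarrow> 0) (at_left 0)"
      by (rule Lim_transform_eventually[OF tendsto_const])
        (auto simp: flat_exp_def eventually_at_filter)
    ultimately have "((\<lambda>y. flat_exp i y / y) \<longlongrightarrow> 0) (at 0)"
      by (simp add: filterlim_at_split)
    then show ?thesis
      using 3 by (simp add: has_field_derivative_iff flat_exp_def)
  qed
qed

lemma flat_exp_nonneg: "0 \<le> flat_exp i x"
  by (simp add: flat_exp_def)

text \<open>This span is closed under differentiation, so all its members are smooth.\<close>

inductive_set flat_span :: "(real \<Rightarrow> real) set" where
  flat_span_base: "(\<lambda>x. flat_exp i (a * x + b) * flat_exp j (c * x + d)) \<in> flat_span"
| flat_span_add: "f \<in> flat_span \<Longrightarrow> g \<in> flat_span \<Longrightarrow> (\<lambda>x. f x + g x) \<in> flat_span"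
| flat_span_cmult: "f \<in> flat_span \<Longrightarrow> (\<lambda>x. k * f x) \<in> flat_span"

lemma flat_span_deriv:
  assumes "f \<in> flat_span"
  obtains f' where "f' \<in> flat_span" "\<And>x. (f has_real_derivative f' x) (at x)"
proof -
  have "\<exists>f'\<in>flat_span. \<forall>x. (f has_real_derivative f' x) (at x)"
    using assms
  proof induction
    case (flat_span_base i a b j c d)
    \<comment> \<open>The product rule, arranged as nested sums with explicit scalar factors so that
      the introduction rules apply literally; subtraction becomes a negative factor.\<close>
    let ?f' = "\<lambda>x. a * (flat_exp (i+2) (a*x+b) * flat_exp j (c*x+d)) +
        ((- (a * real i)) * (flat_exp (i+1) (a*x+b) * flat_exp j (c*x+d)) +
        (c * (flat_exp i (a*x+b) * flat_exp (j+2) (c*x+d)) +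
        (- (c * real j)) * (flat_exp i (a*x+b) * flat_exp (j+1) (c*x+d))))"
    have "?f' \<in> flat_span"
      by (intro flat_span.intros)
    moreover have "((\<lambda>x. flat_exp i (a * x + b) * flat_exp j (c * x + d)) has_real_derivative ?f' x) (at x)" for x
    proof -
      have *: "((\<lambda>x. flat_exp k (u * x + v)) has_real_derivative
          (flat_exp (k + 2) (u * x + v) - real k * flat_exp (k + 1) (u * x + v)) * u) (at x)" for k u v
        by (rule DERIV_chain2[OF has_real_derivative_flat_exp]) (auto intro!: derivative_eq_intros)
      show ?thesis
        by (rule DERIV_cong[OF DERIV_mult'[OF * *]]) (simp add: algebra_simps)
    qed
    ultimately show ?case by (intro bexI[of _ ?f'] allI)
  next
    case (flat_span_add f g)
    then obtain f' g' where "f' \<in> flat_span" "g' \<in> flat_span"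
      "\<forall>x. (f has_real_derivative f' x) (at x)" "\<forall>x. (g has_real_derivative g' x) (at x)"
      by blast
    then show ?case
      by (intro bexI[of _ "\<lambda>x. f' x + g' x"]) (auto intro!: flat_span.intros derivative_intros)
  next
    case (flat_span_cmult f k)
    then obtain f' where "f' \<in> flat_span" "\<forall>x. (f has_real_derivative f' x) (at x)"
      by blast
    then show ?case
      by (intro bexI[of _ "\<lambda>x. k * f' x"]) (auto intro!: flat_span.intros DERIV_cmult)
  qed
  then show ?thesis using that by blast
qed

lemma flat_span_deriv_funpow:
  "f \<in> flat_span \<Longrightarrow> (deriv ^^ n) f \<in> flat_span"
proof (induction n arbitrary: f)
  case (Suc n)
  obtain f' where f': "f' \<in> flat_span" "\<And>x. (f has_real_derivative f' x) (at x)"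
    using flat_span_deriv[OF Suc.prems] by blast
  have "deriv f = f'" using f'(2) by (auto intro!: DERIV_imp_deriv)
  then show ?case using Suc.IH[OF f'(1)] by (simp add: funpow_Suc_right del: funpow.simps)
qed simp

lemma flat_span_differentiable: "f \<in> flat_span \<Longrightarrow> f differentiable_on S"
  by (metis differentiable_at_imp_differentiable_on flat_span_deriv real_differentiable_def)

lemma flat_span_continuous_on: "f \<in> flat_span \<Longrightarrow> continuous_on S f"
  by (rule differentiable_imp_continuous_on[OF flat_span_differentiable])

section \<open>Bumps, smooth steps and plateaus\<close>

definition bump :: "real \<Rightarrow> real" where
  "bump x = flat_exp 0 x * flat_exp 0 (1 - x)"

text \<open>This is why the generators of \<open>flat_span\<close> are products of two flat
  functions with arbitrary affine arguments: each rescaled bump is itself a generator.\<close>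

lemma bump_affine_flat_span: "(\<lambda>x. bump (a * x + b)) \<in> flat_span"
  using flat_span_base[of 0 a b 0 "- a" "1 - b"] by (simp add: bump_def algebra_simps)

lemma continuous_on_bump: "continuous_on S bump"
  using flat_span_continuous_on[OF bump_affine_flat_span[of 1 0]] by simp

lemma bump_nonneg: "0 \<le> bump x"
  by (simp add: bump_def flat_exp_nonneg)

lemma bump_eq_0: "x \<notin> {0<..<1} \<Longrightarrow> bump x = 0"
  by (auto simp: bump_def flat_exp_def)

lemma integral_bump_pos: "integral {0..1} bump > 0"
proof -
  have "integral {0..1} bump \<noteq> 0"
  proof
    assume "integral {0..1} bump = 0"
    then have "bump (1/2) = 0"
      using integral_eq_0_iff[OF continuous_on_bump, of 0 1] bump_nonneg by auto
    then show False by (simp add: bump_def flat_exp_def)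
  qed
  moreover have "integral {0..1} bump \<ge> 0"
    by (intro integral_nonneg integrable_continuous_real continuous_on_bump bump_nonneg)
  ultimately show ?thesis by simp
qed

definition step_deriv :: "real \<Rightarrow> real" where
  "step_deriv x = bump x / integral {0..1} bump"

definition smooth_step :: "real \<Rightarrow> real" where
  "smooth_step x = integral {0..x} step_deriv"

lemma continuous_on_step_deriv: "continuous_on S step_deriv"
  unfolding step_deriv_def using integral_bump_pos
  by (intro continuous_intros continuous_on_bump) auto

lemma step_deriv_eq_0: "x \<notin> {0<..<1} \<Longrightarrow> step_deriv x = 0"
  by (simp add: step_deriv_def bump_eq_0)

lemma step_deriv_nonneg: "0 \<le> step_deriv x"
  using integral_bump_pos by (simp add: step_deriv_def bump_nonneg)

lemma smooth_step_eq_0: "x \<le> 0 \<Longrightarrow> smooth_step x = 0"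
  unfolding smooth_step_def by (cases "x = 0") auto

lemma smooth_step_eq_1:
  assumes "1 \<le> x" shows "smooth_step x = 1"
proof -
  have "smooth_step x = integral {0..1} step_deriv + integral {1..x} step_deriv"
    unfolding smooth_step_def using assms
    by (intro Henstock_Kurzweil_Integration.integral_combine[symmetric] integrable_continuous_real continuous_on_step_deriv) auto
  also have "integral {1..x} step_deriv = integral {1..x} (\<lambda>x. 0)"
    by (intro Henstock_Kurzweil_Integration.integral_cong step_deriv_eq_0) auto
  finally show ?thesis
    using integral_bump_pos by (simp add: step_deriv_def)
qed

lemma has_real_derivative_smooth_step: "(smooth_step has_real_derivative step_deriv x) (at x)"
proof -
  have "(smooth_step has_real_derivative step_deriv x) (at x)" if "x > - 1"
  proof -
    \<comment> \<open>Moving the lower limit from 0 to -1 turns 0 into an interior point, where the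
      fundamental theorem gives a two-sided derivative; the integrand vanishes on the added
      piece.\<close>
    have eq: "integral {-1..y} step_deriv = smooth_step y" if "y > - 1" for y
    proof (cases "y \<ge> 0")
      case True
      have "integral {-1..y} step_deriv = integral {-1..0} step_deriv + integral {0..y} step_deriv"
        using True
        by (intro Henstock_Kurzweil_Integration.integral_combine[symmetric] integrable_continuous_real continuous_on_step_deriv) auto
      also have "integral {-1..0} step_deriv = 0"
        by (intro integral_unique has_integral_is_0 step_deriv_eq_0) auto
      finally show ?thesis by (simp add: smooth_step_def)
    next
      case False
      have "integral {-1..y} step_deriv = integral {-1..y} (\<lambda>x. 0)"
        using False by (intro Henstock_Kurzweil_Integration.integral_cong step_deriv_eq_0) auto
      then show ?thesis using False by (simp add: smooth_step_eq_0)
    qed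
    have "((\<lambda>y. integral {-1..y} step_deriv) has_real_derivative step_deriv x) (at x within {-1..x+1})"
      using that by (intro integral_has_real_derivative continuous_on_step_deriv) auto
    then have "((\<lambda>y. integral {-1..y} step_deriv) has_real_derivative step_deriv x) (at x)"
      using that by (simp add: at_within_Icc_at)
    then show ?thesis
      by (rule has_field_derivative_transform_within_open[where S = "{-1<..}"])
        (use that in \<open>auto simp: eq\<close>)
  qed
  moreover have "(smooth_step has_real_derivative step_deriv x) (at x)" if "x < 0"
  proof -
    have "((\<lambda>x. 0) has_real_derivative step_deriv x) (at x)"
      using that by (simp add: step_deriv_eq_0)
    then show ?thesis
      by (rule has_field_derivative_transform_within_open[where S = "{..<0}"])
        (use that in \<open>auto simp: smooth_step_eq_0\<close>)
  qed
  ultimately show ?thesis by (cases "x < 0") auto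
qed

lemma smooth_step_mono: "x \<le> y \<Longrightarrow> smooth_step x \<le> smooth_step y"
  by (rule DERIV_nonneg_imp_nondecreasing[where f = smooth_step])
    (auto intro: has_real_derivative_smooth_step step_deriv_nonneg)

lemma smooth_step_bounds: "0 \<le> smooth_step x" "smooth_step x \<le> 1"
  using smooth_step_mono[of "min x 0" x] smooth_step_mono[of x "max x 1"]
  by (auto simp: smooth_step_eq_0 smooth_step_eq_1)

text \<open>A smooth indicator of [a,b]. Both ramps have width \<open>e\<close> and start at their
  end point, so the support lies in [a, b + e] and the pointwise limit for e to 0 is the indicator
  of the half-open interval (a,b].\<close>

definition plateau :: "real \<Rightarrow> real \<Rightarrow> real \<Rightarrow> real \<Rightarrow> real" where
  "plateau a b e x = smooth_step ((x - a) / e) - smooth_step ((x - b) / e)"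

lemma has_real_derivative_plateau:
  assumes "e > 0"
  shows "(plateau a b e has_real_derivative
    (step_deriv ((x - a) / e) - step_deriv ((x - b) / e)) / e) (at x)"
proof -
  have *: "((\<lambda>x. smooth_step ((x - c) / e)) has_real_derivative step_deriv ((x - c) / e) * (1 / e)) (at x)" for c
    using assms
    by (intro DERIV_chain2[OF has_real_derivative_smooth_step]) (auto intro!: derivative_eq_intros)
  show ?thesis
    unfolding plateau_def[abs_def]
    by (rule DERIV_cong[OF DERIV_diff[OF * *]]) (simp add: diff_divide_distrib)
qed

lemma deriv_plateau:
  "e > 0 \<Longrightarrow> deriv (plateau a b e) x = (step_deriv ((x - a) / e) - step_deriv ((x - b) / e)) / e"
  by (intro DERIV_imp_deriv has_real_derivative_plateau)

text \<open>Smoothness of the plateau is read off one derivative later: the step is a primitive of a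
  bump rather than a combination of flat functions, but the derivative of the plateau is a
  difference of two rescaled bumps.\<close>

lemma deriv_plateau_flat_span:
  assumes "e > 0" shows "deriv (plateau a b e) \<in> flat_span"
proof -
  define I where "I = integral {0..1} bump"
  have "deriv (plateau a b e) = (\<lambda>x. 1 / (I * e) * bump (1 / e * x + (- a / e)) +
      (- 1 / (I * e)) * bump (1 / e * x + (- b / e)))"
    by (rule ext) (simp add: deriv_plateau assms step_deriv_def I_def diff_divide_distrib)
  also have "\<dots> \<in> flat_span"
    by (intro flat_span_add flat_span_cmult bump_affine_flat_span)
  finally show ?thesis .
qed

lemma plateau_eq_0:
  assumes "e > 0" "a \<le> b" "x \<notin> {a..b + e}" shows "plateau a b e x = 0"
proof -
  consider "x < a" | "x > b + e" using assms(3) by fastforce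
  then show ?thesis
  proof cases
    case 1
    then have "(x - a) / e \<le> 0" "(x - b) / e \<le> 0"
      using assms(1,2) by (auto intro!: divide_nonpos_pos)
    then show ?thesis by (simp add: plateau_def smooth_step_eq_0)
  next
    case 2
    then have "1 \<le> (x - a) / e" "1 \<le> (x - b) / e"
      using assms(1,2) by (auto simp: pos_le_divide_eq)
    then show ?thesis by (simp add: plateau_def smooth_step_eq_1)
  qed
qed

lemma test_function_plateau:
  assumes "e > 0" "a \<le> b" "{a..b + e} \<subseteq> U"
  shows "test_function U (plateau a b e)"
proof -
  have "x \<in> {a..b + e}" if "plateau a b e x \<noteq> 0" for x
    using plateau_eq_0[OF assms(1,2), of x] that by argo
  then have cl: "closure {x. plateau a b e x \<noteq> 0} \<subseteq> {a..b + e}"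
    by (intro closure_minimal subsetI) auto
  have "(deriv ^^ n) (plateau a b e) differentiable_on UNIV" for n
  proof (cases n)
    case 0
    then show ?thesis
      using has_real_derivative_plateau[OF assms(1)]
      by (metis differentiable_at_imp_differentiable_on real_differentiable_def funpow_0)
  next
    case (Suc m)
    then show ?thesis
      using flat_span_differentiable[OF flat_span_deriv_funpow[OF deriv_plateau_flat_span[OF assms(1)]]]
      by (simp add: funpow_Suc_right del: funpow.simps)
  qed
  moreover have "compact (closure {x. plateau a b e x \<noteq> 0})"
    using cl closure_subset[of "{x. plateau a b e x \<noteq> 0}"]
      bounded_subset[OF bounded_closed_interval[of a "b + e"]]
    unfolding compact_closure by auto
  ultimately show ?thesis
    unfolding test_function_def using cl assms(3) by blast
qed

section \<open>Weak derivatives and primitives\<close>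

text \<open>Absolute continuity with derivative \<open>g\<close>, encoded by the Newton-Leibniz
  formula on subintervals. Integrability is demanded separately because the integral of a
  non-integrable function defaults to 0.\<close>

definition primitive_on :: "real set \<Rightarrow> (real \<Rightarrow> real) \<Rightarrow> (real \<Rightarrow> real) \<Rightarrow> bool" where
  "primitive_on S f g \<longleftrightarrow> (\<forall>a\<in>S. \<forall>b\<in>S. a \<le> b \<longrightarrow>
     set_integrable lborel {a..b} g \<and> f b - f a = (LINT s:{a..b}|lborel. g s))"

lemma primitive_onD:
  assumes "primitive_on S f g" "a \<in> S" "b \<in> S" "a \<le> b"
  shows "set_integrable lborel {a..b} g" "f b - f a = (LINT s:{a..b}|lborel. g s)"
  using assms by (auto simp: primitive_on_def)

section \<open>Integrals against smoothed indicators\<close>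

lemma LINT_step_deriv: "integrable lborel step_deriv" "(LINT u|lborel. step_deriv u) = 1"
proof -
  have eq: "(\<lambda>u. indicator {0..1} u *\<^sub>R step_deriv u) = step_deriv"
  proof
    fix u :: real
    show "indicator {0..1} u *\<^sub>R step_deriv u = step_deriv u"
      using step_deriv_eq_0[of u] by (cases "u \<in> {0..1}") auto
  qed
  have int: "set_integrable lborel {0..1} step_deriv"
    unfolding set_integrable_def
    by (rule borel_integrable_compact) (auto intro: continuous_on_step_deriv)
  then show "integrable lborel step_deriv"
    unfolding set_integrable_def eq .
  have "(LINT u:{0..1}|lborel. step_deriv u) = integral {0..1} step_deriv"
    using int by (rule set_borel_integral_eq_integral)
  also have "\<dots> = 1"
    using smooth_step_eq_1[of 1] by (simp add: smooth_step_def)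
  finally show "(LINT u|lborel. step_deriv u) = 1"
    unfolding set_lebesgue_integral_def eq .
qed

lemma measurable_step_deriv[measurable]: "step_deriv \<in> borel_measurable borel"
  by (rule borel_measurable_continuous_onI) (rule continuous_on_step_deriv)

text \<open>The substitution x = c + e u replaces the concentrating density by a fixed one on [0,1];
  the dependence on \<open>e\<close> then sits only in the argument of \<open>f\<close>.\<close>

lemma LINT_rescaled_step_deriv:
  assumes "e > 0" "{c..c + e} \<subseteq> U" "continuous_on {c..c + e} f"
  shows "integrable lborel (\<lambda>x. indicator U x * (f x * (step_deriv ((x - c) / e) / e)))" (is "integrable _ ?k")
    and "(LINT x|lborel. indicator U x * (f x * (step_deriv ((x - c) / e) / e))) =
      (LINT u|lborel. indicator {0..1} u * f (c + e * u) * step_deriv u)"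
proof -
  have sd: "step_deriv ((x - c) / e) = 0" if "x \<notin> {c..c + e}" for x
    using that assms(1) by (intro step_deriv_eq_0) (auto simp: field_simps)
  have "integrable lborel (\<lambda>x. indicator {c..c + e} x *\<^sub>R (f x * (step_deriv ((x - c) / e) / e)))"
    using assms by (intro borel_integrable_compact continuous_intros
      continuous_on_compose2[OF continuous_on_step_deriv[of UNIV]]) auto
  also have "(\<lambda>x. indicator {c..c + e} x *\<^sub>R (f x * (step_deriv ((x - c) / e) / e))) = ?k"
    using assms(2) sd by (auto simp: indicator_def fun_eq_iff)
  finally show "integrable lborel ?k" .
  have "(LINT x|lborel. ?k x) = \<bar>e\<bar> *\<^sub>R (LINT u|lborel. ?k (c + e * u))"
    by (rule lborel_integral_real_affine) (use assms in auto)
  also have "\<dots> = (LINT u|lborel. e * ?k (c + e * u))"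
    using assms(1) by simp
  also have "\<dots> = (LINT u|lborel. indicator {0..1} u * f (c + e * u) * step_deriv u)"
  proof (intro Bochner_Integration.integral_cong refl)
    fix u :: real
    show "e * ?k (c + e * u) = indicator {0..1} u * f (c + e * u) * step_deriv u"
    proof (cases "u \<in> {0<..<1}")
      case True
      then have "c + e * u \<in> {c..c + e}" using assms(1) by auto
      then have "c + e * u \<in> U" using assms(2) by blast
      then show ?thesis using True assms(1) by (simp add: indicator_def)
    qed (use assms(1) in \<open>simp add: step_deriv_eq_0\<close>)
  qed
  finally show "(LINT x|lborel. ?k x) = (LINT u|lborel. indicator {0..1} u * f (c + e * u) * step_deriv u)" .
qed

text \<open>The rescaled densities form an approximate identity concentrated to the right of
  \<open>c\<close>. Continuity gives the pointwise limit and boundedness of \<open>f\<close> on the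
  compact interval gives the majorant.\<close>

lemma LINT_rescaled_step_deriv_tendsto:
  assumes "d > 0" "continuous_on {c..c + d} f"
  shows "(\<lambda>n. LINT u|lborel. indicator {0..1} u * f (c + d / real (Suc n) * u) * step_deriv u) \<longlonglongrightarrow> f c"
proof -
  have in_Icc: "c + d / real (Suc n) * u \<in> {c..c + d}" if "u \<in> {0..1}" for u n
  proof -
    have "d / real (Suc n) * u \<le> d * 1"
      using that assms(1) by (intro mult_mono) (auto simp: field_simps)
    then show ?thesis using that assms(1) by auto
  qed
  have "bounded (f ` {c..c + d})"
    by (intro compact_imp_bounded compact_continuous_image assms) auto
  then obtain B where B: "\<And>x. x \<in> {c..c + d} \<Longrightarrow> \<bar>f x\<bar> \<le> B"
    unfolding bounded_iff by fastforce
  have "(\<lambda>n. LINT u|lborel. indicator {0..1} u * f (c + d / real (Suc n) * u) * step_deriv u) \<longlonglongrightarrow>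
      (LINT u|lborel. f c * step_deriv u)"
  proof (rule integral_dominated_convergence[where w = "\<lambda>u. B * step_deriv u"])
    show "(\<lambda>u. indicator {0..1} u * f (c + d / real (Suc n) * u) * step_deriv u) \<in> borel_measurable lborel" for n
    proof -
      have "continuous_on {0..1} (\<lambda>u. f (c + d / real (Suc n) * u) * step_deriv u)"
        using in_Icc by (intro continuous_intros continuous_on_compose2[OF assms(2)] continuous_on_step_deriv) auto
      then have "(\<lambda>u. indicator {0..1} u *\<^sub>R (f (c + d / real (Suc n) * u) * step_deriv u)) \<in> borel_measurable borel"
        by (rule borel_measurable_continuous_on_indicator[rotated]) auto
      then show ?thesis by (simp add: mult.assoc)
    qed
    show "AE u in lborel. (\<lambda>n. indicator {0..1} u * f (c + d / real (Suc n) * u) * step_deriv u) \<longlonglongrightarrow> f c * step_deriv u"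
    proof (intro AE_I2)
      fix u :: real
      show "(\<lambda>n. indicator {0..1} u * f (c + d / real (Suc n) * u) * step_deriv u) \<longlonglongrightarrow> f c * step_deriv u"
      proof (cases "u \<in> {0..1}")
        case True
        have "(\<lambda>n. d / real (Suc n)) \<longlonglongrightarrow> 0"
          using LIMSEQ_inverse_real_of_nat[THEN tendsto_mult_left, of d] by (simp add: divide_inverse)
        then have "(\<lambda>n. c + d / real (Suc n) * u) \<longlonglongrightarrow> c + 0 * u"
          by (intro tendsto_intros)
        then have "(\<lambda>n. f (c + d / real (Suc n) * u)) \<longlonglongrightarrow> f c"
          using in_Icc[OF True] assms(1)
          by (intro continuous_on_tendsto_compose[OF assms(2), of _ c]) auto
        then show ?thesis using True by (auto intro: tendsto_mult)
      qed (auto simp: step_deriv_eq_0)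
    qed
    show "integrable lborel (\<lambda>u. B * step_deriv u)"
      by (intro integrable_mult_right LINT_step_deriv)
    show "AE u in lborel. norm (indicator {0..1} u * f (c + d / real (Suc n) * u) * step_deriv u) \<le> B * step_deriv u" for n
      using B[OF in_Icc] by (auto simp: indicator_def abs_mult step_deriv_nonneg step_deriv_eq_0 intro!: mult_right_mono)
  qed simp
  then show ?thesis by (simp add: LINT_step_deriv)
qed

lemma plateau_bounds: "0 < e \<Longrightarrow> a \<le> b \<Longrightarrow> 0 \<le> plateau a b e x" "plateau a b e x \<le> 1"
  using smooth_step_mono[of "(x - b) / e" "(x - a) / e"] smooth_step_bounds(2)[of "(x - a) / e"]
    smooth_step_bounds(1)[of "(x - b) / e"]
  by (auto simp: plateau_def divide_right_mono)

lemma plateau_tendsto: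
  assumes "d > 0" "a \<le> b" "x \<noteq> a"
  shows "(\<lambda>n. plateau a b (d / real (Suc n)) x) \<longlonglongrightarrow> indicator {a..b} x"
proof -
  have ev: "\<forall>\<^sub>F n in sequentially. smooth_step ((x - c) / (d / real (Suc n))) = 1" if "x > c" for c
  proof -
    have "filterlim (\<lambda>n. (x - c) / d * real (Suc n)) at_top sequentially"
      using that assms(1)
      by (intro filterlim_tendsto_pos_mult_at_top[OF tendsto_const] filterlim_compose[OF filterlim_real_sequentially filterlim_Suc]) auto
    then have "\<forall>\<^sub>F n in sequentially. 1 \<le> (x - c) / d * real (Suc n)"
      by (simp add: filterlim_at_top)
    then show ?thesis
      by eventually_elim (simp add: smooth_step_eq_1)
  qed
  have zero: "smooth_step ((x - c) / (d / real (Suc n))) = 0" if "x \<le> c" for c n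
    using that assms(1) by (intro smooth_step_eq_0 divide_nonpos_pos) auto
  consider "x < a" | "a < x" "x \<le> b" | "x > b" using assms(3) by linarith
  then have "\<forall>\<^sub>F n in sequentially. plateau a b (d / real (Suc n)) x = indicator {a..b} x"
  proof cases
    case 1
    then show ?thesis using assms zero by (simp add: plateau_def del: of_nat_Suc)
  next
    case 2
    from ev[OF this(1)] show ?thesis
      by eventually_elim (use 2 zero in \<open>simp add: plateau_def del: of_nat_Suc\<close>)
  next
    case 3
    with assms have "x > a" by simp
    from ev[OF this] ev[OF 3] show ?thesis
      by eventually_elim (use 3 in \<open>simp add: plateau_def del: of_nat_Suc\<close>)
  qed
  then show ?thesis by (rule tendsto_eventually)
qed

text \<open>Test the weak derivative against smooth approximations of the indicator of \<open>{a..b}\<close>.\<close>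

lemma weak_deriv_imp_primitive:
  assumes "open U" "is_interval U" "continuous_on U f" "has_weak_deriv_on U f g"
  shows "primitive_on U f g"
  unfolding primitive_on_def
proof (intro ballI impI conjI)
  fix a b assume ab: "a \<in> U" "b \<in> U" "a \<le> b"
  have Icc: "{x..y} \<subseteq> U" if "x \<in> U" "y \<in> U" for x y
    using that assms(2) by (meson atLeastAtMost_iff mem_is_interval_1_I subsetI)
  have "{a..b} \<subseteq> U" using ab by (simp add: Icc)
  then show "set_integrable lborel {a..b} g"
    using assms(4) by (auto simp: has_weak_deriv_on_def locally_integrable_def)
  obtain d0 where d0: "d0 > 0" "ball b d0 \<subseteq> U" using assms(1) ab(2) by (auto simp: open_contains_ball)
  \<comment> \<open>The plateaus reach up to \<open>b + e n\<close>, so room to the right of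
    \<open>b\<close> is needed inside \<open>U\<close>; half the radius keeps \<open>b + d\<close>
    inside the open ball.\<close>
  define d where "d = d0 / 2"
  have d: "d > 0" using d0 by (simp add: d_def)
  have "b + d \<in> ball b d0" using d0 by (auto simp: d_def dist_real_def)
  then have "b + d \<in> U" using d0 by blast
  then have sub: "{a..b + d} \<subseteq> U" using ab by (simp add: Icc)
  define e where "e n = d / real (Suc n)" for n
  have e: "e n > 0" "e n \<le> d" for n using d by (auto simp: e_def field_simps)
  have g_int: "set_integrable lborel {a..b + d} g"
    using assms(4) sub by (auto simp: has_weak_deriv_on_def locally_integrable_def)
  let ?\<phi> = "\<lambda>n. plateau a b (e n)"
  have eq: "(LINT x:U|lborel. f x * deriv (?\<phi> n) x) =
      (LINT u|lborel. indicator {0..1} u * f (a + e n * u) * step_deriv u) -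
      (LINT u|lborel. indicator {0..1} u * f (b + e n * u) * step_deriv u)" for n
  proof -
    have sub': "{a..a + e n} \<subseteq> U" "{b..b + e n} \<subseteq> U"
      using e[of n] ab sub by (force simp: subset_iff)+
    note A = LINT_rescaled_step_deriv[OF e(1) sub'(1) continuous_on_subset[OF assms(3) sub'(1)]]
    note B = LINT_rescaled_step_deriv[OF e(1) sub'(2) continuous_on_subset[OF assms(3) sub'(2)]]
    have "(LINT x:U|lborel. f x * deriv (?\<phi> n) x) = (LINT x|lborel.
        indicator U x * (f x * (step_deriv ((x - a) / e n) / e n)) -
        indicator U x * (f x * (step_deriv ((x - b) / e n) / e n)))"
      unfolding set_lebesgue_integral_def
      by (intro Bochner_Integration.integral_cong refl)
        (simp add: deriv_plateau e diff_divide_distrib algebra_simps)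
    then show ?thesis
      using A B by (simp add: Bochner_Integration.integral_diff)
  qed
  have "(\<lambda>n. LINT x:U|lborel. f x * deriv (?\<phi> n) x) \<longlonglongrightarrow> f a - f b"
    unfolding eq
  proof (rule tendsto_diff)
    show "(\<lambda>n. LINT u|lborel. indicator {0..1} u * f (a + e n * u) * step_deriv u) \<longlonglongrightarrow> f a"
      unfolding e_def using sub ab
      by (intro LINT_rescaled_step_deriv_tendsto d continuous_on_subset[OF assms(3)]) (auto simp: subset_iff)
    show "(\<lambda>n. LINT u|lborel. indicator {0..1} u * f (b + e n * u) * step_deriv u) \<longlonglongrightarrow> f b"
      unfolding e_def using sub ab
      by (intro LINT_rescaled_step_deriv_tendsto d continuous_on_subset[OF assms(3)]) (auto simp: subset_iff)
  qed
  moreover have "(\<lambda>n. LINT x:U|lborel. g x * ?\<phi> n x) \<longlonglongrightarrow> (LINT x:{a..b}|lborel. g x)"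
    unfolding set_lebesgue_integral_def
  proof (rule integral_dominated_convergence[where w = "\<lambda>x. \<bar>indicator {a..b + d} x *\<^sub>R g x\<bar>"])
    have outside: "?\<phi> n x = 0" if "x \<notin> {a..b + d}" for n x
      using that e[of n] ab by (intro plateau_eq_0) auto
    have eq': "indicator U x *\<^sub>R (g x * ?\<phi> n x) = indicator {a..b + d} x *\<^sub>R g x * ?\<phi> n x" for n x
      using sub outside[of x n] by (auto simp: indicator_def)
    have [measurable]: "(\<lambda>x. indicator {a..b + d} x *\<^sub>R g x) \<in> borel_measurable borel"
      using g_int by (auto simp: set_integrable_def dest: borel_measurable_integrable)
    have [measurable]: "?\<phi> n \<in> borel_measurable borel" for n
      using has_real_derivative_plateau[OF e(1)]
      by (intro borel_measurable_continuous_onI DERIV_continuous_on)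
        (blast intro: has_field_derivative_at_within)
    show "(\<lambda>x. indicator U x *\<^sub>R (g x * ?\<phi> n x)) \<in> borel_measurable lborel" for n
      unfolding eq' by measurable
    have restr: "(\<lambda>x. indicator {a..b} x *\<^sub>R g x) = (\<lambda>x. indicator {a..b} x * (indicator {a..b + d} x *\<^sub>R g x))"
      using d by (auto simp: indicator_def)
    show "(\<lambda>x. indicator {a..b} x *\<^sub>R g x) \<in> borel_measurable lborel"
      unfolding restr by measurable
    show "integrable lborel (\<lambda>x. \<bar>indicator {a..b + d} x *\<^sub>R g x\<bar>)"
      using g_int unfolding set_integrable_def by (rule integrable_abs)
    \<comment> \<open>At the point \<open>a\<close> all plateaus are 0 while the indicator is 1, so
      convergence holds only almost everywhere.\<close>
    show "AE x in lborel. (\<lambda>n. indicator U x *\<^sub>R (g x * ?\<phi> n x)) \<longlonglongrightarrow> indicator {a..b} x *\<^sub>R g x"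
      using AE_lborel_singleton[of a]
    proof eventually_elim
      case (elim x)
      have "(\<lambda>n. indicator {a..b + d} x *\<^sub>R g x * ?\<phi> n x) \<longlonglongrightarrow>
          indicator {a..b + d} x *\<^sub>R g x * indicator {a..b} x"
        unfolding e_def by (intro tendsto_mult tendsto_const plateau_tendsto d ab elim)
      also have "indicator {a..b + d} x *\<^sub>R g x * indicator {a..b} x = indicator {a..b} x *\<^sub>R g x"
        using d by (auto simp: indicator_def)
      finally show ?case unfolding eq' .
    qed
    show "AE x in lborel. norm (indicator U x *\<^sub>R (g x * ?\<phi> n x)) \<le> \<bar>indicator {a..b + d} x *\<^sub>R g x\<bar>" for n
      unfolding eq' using plateau_bounds(1)[OF e(1) ab(3)] plateau_bounds(2)
      by (auto simp: abs_mult intro!: mult_left_le)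
  qed
  moreover have "(LINT x:U|lborel. f x * deriv (?\<phi> n) x) = - (LINT x:U|lborel. g x * ?\<phi> n x)" for n
  proof -
    have "test_function U (?\<phi> n)"
      using e[of n] ab sub by (intro test_function_plateau) (auto simp: subset_iff)
    then show ?thesis using assms(4) by (auto simp: has_weak_deriv_on_def)
  qed
  ultimately have "f a - f b = - (LINT x:{a..b}|lborel. g x)"
    by (metis (no_types, lifting) LIMSEQ_unique ext tendsto_minus)
  then show "f b - f a = (LINT x:{a..b}|lborel. g x)" by simp
qed

section \<open>Primitives of bounded functions and their weak derivatives\<close>

lemma set_integrable_bounded_Icc:
  fixes g :: "real \<Rightarrow> real"
  assumes "g \<in> borel_measurable borel" "\<And>x. \<bar>g x\<bar> \<le> C"
  shows "set_integrable lborel {a..b} g"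
  unfolding set_integrable_def
  by (rule integrableI_bounded_set[where A = "{a..b}" and B = C])
    (use assms in \<open>auto simp: indicator_def emeasure_lborel_Icc_eq\<close>)

lemma primitive_exists:
  assumes "g \<in> borel_measurable borel" "\<And>x. \<bar>g x\<bar> \<le> C"
  obtains f where "primitive_on UNIV f g"
proof
  \<comment> \<open>The oriented integral from 0 to \<open>x\<close>: at least one of the two
    intervals is empty or a single point.\<close>
  define f where "f x = integral {0..x} g - integral {x..0} g" for x
  note int = set_integrable_bounded_Icc[OF assms]
  note io = set_borel_integral_eq_integral(1)[OF int]
  show "primitive_on UNIV f g"
    unfolding primitive_on_def
  proof (intro ballI impI conjI int)
    fix a b :: real assume "a \<le> b"
    have split: "integral {u..v} g + integral {v..w} g = integral {u..w} g" if "u \<le> v" "v \<le> w" for u v w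
      using that io by (intro Henstock_Kurzweil_Integration.integral_combine) auto
    have triv: "integral {u..v} g = 0" if "v \<le> u" for u v
      using that by (cases "u = v") auto
    have "f b - f a = integral {a..b} g"
    proof -
      consider "0 \<le> a" | "b \<le> 0" | "a < 0" "0 < b" using \<open>a \<le> b\<close> by linarith
      then show ?thesis
        by cases (use \<open>a \<le> b\<close> split[of 0 a b] split[of a b 0] split[of a 0 b] triv[of 0 a] triv[of 0 b]
          triv[of a 0] triv[of b 0] in \<open>auto simp: f_def\<close>)
    qed
    then show "f b - f a = (LINT s:{a..b}|lborel. g s)"
      using set_borel_integral_eq_integral(2)[OF int] by simp
  qed
qed

lemma primitive_on_subset: "primitive_on S f g \<Longrightarrow> T \<subseteq> S \<Longrightarrow> primitive_on T f g"
  by (auto simp: primitive_on_def)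

lemma primitive_Lipschitz:
  assumes "primitive_on S f g" "\<And>x. \<bar>g x\<bar> \<le> C" "a \<in> S" "b \<in> S"
  shows "\<bar>f b - f a\<bar> \<le> C * \<bar>b - a\<bar>"
proof -
  have *: "\<bar>f b - f a\<bar> \<le> C * \<bar>b - a\<bar>" if "a \<le> b" "a \<in> S" "b \<in> S" for a b
  proof -
    note p = primitive_onD[OF assms(1) that(2,3,1)]
    have "norm (integral {a..b} g) \<le> integral {a..b} (\<lambda>x. C)"
      using assms(2) by (intro integral_norm_bound_integral set_borel_integral_eq_integral(1)[OF p(1)]) auto
    then show ?thesis
      using p(2) set_borel_integral_eq_integral(2)[OF p(1)] that(1) by (simp add: mult.commute)
  qed
  show ?thesis
  proof (cases "a \<le> b")
    case False
    then show ?thesis using *[of b a] assms(3,4) by (simp add: abs_minus_commute)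
  qed (use * assms in auto)
qed

lemma primitive_continuous_on:
  assumes "primitive_on S f g" "\<And>x. \<bar>g x\<bar> \<le> C"
  shows "continuous_on S f"
proof (rule lipschitz_on_continuous_on)
  show "C-lipschitz_on S f"
    using primitive_Lipschitz[OF assms] order_trans[OF abs_ge_zero assms(2)]
    by (intro lipschitz_onI) (auto simp: dist_real_def abs_minus_commute)
qed

lemma test_function_deriv:
  assumes "test_function U \<phi>"
  shows "(\<phi> has_real_derivative deriv \<phi> x) (at x)" "continuous_on S (deriv \<phi>)"
proof -
  have "(deriv ^^ n) \<phi> differentiable_on UNIV" for n
    using assms by (simp add: test_function_def)
  from this[of 0] this[of 1] have d: "\<phi> differentiable_on UNIV" "deriv \<phi> differentiable_on UNIV"
    by simp_all
  show "(\<phi> has_real_derivative deriv \<phi> x) (at x)"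
    using d(1) by (simp add: differentiable_on_def DERIV_deriv_iff_real_differentiable)
  show "continuous_on S (deriv \<phi>)"
    using differentiable_imp_continuous_on[OF d(2)] by (rule continuous_on_subset) simp
qed

text \<open>Stepping slightly beyond the extreme points of the compact support, within the open set
  \<open>U\<close>, makes \<phi> vanish at both end points as well. The partial integration below
  then has no boundary terms.\<close>

lemma test_function_support:
  assumes "open U" "is_interval U" "U \<noteq> {}" "test_function U \<phi>"
  obtains A B where "A \<in> U" "B \<in> U" "A \<le> B" "\<And>x. x \<notin> {A<..<B} \<Longrightarrow> \<phi> x = 0"
proof -
  define K where "K = closure {x. \<phi> x \<noteq> 0}"
  have K: "compact K" "K \<subseteq> U" using assms(4) by (auto simp: test_function_def K_def)
  have \<phi>: "\<phi> x = 0" if "x \<notin> K" for x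
    using that closure_subset[of "{x. \<phi> x \<noteq> 0}"] by (auto simp: K_def)
  show ?thesis
  proof (cases "K = {}")
    case True
    obtain u where "u \<in> U" using assms(3) by blast
    then show ?thesis using that[of u u] \<phi> True by auto
  next
    case False
    obtain s where s: "s \<in> K" "\<And>x. x \<in> K \<Longrightarrow> s \<le> x"
      using compact_attains_inf[OF K(1) False] by blast
    obtain t where t: "t \<in> K" "\<And>x. x \<in> K \<Longrightarrow> x \<le> t"
      using compact_attains_sup[OF K(1) False] by blast
    obtain d where d: "d > 0" "cball s d \<subseteq> U"
      using assms(1) s(1) K(2) by (meson open_contains_cball subsetD)
    obtain e where e: "e > 0" "cball t e \<subseteq> U"
      using assms(1) t(1) K(2) by (meson open_contains_cball subsetD)
    have "s - d \<in> U" "t + e \<in> U"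
      using d e by (auto simp: dist_real_def subset_iff)
    moreover have "x \<in> {s - d<..<t + e}" if "x \<in> K" for x
      using s(2)[OF that] t(2)[OF that] d(1) e(1) by auto
    moreover have "s - d \<le> t + e" using s(2)[OF t(1)] d(1) e(1) by simp
    ultimately show ?thesis using that[of "s - d" "t + e"] \<phi> by blast
  qed
qed

text \<open>Integration by parts through Fubini: f x - f A is the integral of \<open>g\<close> from
  \<open>A\<close> to \<open>x\<close>, and exchanging the order on the triangle A \<le> s \<le> x
  \<le> B leaves the integral of the derivative of \<phi> from \<open>s\<close> to \<open>B\<close>,
  which is - \<phi> s. The constant f A drops out because that derivative has integral 0.\<close>

lemma primitive_imp_weak_deriv:
  assumes "open U" "is_interval U" "primitive_on U f g"
    and g: "g \<in> borel_measurable borel" "\<And>x. \<bar>g x\<bar> \<le> C"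
  shows "has_weak_deriv_on U f g"
  unfolding has_weak_deriv_on_def
proof (intro conjI allI impI)
  have cont: "continuous_on U f" using primitive_continuous_on[OF assms(3) g(2)] .
  show "locally_integrable U f"
    unfolding locally_integrable_def set_integrable_def
    by (intro allI impI borel_integrable_compact continuous_on_subset[OF cont]) auto
  show "locally_integrable U g"
    unfolding locally_integrable_def set_integrable_def
  proof (intro allI impI)
    fix K :: "real set" assume K: "compact K \<and> K \<subseteq> U"
    have [measurable]: "K \<in> sets borel" "g \<in> borel_measurable borel"
      using K g(1) by (auto intro: borel_compact)
    have 1: "(\<lambda>x. indicator K x *\<^sub>R g x) \<in> borel_measurable lborel"
      by measurable
    have 2: "emeasure lborel K < \<infinity>"
      by (rule emeasure_bounded_finite[OF compact_imp_bounded[OF conjunct1[OF K]]])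
    show "integrable lborel (\<lambda>x. indicator K x *\<^sub>R g x)"
    proof (rule integrableI_bounded_set[OF _ 1 2])
      show "K \<in> sets lborel" using K by (simp add: borel_compact)
      have "norm (indicator K x *\<^sub>R g x) \<le> C" if "x \<in> K" for x
        using that g(2)[of x] by simp
      then show "AE x in lborel. x \<in> K \<longrightarrow> norm (indicator K x *\<^sub>R g x) \<le> C"
        by (intro AE_I2 impI)
      show "AE x in lborel. x \<notin> K \<longrightarrow> indicator K x *\<^sub>R g x = 0"
        by (intro AE_I2 impI) (metis indicator_simps(2) scaleR_zero_left)
    qed
  qed
  fix \<phi> assume tf: "test_function U \<phi>"
  show "(LINT x:U|lborel. f x * deriv \<phi> x) = - (LINT x:U|lborel. g x * \<phi> x)"
  proof (cases "U = {}")
    case False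
    obtain A B where AB: "A \<in> U" "B \<in> U" "A \<le> B" and supp: "\<And>x. x \<notin> {A<..<B} \<Longrightarrow> \<phi> x = 0"
      using test_function_support[OF assms(1,2) False tf] by blast
    have sub: "{A..B} \<subseteq> U"
      using AB assms(2) by (meson atLeastAtMost_iff mem_is_interval_1_I subsetI)
    let ?d = "deriv \<phi>"
    note d = test_function_deriv[OF tf]
    have d0: "?d x = 0" if "x \<notin> {A..B}" for x
    proof -
      have "((\<lambda>x. 0) has_real_derivative ?d x) (at x) "
        by (rule has_field_derivative_transform_within_open[OF d(1), where S = "- {A..B}"])
          (use that supp in auto)
      then show ?thesis by (metis DERIV_const DERIV_unique)
    qed
    have FTC: "(LINT x:{s..B}|lborel. ?d x) = - \<phi> s" "set_integrable lborel {s..B} ?d" if "s \<le> B" for s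
    proof -
      show "set_integrable lborel {s..B} ?d"
        unfolding set_integrable_def by (rule borel_integrable_compact) (auto intro: d)
      then have "(LINT x:{s..B}|lborel. ?d x) = integral {s..B} ?d"
        by (rule set_borel_integral_eq_integral)
      also have "\<dots> = \<phi> B - \<phi> s"
        using that by (intro integral_unique fundamental_theorem_of_calculus)
          (auto intro: d has_field_derivative_at_within simp flip: has_real_derivative_iff_has_vector_derivative)
      finally show "(LINT x:{s..B}|lborel. ?d x) = - \<phi> s"
        using supp[of B] by simp
    qed
    have "bounded (?d ` {A..B})"
      by (intro compact_imp_bounded compact_continuous_image d) auto
    then obtain D where D: "\<And>x. x \<in> {A..B} \<Longrightarrow> \<bar>?d x\<bar> \<le> D"
      unfolding bounded_iff by fastforce
    have [measurable]: "?d \<in> borel_measurable borel" "g \<in> borel_measurable borel"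
      using d(2) g(1) by (auto intro: borel_measurable_continuous_onI)
    define k where "k x s = indicator {A..B} x * indicator {A..x} s * g s * ?d x" for x s
    have C: "C \<ge> 0" using g(2) order_trans[OF abs_ge_zero] by blast
    have k_int: "integrable (lborel \<Otimes>\<^sub>M lborel) (case_prod k)"
    proof (rule integrableI_bounded_set[where A = "{A..B} \<times> {A..B}" and B = "C * D"])
      show "case_prod k \<in> borel_measurable (lborel \<Otimes>\<^sub>M lborel)"
        unfolding k_def indicator_def atLeastAtMost_iff by measurable
      show "emeasure (lborel \<Otimes>\<^sub>M lborel) ({A..B} \<times> {A..B}) < \<infinity>"
        by (subst lborel.emeasure_pair_measure_Times) (auto simp: AB(3) ennreal_mult_less_top)
      have "\<bar>g s * ?d x\<bar> \<le> C * D" if "x \<in> {A..B}" for s x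
        unfolding abs_mult by (intro mult_mono g D that C) auto
      then show "AE z in lborel \<Otimes>\<^sub>M lborel. z \<in> {A..B} \<times> {A..B} \<longrightarrow> norm (case_prod k z) \<le> C * D"
        using C D[of A] AB(3)
        by (intro AE_I2) (auto simp: k_def indicator_def mult.assoc)
      show "AE z in lborel \<Otimes>\<^sub>M lborel. z \<notin> {A..B} \<times> {A..B} \<longrightarrow> case_prod k z = 0"
        by (auto simp: k_def indicator_def)
    qed auto
    have inner1: "(LINT s|lborel. k x s) = indicator {A..B} x * (f x - f A) * ?d x" for x
    proof (cases "x \<in> {A..B}")
      case True
      then have "f x - f A = (LINT s:{A..x}|lborel. g s)"
        using AB sub by (intro primitive_onD(2)[OF assms(3)]) auto
      moreover have "(LINT s|lborel. k x s) = (LINT s|lborel. (indicator {A..x} s *\<^sub>R g s) * ?d x)"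
        using True by (simp add: k_def)
      ultimately show ?thesis using True by (simp add: set_lebesgue_integral_def)
    qed (simp add: k_def)
    have inner2: "(LINT x|lborel. k x s) = - (indicator {A..B} s * g s * \<phi> s)" for s
    proof (cases "s \<in> {A..B}")
      case True
      have "(LINT x|lborel. k x s) = (LINT x|lborel. g s * (indicator {s..B} x *\<^sub>R ?d x))"
        using True by (intro Bochner_Integration.integral_cong) (auto simp: k_def indicator_def)
      also have "\<dots> = g s * - \<phi> s"
        using True FTC(1)[of s] by (simp add: set_lebesgue_integral_def)
      finally show ?thesis using True by simp
    next
      case False
      then have "k x s = 0" for x by (auto simp: k_def indicator_def)
      then show ?thesis using False by simp
    qed
    have "(LINT x:U|lborel. f x * ?d x) = (LINT x|lborel. indicator {A..B} x * (f x - f A) * ?d x +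
        f A * (indicator {A..B} x *\<^sub>R ?d x))"
      unfolding set_lebesgue_integral_def
      by (intro Bochner_Integration.integral_cong)
        (use sub d0 in \<open>auto simp: indicator_def algebra_simps\<close>)
    also have "\<dots> = (LINT x|lborel. indicator {A..B} x * (f x - f A) * ?d x) +
        (LINT x|lborel. f A * (indicator {A..B} x *\<^sub>R ?d x))"
    proof (rule Bochner_Integration.integral_add)
      show "integrable lborel (\<lambda>x. indicator {A..B} x * (f x - f A) * ?d x)"
        using lborel_pair.integrable_fst[OF k_int] by (simp add: inner1)
      show "integrable lborel (\<lambda>x. f A * (indicator {A..B} x *\<^sub>R ?d x))"
        using FTC(2)[OF AB(3)] unfolding set_integrable_def by (rule integrable_mult_right)
    qed
    also have "(LINT x|lborel. f A * (indicator {A..B} x *\<^sub>R ?d x)) = 0"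
      using FTC(1)[OF AB(3)] supp[of A] by (simp add: set_lebesgue_integral_def)
    also have "(LINT x|lborel. indicator {A..B} x * (f x - f A) * ?d x) = (LINT x|lborel. LINT s|lborel. k x s)"
      by (simp only: inner1)
    also have "\<dots> = (LINT s|lborel. LINT x|lborel. k x s)"
      by (rule lborel_pair.Fubini_integral[OF k_int, symmetric])
    also have "\<dots> = - (LINT s:U|lborel. g s * \<phi> s)"
    proof -
      have "indicator {A..B} s * g s * \<phi> s = indicator U s *\<^sub>R (g s * \<phi> s)" for s
        using sub supp[of s] by (cases "s \<in> {A..B}") (auto simp: subset_iff)
      then show ?thesis
        unfolding inner2 set_lebesgue_integral_def Bochner_Integration.integral_minus
        by (simp only:)
    qed
    finally show ?thesis by simp
  qed (simp add: set_lebesgue_integral_def)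
qed

text \<open>Test functions live in the open interval and do not see 0, but the value there matters,
  since a measure on [0,1) may have an atom at 0. Continuity of \<open>f\<close> at 0 and
  integrability of \<open>g\<close> up to 0 allow the left end point to tend to 0.\<close>

lemma primitive_on_extend_0:
  assumes "continuous_on {0..<1} f" "primitive_on {0<..<1} f g" "set_integrable lborel {0..<1} g"
  shows "primitive_on {0..<1} f g"
proof -
  have int: "set_integrable lborel {a..b} g" if "0 \<le> a" "b < 1" for a b
    using assms(3) by (rule set_integrable_subset) (use that in auto)
  have base: "f x - f 0 = (LINT s:{0..x}|lborel. g s)" if x: "0 < x" "x < 1" for x
  proof -
    define a where "a n = x / real (Suc (Suc n))" for n
    have a: "0 < a n" "a n \<le> x" "a n < 1" for n
      using x by (auto simp: a_def field_simps intro: less_le_trans)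
    have lim_a: "a \<longlonglongrightarrow> 0"
      unfolding a_def by (intro tendsto_divide_0[OF tendsto_const] filterlim_at_top_imp_at_infinity
        filterlim_compose[OF filterlim_real_sequentially] filterlim_compose[OF filterlim_Suc] filterlim_Suc)
    have "(\<lambda>n. LINT s:{a n..x}|lborel. g s) \<longlonglongrightarrow> (LINT s:{0..x}|lborel. g s)"
      unfolding set_lebesgue_integral_def
    proof (rule integral_dominated_convergence[where w = "\<lambda>s. \<bar>indicator {0..x} s *\<^sub>R g s\<bar>"])
      show "integrable lborel (\<lambda>s. \<bar>indicator {0..x} s *\<^sub>R g s\<bar>)"
        using int[of 0 x] x unfolding set_integrable_def by (intro integrable_abs) auto
      show "(\<lambda>s. indicator {a n..x} s *\<^sub>R g s) \<in> borel_measurable lborel" for n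
        using int[of "a n" x] x a[of n] unfolding set_integrable_def by (intro borel_measurable_integrable) auto
      show "(\<lambda>s. indicator {0..x} s *\<^sub>R g s) \<in> borel_measurable lborel"
        using int[of 0 x] x unfolding set_integrable_def by (intro borel_measurable_integrable) auto
      show "AE s in lborel. norm (indicator {a n..x} s *\<^sub>R g s) \<le> \<bar>indicator {0..x} s *\<^sub>R g s\<bar>" for n
        using a(1)[of n] by (intro AE_I2) (auto simp: indicator_def)
      show "AE s in lborel. (\<lambda>n. indicator {a n..x} s *\<^sub>R g s) \<longlonglongrightarrow> indicator {0..x} s *\<^sub>R g s"
        using AE_lborel_singleton[of 0]
      proof eventually_elim
        case (elim s)
        have "\<forall>\<^sub>F n in sequentially. indicator {a n..x} s *\<^sub>R g s = indicator {0..x} s *\<^sub>R g s"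
        proof (cases "s > 0")
          case True
          then have "\<forall>\<^sub>F n in sequentially. a n < s" using order_tendstoD(2)[OF lim_a] by blast
          then show ?thesis by eventually_elim (use True in \<open>auto simp: indicator_def\<close>)
        next
          case False
          then show ?thesis using elim a(1) by (intro always_eventually allI) (smt (verit) atLeastAtMost_iff indicator_simps(2))
        qed
        then show ?case by (rule tendsto_eventually)
      qed
    qed
    moreover have "(LINT s:{a n..x}|lborel. g s) = f x - f (a n)" for n
      using primitive_onD(2)[OF assms(2), of "a n" x] a[of n] x by simp
    moreover have "(\<lambda>n. f x - f (a n)) \<longlonglongrightarrow> f x - f 0"
      using a lim_a by (intro tendsto_diff tendsto_const continuous_on_tendsto_compose[OF assms(1)])
        (auto intro!: always_eventually less_imp_le)
    ultimately show ?thesis using LIMSEQ_unique by auto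
  qed
  have zero: "(LINT s:{0..0}|lborel. g s) = 0"
    using set_borel_integral_eq_integral(2)[OF int[of 0 0]] by simp
  show ?thesis
    unfolding primitive_on_def
  proof (intro ballI impI conjI)
    fix a b :: real assume ab: "a \<in> {0..<1}" "b \<in> {0..<1}" "a \<le> b"
    show "set_integrable lborel {a..b} g" using ab by (intro int) auto
    show "f b - f a = (LINT s:{a..b}|lborel. g s)"
    proof (cases "a = 0 \<or> b = 0")
      case True
      then show ?thesis using base[of b] zero ab by (cases "b = 0") auto
    next
      case False
      then show ?thesis using primitive_onD(2)[OF assms(2), of a b] ab by auto
    qed
  qed
qed

section \<open>Periodic integrands and the uniform measure\<close>

lemma space_unif_interval[simp]: "space unif_interval = {0..<1}"
  by (simp add: unif_interval_def space_restrict_space)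

lemma sets_unif_interval: "sets unif_interval = sets (restrict_space borel {0..<1})"
  by (simp add: unif_interval_def sets_restrict_space)

lemma prob_space_unif_interval: "prob_space unif_interval"
  by (auto simp: unif_interval_def emeasure_restrict_space space_restrict_space intro!: prob_spaceI)

interpretation unif: prob_space unif_interval
  by (rule prob_space_unif_interval)

lemma measurable_unif_interval[measurable (raw)]:
  "f \<in> measurable borel N \<Longrightarrow> f \<in> measurable unif_interval N"
  unfolding unif_interval_def by (intro measurable_restrict_space1) simp

lemma nn_integral_unif_interval:
  "(\<integral>\<^sup>+x. f x \<partial>unif_interval) = (\<integral>\<^sup>+x. f x * indicator {0..<1} x \<partial>lborel)"
  unfolding unif_interval_def by (rule nn_integral_restrict_space) simp

lemma integral_unif_interval:
  fixes f :: "real \<Rightarrow> real"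
  shows "(LINT x|unif_interval. f x) = (LINT x:{0..<1}|lborel. f x)"
  unfolding unif_interval_def set_lebesgue_integral_def by (rule integral_restrict_space) simp

lemma integrable_unif_interval:
  fixes f :: "real \<Rightarrow> real"
  shows "integrable unif_interval f \<longleftrightarrow> set_integrable lborel {0..<1} f"
  unfolding unif_interval_def set_integrable_def by (rule integrable_restrict_space) simp

lemma AE_unif_interval:
  "AE x in lborel. P x \<Longrightarrow> AE x in unif_interval. P x"
  unfolding unif_interval_def by (subst AE_restrict_space_iff) auto

lemma integrable_unif_interval_bounded:
  fixes f :: "real \<Rightarrow> real"
  assumes "f \<in> borel_measurable unif_interval" "\<And>x. x \<in> {0..<1} \<Longrightarrow> \<bar>f x\<bar> \<le> B"
  shows "integrable unif_interval f"
  using assms by (intro unif.integrable_const_bound[where B = B] AE_I2) auto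

lemma periodic_add_int:
  fixes g :: "real \<Rightarrow> 'b"
  assumes "\<And>x. g (x + 1) = g x"
  shows "g (x + of_int k) = g x"
proof -
  have nat: "g (x + real n) = g x" for x n
  proof (induction n)
    case (Suc n)
    then show ?case using assms[of "x + real n"] by (simp add: add_ac)
  qed simp
  show ?thesis
  proof (cases "k \<ge> 0")
    case True
    then show ?thesis using nat[of x "nat k"] by simp
  next
    case False
    then show ?thesis using nat[of "x + of_int k" "nat (- k)"] by simp
  qed
qed

text \<open>Only the fractional part \<open>b\<close> of the shift counts. The window [b, 1 + b) is
  cut at 1 and the part beyond 1 is moved back by one period.\<close>

lemma nn_integral_periodic_shift:
  fixes g :: "real \<Rightarrow> ennreal"
  assumes [measurable]: "g \<in> borel_measurable borel" and per: "\<And>x. g (x + 1) = g x"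
  shows "(\<integral>\<^sup>+x. g (x + a) \<partial>unif_interval) = (\<integral>\<^sup>+x. g x \<partial>unif_interval)"
proof -
  define b where "b = frac a"
  have b: "0 \<le> b" "b < 1" by (auto simp: b_def frac_lt_1)
  have "g (x + a) = g (x + b)" for x
    using periodic_add_int[of g "x + b" "\<lfloor>a\<rfloor>", OF per] by (simp add: b_def frac_def)
  then have "(\<integral>\<^sup>+x. g (x + a) \<partial>unif_interval) = (\<integral>\<^sup>+x. g (b + 1 * x) * indicator {b..<1 + b} (b + 1 * x) \<partial>lborel)"
    unfolding nn_integral_unif_interval by (intro nn_integral_cong) (auto simp: indicator_def add.commute)
  also have "\<dots> = (\<integral>\<^sup>+x. g x * indicator {b..<1 + b} x \<partial>lborel)"
    using nn_integral_real_affine[of "\<lambda>x. g x * indicator {b..<1 + b} x" 1 b] by simp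
  also have "\<dots> = (\<integral>\<^sup>+x. g x * indicator {b..<1} x + g x * indicator {1..<1 + b} x \<partial>lborel)"
    using b by (intro nn_integral_cong) (auto simp: indicator_def)
  also have "\<dots> = (\<integral>\<^sup>+x. g x * indicator {b..<1} x \<partial>lborel) + (\<integral>\<^sup>+x. g x * indicator {1..<1 + b} x \<partial>lborel)"
    by (intro nn_integral_add) auto
  also have "(\<integral>\<^sup>+x. g x * indicator {1..<1 + b} x \<partial>lborel) = (\<integral>\<^sup>+x. g (1 + 1 * x) * indicator {1..<1 + b} (1 + 1 * x) \<partial>lborel)"
    using nn_integral_real_affine[of "\<lambda>x. g x * indicator {1..<1 + b} x" 1 1] by simp
  also have "\<dots> = (\<integral>\<^sup>+x. g x * indicator {0..<b} x \<partial>lborel)"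
    using per by (intro nn_integral_cong) (auto simp: indicator_def add.commute)
  also have "(\<integral>\<^sup>+x. g x * indicator {b..<1} x \<partial>lborel) + \<dots> =
      (\<integral>\<^sup>+x. g x * indicator {b..<1} x + g x * indicator {0..<b} x \<partial>lborel)"
    by (intro nn_integral_add[symmetric]) auto
  also have "\<dots> = (\<integral>\<^sup>+x. g x \<partial>unif_interval)"
    unfolding nn_integral_unif_interval using b by (intro nn_integral_cong) (auto simp: indicator_def)
  finally show ?thesis .
qed

text \<open>Substituting \<open>s = y + u\<close> makes the integrand periodic in \<open>y\<close> for fixed \<open>u\<close>, so the translation by
  \<open>u\<close> can be undone inside the integral over a period.\<close>

lemma nn_integral_diagonal_swap:
  fixes f :: "real \<Rightarrow> real \<Rightarrow> ennreal"
  assumes [measurable]: "case_prod f \<in> borel_measurable (borel \<Otimes>\<^sub>M borel)"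
    and per: "\<And>s y. f (s + 1) (y + 1) = f s y"
  shows "(\<integral>\<^sup>+y. (\<integral>\<^sup>+s. f s y \<partial>lborel) \<partial>unif_interval) = (\<integral>\<^sup>+s. (\<integral>\<^sup>+y. f s y \<partial>lborel) \<partial>unif_interval)"
proof -
  interpret pair_sigma_finite lborel unif_interval
    by (intro pair_sigma_finite.intro unif.sigma_finite_measure_axioms lborel.sigma_finite_measure_axioms)
  have m: "case_prod h \<in> borel_measurable (lborel \<Otimes>\<^sub>M unif_interval)"
    if "case_prod h \<in> borel_measurable (borel \<Otimes>\<^sub>M borel)" for h :: "real \<Rightarrow> real \<Rightarrow> ennreal"
  proof -
    have "(\<lambda>z. (fst z, snd z)) \<in> lborel \<Otimes>\<^sub>M unif_interval \<rightarrow>\<^sub>M borel \<Otimes>\<^sub>M borel"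
      by (intro measurable_Pair measurable_compose[OF measurable_snd measurable_unif_interval]) auto
    from measurable_compose[OF this that]
    show "case_prod h \<in> borel_measurable (lborel \<Otimes>\<^sub>M unif_interval)" by simp
  qed
  have "(\<integral>\<^sup>+y. (\<integral>\<^sup>+s. f s y \<partial>lborel) \<partial>unif_interval) =
      (\<integral>\<^sup>+y. (\<integral>\<^sup>+u. f (y + u) y \<partial>lborel) \<partial>unif_interval)"
  proof (rule nn_integral_cong)
    fix y :: real
    show "(\<integral>\<^sup>+s. f s y \<partial>lborel) = (\<integral>\<^sup>+u. f (y + u) y \<partial>lborel)"
      using nn_integral_real_affine[of "\<lambda>s. f s y" 1 y] by simp
  qed
  also have "\<dots> = (\<integral>\<^sup>+u. (\<integral>\<^sup>+y. f (y + u) y \<partial>unif_interval) \<partial>lborel)"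
    by (rule Fubini') (rule m, measurable)
  also have "\<dots> = (\<integral>\<^sup>+u. (\<integral>\<^sup>+s. f s (s - u) \<partial>unif_interval) \<partial>lborel)"
  proof (rule nn_integral_cong)
    fix u :: real
    show "(\<integral>\<^sup>+y. f (y + u) y \<partial>unif_interval) = (\<integral>\<^sup>+s. f s (s - u) \<partial>unif_interval)"
      using nn_integral_periodic_shift[of "\<lambda>s. f s (s - u)" u] per[of _ "_ - u"]
      by (simp add: diff_add_eq)
  qed
  also have "\<dots> = (\<integral>\<^sup>+s. (\<integral>\<^sup>+u. f s (s - u) \<partial>lborel) \<partial>unif_interval)"
    by (rule Fubini'[symmetric]) (rule m, measurable)
  also have "\<dots> = (\<integral>\<^sup>+s. (\<integral>\<^sup>+y. f s y \<partial>lborel) \<partial>unif_interval)"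
  proof (rule nn_integral_cong)
    fix s :: real
    show "(\<integral>\<^sup>+u. f s (s - u) \<partial>lborel) = (\<integral>\<^sup>+y. f s y \<partial>lborel)"
      using nn_integral_real_affine[of "\<lambda>y. f s y" "-1" s] by simp
  qed
  finally show ?thesis .
qed

section \<open>Transport costs on the line\<close>

text \<open>The derivative of \<open>|z|\<^sup>p\<close> up to sign. Since \<open>0 powr 0 = 0\<close>, it vanishes at \<open>0\<close> even for \<open>p = 1\<close>.\<close>

definition pow_slope :: "real \<Rightarrow> real \<Rightarrow> real" where
  "pow_slope p z = p * \<bar>z\<bar> powr (p - 1)"

lemma measurable_pow_slope[measurable]: "pow_slope p \<in> borel_measurable borel"
  unfolding pow_slope_def by measurable

lemma pow_slope_nonneg: "1 \<le> p \<Longrightarrow> 0 \<le> pow_slope p z"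
  by (simp add: pow_slope_def)

lemma pow_slope_mono: "1 \<le> p \<Longrightarrow> \<bar>z\<bar> \<le> \<bar>z'\<bar> \<Longrightarrow> pow_slope p z \<le> pow_slope p z'"
  unfolding pow_slope_def by (intro mult_left_mono powr_mono2) auto

lemma pow_slope_mult: "pow_slope p z * \<bar>z\<bar> = p * \<bar>z\<bar> powr p"
  by (cases "z = 0") (auto simp: pow_slope_def powr_diff)

lemma has_integral_pow_slope:
  assumes "1 \<le> p" "0 \<le> b"
  shows "(pow_slope p has_integral b powr p) {0..b}"
proof -
  have "(pow_slope p has_integral b powr p - 0 powr p) {0..b}"
  proof (rule fundamental_theorem_of_calculus_interior)
    show "continuous_on {0..b} (\<lambda>x. x powr p)"
      using assms by (intro continuous_on_powr') auto
    fix x assume "x \<in> {0<..<b}"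
    then show "((\<lambda>x. x powr p) has_vector_derivative pow_slope p x) (at x)"
      by (auto simp: pow_slope_def simp flip: has_real_derivative_iff_has_vector_derivative intro!: derivative_eq_intros)
  qed (use assms in auto)
  then show ?thesis using assms by simp
qed

lemma has_integral_pow_slope_shift:
  assumes "1 \<le> p"
  shows "((\<lambda>s. pow_slope p (s - y)) has_integral \<bar>x - y\<bar> powr p) {min x y..max x y}"
proof -
  have base: "(pow_slope p has_integral \<bar>x - y\<bar> powr p) {0..\<bar>x - y\<bar>}"
    using has_integral_pow_slope[OF assms, of "\<bar>x - y\<bar>"] by simp
  show ?thesis
  proof (cases "y \<le> x")
    case True
    then show ?thesis
      using has_integral_affinity'[OF base[folded box_real(2)], of 1 "- y"]
      by (cases "x = y") (simp_all add: min_def max_def has_integral_refl)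
  next
    case False
    have "pow_slope p (- z) = pow_slope p z" for z by (simp add: pow_slope_def)
    then have "(pow_slope p has_integral \<bar>x - y\<bar> powr p) {- \<bar>x - y\<bar>..0}"
      using has_integral_reflect_real[of "pow_slope p" "\<bar>x - y\<bar> powr p" "\<bar>x - y\<bar>" 0] base by simp
    then show ?thesis
      using False has_integral_affinity'[of "pow_slope p" "\<bar>x - y\<bar> powr p" "- \<bar>x - y\<bar>" 0 1 "- y"]
      by (simp add: min_def max_def)
  qed
qed

lemma nn_integral_pow_slope:
  assumes "1 \<le> p"
  shows "(\<integral>\<^sup>+s. ennreal (pow_slope p (s - y)) * indicator {min x y..max x y} s \<partial>lborel) = ennreal (\<bar>x - y\<bar> powr p)"
  by (rule nn_integral_has_integral_lebesgue'[OF _ has_integral_pow_slope_shift])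
    (auto simp: assms pow_slope_nonneg)

lemma nn_integral_pow_slope_left:
  assumes "1 \<le> p"
  shows "(\<integral>\<^sup>+y. ennreal (pow_slope p (s - y)) * indicator {min 0 b..max 0 b} (s - y) \<partial>lborel) = ennreal (\<bar>b\<bar> powr p)"
proof -
  have "(\<integral>\<^sup>+y. ennreal (pow_slope p (s - y)) * indicator {min 0 b..max 0 b} (s - y) \<partial>lborel) =
      (\<integral>\<^sup>+z. ennreal (pow_slope p (z - 0)) * indicator {min b 0..max b 0} z \<partial>lborel)"
    using nn_integral_real_affine[of "\<lambda>z. ennreal (pow_slope p z) * indicator {min 0 b..max 0 b} z" "-1" s]
    by (simp add: min.commute max.commute)
  also have "\<dots> = ennreal (\<bar>b\<bar> powr p)"
    using nn_integral_pow_slope[OF assms, of 0 b] by simp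
  finally show ?thesis .
qed

text \<open>The assumption on \<open>T\<close> says that \<open>T\<close> is a generalized inverse of \<open>\<lambda>s. s - H s\<close>.\<close>

lemma transport_cost_le:
  fixes H T :: "real \<Rightarrow> real"
  assumes p: "1 \<le> p" and [measurable]: "H \<in> borel_measurable borel" and per: "\<And>s. H (s + 1) = H s"
    and T: "AE y in unif_interval. (\<forall>s. y < s \<longrightarrow> s < T y \<longrightarrow> s - y \<le> H s) \<and> (\<forall>s. T y < s \<longrightarrow> s < y \<longrightarrow> H s \<le> s - y)"
  shows "(\<integral>\<^sup>+y. ennreal (\<bar>T y - y\<bar> powr p) \<partial>unif_interval) \<le> (\<integral>\<^sup>+s. ennreal (\<bar>H s\<bar> powr p) \<partial>unif_interval)"
proof -
  \<comment> \<open>For fixed \<open>y\<close> the indicator covers, up to end points, the interval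
    between \<open>y\<close> and \<open>T y\<close>; for fixed \<open>s\<close> it marks the
    \<open>y\<close> between \<open>s\<close> and \<open>s - H s\<close>. Integrating the slope over
    these sections gives at least the cost at \<open>y\<close>, and exactly the power of |H
    s|.\<close>
  define f where "f s y = ennreal (pow_slope p (s - y)) * indicator {min 0 (H s)..max 0 (H s)} (s - y)" for s y
  have "(\<integral>\<^sup>+y. ennreal (\<bar>T y - y\<bar> powr p) \<partial>unif_interval) \<le> (\<integral>\<^sup>+y. (\<integral>\<^sup>+s. f s y \<partial>lborel) \<partial>unif_interval)"
  proof (rule nn_integral_mono_AE)
    show "AE y in unif_interval. ennreal (\<bar>T y - y\<bar> powr p) \<le> (\<integral>\<^sup>+s. f s y \<partial>lborel)"
      using T
    proof eventually_elim
      case (elim y)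
      have "(\<integral>\<^sup>+s. ennreal (pow_slope p (s - y)) * indicator {min (T y) y..max (T y) y} s \<partial>lborel) \<le> (\<integral>\<^sup>+s. f s y \<partial>lborel)"
      proof (rule nn_integral_mono_AE)
        show "AE s in lborel. ennreal (pow_slope p (s - y)) * indicator {min (T y) y..max (T y) y} s \<le> f s y"
          using AE_lborel_singleton[of y] AE_lborel_singleton[of "T y"]
        proof eventually_elim
          case s: (elim s)
          then show ?case
            using elim[THEN conjunct1, THEN spec, of s] elim[THEN conjunct2, THEN spec, of s] by (auto simp: f_def indicator_def split: if_splits)
        qed
      qed
      then show ?case unfolding nn_integral_pow_slope[OF p] .
    qed
  qed
  also have "\<dots> = (\<integral>\<^sup>+s. (\<integral>\<^sup>+y. f s y \<partial>lborel) \<partial>unif_interval)"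
  proof (rule nn_integral_diagonal_swap)
    show "case_prod f \<in> borel_measurable (borel \<Otimes>\<^sub>M borel)"
      unfolding f_def indicator_def atLeastAtMost_iff by measurable
    show "f (s + 1) (y + 1) = f s y" for s y by (simp add: f_def per)
  qed
  also have "\<dots> = (\<integral>\<^sup>+s. ennreal (\<bar>H s\<bar> powr p) \<partial>unif_interval)"
    unfolding f_def nn_integral_pow_slope_left[OF p] ..
  finally show ?thesis .
qed

text \<open>A subgradient of \<open>|z|\<^sup>p\<close>; the parameter \<open>t \<in> [-1, 1]\<close> selects it at the kink for \<open>p = 1\<close>.\<close>

definition pow_grad :: "real \<Rightarrow> real \<Rightarrow> real \<Rightarrow> real" where
  "pow_grad p t z = sgn z * pow_slope p z + (if p = 1 \<and> z = 0 then t else 0)"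

lemma measurable_pow_grad[measurable]: "pow_grad p t \<in> borel_measurable borel"
  unfolding pow_grad_def by measurable

lemma pow_slope_0[simp]: "pow_slope p 0 = 0"
  by (simp add: pow_slope_def)

text \<open>The slope controls the gradient away from the kink, and the summand 1 accounts for
  \<open>t\<close> at the kink.\<close>

lemma abs_pow_grad_le:
  assumes "1 \<le> p" "\<bar>t\<bar> \<le> 1" "\<bar>z\<bar> \<le> B"
  shows "\<bar>pow_grad p t z\<bar> \<le> pow_slope p B + 1"
  using pow_slope_mono[of p z B] pow_slope_nonneg[of p z] pow_slope_nonneg[of p B] assms
  by (cases "z = 0") (auto simp: pow_grad_def abs_mult)

text \<open>Euler's identity for a homogeneous function of degree p; at the kink the value
  \<open>t\<close> is multiplied by 0. It yields the total \<open>r * S\<close> in both lower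
  bounds.\<close>

lemma pow_grad_mult: "pow_grad p t z * z = p * \<bar>z\<bar> powr p"
  using pow_slope_mult[of p z] by (auto simp: pow_grad_def sgn_if algebra_simps)

text \<open>The left side is the gradient at \<open>h\<close> in the direction of \<open>z\<close>,
  minus the slope at \<open>z\<close>. If \<open>z\<close> points away from \<open>h\<close> the
  gradient term is negative, and if \<open>z\<close> lies beyond \<open>h\<close> the slope at
  \<open>z\<close> is larger by monotonicity; so an excess can occur only between 0 and
  \<open>h\<close>. For h = 0 and p = 1 the slope is 1, which dominates |t|.\<close>

lemma pow_grad_excess:
  assumes "1 \<le> p" "\<bar>t\<bar> \<le> 1" "z \<noteq> 0"
  shows "sgn z * pow_grad p t h - pow_slope p z
    \<le> (pow_slope p h - pow_slope p z) * indicator {min 0 h..max 0 h} z"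
proof (cases "h = 0")
  case True
  have "pow_slope 1 z = 1" using assms(3) by (simp add: pow_slope_def)
  then show ?thesis
    using True assms pow_slope_nonneg[OF assms(1), of z]
    by (cases "z > 0"; cases "p = 1") (auto simp: pow_grad_def indicator_def)
next
  case False
  show ?thesis
  proof (cases "z \<in> {min 0 h..max 0 h}")
    case True
    then have "sgn z = sgn h" using assms(3) by (auto simp: sgn_if min_def max_def split: if_splits)
    then show ?thesis using True False by (simp add: pow_grad_def sgn_mult_self_eq flip: mult.assoc)
  next
    case out: False
    show ?thesis
    proof (cases "sgn z = sgn h")
      case True
      then have "\<bar>h\<bar> \<le> \<bar>z\<bar>" using out False assms(3) by (auto simp: sgn_if min_def max_def split: if_splits)
      then show ?thesis
        using pow_slope_mono[OF assms(1), of h z] True False out by (simp add: pow_grad_def flip: mult.assoc)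
    next
      case opp: False
      then have "sgn z * sgn h = - 1" using False assms(3) by (auto simp: sgn_if split: if_splits)
      then show ?thesis
        using pow_slope_nonneg[OF assms(1), of h] pow_slope_nonneg[OF assms(1), of z] False out
        by (simp add: pow_grad_def flip: mult.assoc)
    qed
  qed
qed

section \<open>Kantorovich potentials\<close>

lemma ennreal_mult_indicator: "ennreal (u * indicator A x) = ennreal u * indicator A x"
  by (cases "x \<in> A") auto

text \<open>The area between the graph of the slope and its maximal height on the interval: a
  rectangle of area p |b|^p minus |b|^p. This is the origin of the factor p - 1 in the integral of
  \<open>G\<close>.\<close>

lemma nn_integral_pow_slope_gap:
  assumes "1 \<le> p"
  shows "(\<integral>\<^sup>+y. ennreal ((pow_slope p b - pow_slope p (s - y)) * indicator {min 0 b..max 0 b} (s - y)) \<partial>lborel)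
    = ennreal ((p - 1) * \<bar>b\<bar> powr p)"
proof -
  let ?I = "{min 0 b..max 0 b}"
  have "((\<lambda>z. pow_slope p b - pow_slope p z) has_integral
      (pow_slope p b * \<bar>b\<bar> - \<bar>b\<bar> powr p)) ?I"
  proof (rule has_integral_diff)
    show "((\<lambda>z. pow_slope p b) has_integral pow_slope p b * \<bar>b\<bar>) ?I"
      using has_integral_const_real[of "pow_slope p b" "min 0 b" "max 0 b"]
      by (cases "b \<ge> 0") (auto simp: min_def max_def mult.commute)
    show "(pow_slope p has_integral \<bar>b\<bar> powr p) ?I"
      using has_integral_pow_slope_shift[OF assms, of 0 b] by (simp add: min.commute max.commute)
  qed
  then have "(\<integral>\<^sup>+z. ennreal (pow_slope p b - pow_slope p z) * indicator ?I z \<partial>lborel)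
      = ennreal (pow_slope p b * \<bar>b\<bar> - \<bar>b\<bar> powr p)"
    by (rule nn_integral_has_integral_lebesgue'[rotated]) (auto intro!: pow_slope_mono assms)
  moreover have "(\<integral>\<^sup>+y. ennreal ((pow_slope p b - pow_slope p (s - y)) * indicator ?I (s - y)) \<partial>lborel)
      = (\<integral>\<^sup>+z. ennreal (pow_slope p b - pow_slope p z) * indicator ?I z \<partial>lborel)"
    using nn_integral_real_affine[of "\<lambda>z. ennreal (pow_slope p b - pow_slope p z) * indicator ?I z" "-1" s]
    by (simp add: ennreal_mult_indicator)
  moreover have "pow_slope p b * \<bar>b\<bar> - \<bar>b\<bar> powr p = (p - 1) * \<bar>b\<bar> powr p"
    by (simp add: pow_slope_mult left_diff_distrib)
  ultimately show ?thesis by simp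
qed

text \<open>\<open>G y\<close> is the integral over \<open>s\<close> of the positive part of \<open>\<plusminus> (\<Phi>' s - d/ds |s - y|\<^sup>p)\<close>, which by convexity
  lives on those \<open>s\<close> for which \<open>s - y\<close> lies between \<open>0\<close> and \<open>H s\<close>.\<close>

lemma transport_potential:
  fixes H :: "real \<Rightarrow> real"
  assumes p: "1 \<le> p" and H[measurable]: "H \<in> borel_measurable borel"
    and per: "\<And>s. H (s + 1) = H s" and bdd: "\<And>s. \<bar>H s\<bar> \<le> K" and t: "\<bar>t\<bar> \<le> 1"
    and prim: "primitive_on UNIV \<Phi> (\<lambda>s. pow_grad p t (H s))"
  obtains G where "integrable unif_interval G" "\<And>x y. \<Phi> x - \<Phi> y \<le> \<bar>x - y\<bar> powr p + G y"
    "(LINT y|unif_interval. G y) = (p - 1) * (LINT s|unif_interval. \<bar>H s\<bar> powr p)"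
    "G \<in> borel_measurable borel"
proof -
  define N where "N y s = (pow_slope p (H s) - pow_slope p (s - y)) * indicator {min 0 (H s)..max 0 (H s)} (s - y)" for y s
  define G where "G y = (LINT s|lborel. N y s)" for y
  have N_meas: "case_prod N \<in> borel_measurable (borel \<Otimes>\<^sub>M borel)"
    unfolding N_def indicator_def atLeastAtMost_iff by measurable
  have [measurable]: "N y \<in> borel_measurable borel" for y
    unfolding N_def indicator_def atLeastAtMost_iff by measurable
  have N_nonneg: "0 \<le> N y s" for y s
    unfolding N_def indicator_def by (auto intro!: pow_slope_mono p)
  have K: "K \<ge> 0" using bdd[of 0] by linarith
  have N_int: "integrable lborel (N y)" for y
  proof (rule integrableI_bounded_set[where A = "{y - K..y + K}" and B = "pow_slope p K"])
    have "N y s \<le> pow_slope p K" for s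
      using pow_slope_mono[OF p, of "H s" K] bdd[of s] pow_slope_nonneg[OF p, of "s - y"] pow_slope_nonneg[OF p, of K] K
      by (auto simp: N_def indicator_def)
    then show "AE s in lborel. s \<in> {y - K..y + K} \<longrightarrow> norm (N y s) \<le> pow_slope p K"
      using N_nonneg by (intro AE_I2) simp
    have "N y s = 0" if "s \<notin> {y - K..y + K}" for s
    proof -
      have "s - y \<notin> {min 0 (H s)..max 0 (H s)}"
        using that bdd[of s] by (auto simp: min_def max_def split: if_splits)
      then show ?thesis by (simp add: N_def)
    qed
    then show "AE s in lborel. s \<notin> {y - K..y + K} \<longrightarrow> N y s = 0" by (intro AE_I2) simp
    show "emeasure lborel {y - K..y + K} < \<infinity>" using K by simp
  qed auto
  have G_nonneg: "0 \<le> G y" for y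
    unfolding G_def by (intro integral_nonneg_AE AE_I2 N_nonneg)
  have G_meas[measurable]: "G \<in> borel_measurable borel"
    unfolding G_def using N_meas by (intro lborel.borel_measurable_lebesgue_integral) (simp cong: measurable_cong_sets)
  have Hp_int: "integrable unif_interval (\<lambda>s. \<bar>H s\<bar> powr p)"
    using bdd p by (intro integrable_unif_interval_bounded[where B = "K powr p"]) (auto intro!: powr_mono2)
  have "(\<integral>\<^sup>+y. ennreal (G y) \<partial>unif_interval) = (\<integral>\<^sup>+y. (\<integral>\<^sup>+s. ennreal (N y s) \<partial>lborel) \<partial>unif_interval)"
    unfolding G_def by (intro nn_integral_cong nn_integral_eq_integral[symmetric] N_int AE_I2 N_nonneg)
  also have "\<dots> = (\<integral>\<^sup>+s. (\<integral>\<^sup>+y. ennreal (N y s) \<partial>lborel) \<partial>unif_interval)"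
  proof (rule nn_integral_diagonal_swap)
    show "(\<lambda>(s, y). ennreal (N y s)) \<in> borel_measurable (borel \<Otimes>\<^sub>M borel)"
      unfolding N_def indicator_def atLeastAtMost_iff by measurable
    show "ennreal (N (y + 1) (s + 1)) = ennreal (N y s)" for s y by (simp add: N_def per)
  qed
  also have "\<dots> = (\<integral>\<^sup>+s. ennreal ((p - 1) * \<bar>H s\<bar> powr p) \<partial>unif_interval)"
    unfolding N_def nn_integral_pow_slope_gap[OF p] ..
  also have "\<dots> = ennreal ((p - 1) * (LINT s|unif_interval. \<bar>H s\<bar> powr p))"
    using p Hp_int by (subst nn_integral_eq_integral) auto
  finally have nnG: "(\<integral>\<^sup>+y. ennreal (G y) \<partial>unif_interval) = ennreal ((p - 1) * (LINT s|unif_interval. \<bar>H s\<bar> powr p))" .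
  have "has_bochner_integral unif_interval G ((p - 1) * (LINT s|unif_interval. \<bar>H s\<bar> powr p))"
    using p by (intro has_bochner_integral_nn_integral nnG AE_I2 G_nonneg mult_nonneg_nonneg integral_nonneg_AE) auto
  then have G_int: "integrable unif_interval G" "(LINT y|unif_interval. G y) = (p - 1) * (LINT s|unif_interval. \<bar>H s\<bar> powr p)"
    by (auto dest: has_bochner_integral_integrable simp: has_bochner_integral_integral_eq integrable.simps)
  have "\<Phi> x - \<Phi> y \<le> \<bar>x - y\<bar> powr p + G y" for x y
  proof -
    define I where "I = {min x y..max x y}"
    let ?\<kappa> = "\<lambda>s. pow_grad p t (H s)"
    \<comment> \<open>The sign of \<open>x - y\<close> treats both orders of the points at once; on
      \<open>I\<close>, away from \<open>y\<close>, it agrees with the sign of \<open>s - y\<close>,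
      which is what \<open>pow_grad_excess\<close> needs.\<close>
    have "set_integrable lborel I ?\<kappa> \<and> \<Phi> x - \<Phi> y = sgn (x - y) * (LINT s:I|lborel. ?\<kappa> s)"
      unfolding I_def
      using primitive_onD[OF prim, of x y] primitive_onD[OF prim, of y x]
      by (cases x y rule: linorder_cases) (auto simp: min_def max_def)
    then have \<kappa>: "set_integrable lborel I ?\<kappa>" "\<Phi> x - \<Phi> y = sgn (x - y) * (LINT s:I|lborel. ?\<kappa> s)" by auto
    have "has_bochner_integral lborel (\<lambda>s. indicator I s * pow_slope p (s - y)) (\<bar>x - y\<bar> powr p)"
      using nn_integral_pow_slope[OF p, of y x] p
      by (intro has_bochner_integral_nn_integral AE_I2)
        (auto simp: I_def ennreal_mult' ennreal_indicator mult.commute pow_slope_nonneg)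
    then have w: "integrable lborel (\<lambda>s. indicator I s * pow_slope p (s - y))"
      "(LINT s|lborel. indicator I s * pow_slope p (s - y)) = \<bar>x - y\<bar> powr p"
      by (auto simp: has_bochner_integral_integral_eq integrable.simps)
    have \<kappa>': "integrable lborel (\<lambda>s. sgn (x - y) * (indicator I s * ?\<kappa> s))"
      using \<kappa>(1) unfolding set_integrable_def by (intro integrable_mult_right) simp
    have "\<Phi> x - \<Phi> y - \<bar>x - y\<bar> powr p =
        (LINT s|lborel. sgn (x - y) * (indicator I s * ?\<kappa> s) - indicator I s * pow_slope p (s - y))"
      using \<kappa>' w \<kappa>(2) by (subst Bochner_Integration.integral_diff) (auto simp: set_lebesgue_integral_def)
    also have "\<dots> \<le> G y"
      unfolding G_def
    proof (rule integral_mono_AE)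
      show "integrable lborel (\<lambda>s. sgn (x - y) * (indicator I s * ?\<kappa> s) - indicator I s * pow_slope p (s - y))"
        by (intro Bochner_Integration.integrable_diff \<kappa>' w)
      show "AE s in lborel. sgn (x - y) * (indicator I s * ?\<kappa> s) - indicator I s * pow_slope p (s - y) \<le> N y s"
        using AE_lborel_singleton[of y]
      proof eventually_elim
        case (elim s)
        show ?case
        proof (cases "s \<in> I")
          case True
          then have "sgn (x - y) = sgn (s - y)"
            using elim by (auto simp: I_def sgn_if min_def max_def split: if_splits)
          then show ?thesis
            using pow_grad_excess[OF p t, of "s - y" "H s"] elim True by (simp add: N_def)
        qed (simp add: N_nonneg)
      qed
    qed (rule N_int)
    finally show ?thesis by simp
  qed
  then show ?thesis by (rule that[OF G_int(1) _ G_int(2) G_meas])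
qed

section \<open>The shift that balances the gradient\<close>

lemma pow_grad_right_limit:
  assumes "1 \<le> p"
  shows "(\<lambda>n. pow_grad p t (z + inverse (real (Suc n)))) \<longlonglongrightarrow> pow_grad p 1 z"
proof -
  have lim: "(\<lambda>n. z + inverse (real (Suc n))) \<longlonglongrightarrow> z"
    using tendsto_add[OF tendsto_const LIMSEQ_inverse_real_of_nat, of z] by simp
  consider "z \<noteq> 0" | "z = 0" "p = 1" | "z = 0" "p > 1" using assms by linarith
  then show ?thesis
  proof cases
    case 1
    have "(\<lambda>n. sgn (z + inverse (real (Suc n))) * pow_slope p (z + inverse (real (Suc n)))) \<longlonglongrightarrow> sgn z * pow_slope p z"
      unfolding pow_slope_def using 1
      by (intro tendsto_intros tendsto_sgn lim) auto
    moreover have "\<forall>\<^sub>F n in sequentially. sgn (z + inverse (real (Suc n))) * pow_slope p (z + inverse (real (Suc n)))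
        = pow_grad p t (z + inverse (real (Suc n)))"
      using tendsto_imp_eventually_ne[OF lim 1] by eventually_elim (simp add: pow_grad_def)
    ultimately show ?thesis
      using 1 by (auto simp: pow_grad_def[of p 1] intro: Lim_transform_eventually)
  next
    case 2
    then have "pow_grad p t (z + inverse (real (Suc n))) = pow_grad p 1 z" for n
      by (simp add: pow_grad_def pow_slope_def del: of_nat_Suc)
    then show ?thesis by simp
  next
    case 3
    have "(\<lambda>n. p * inverse (real (Suc n)) powr (p - 1)) \<longlonglongrightarrow> p * 0"
      using 3 by (intro tendsto_mult tendsto_const tendsto_zero_powrI[OF LIMSEQ_inverse_real_of_nat]) auto
    moreover have "pow_grad p t (z + inverse (real (Suc n))) = p * inverse (real (Suc n)) powr (p - 1)" for n
      using 3 by (simp add: pow_grad_def pow_slope_def del: of_nat_Suc)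
    ultimately show ?thesis using 3 by (simp add: pow_grad_def)
  qed
qed

lemma pow_grad_minus: "pow_grad p (- t) (- z) = - pow_grad p t z"
  by (auto simp: pow_grad_def pow_slope_def)

lemma pow_grad_left_limit:
  assumes "1 \<le> p"
  shows "(\<lambda>n. pow_grad p t (z - inverse (real (Suc n)))) \<longlonglongrightarrow> pow_grad p (- 1) z"
proof -
  have "- pow_grad p (- t) (- z + e) = pow_grad p t (z - e)" for e
    using pow_grad_minus[of p t "z - e"] by simp
  moreover have "- pow_grad p 1 (- z) = pow_grad p (- 1) z"
    using pow_grad_minus[of p "- 1" z] by simp
  ultimately show ?thesis
    using tendsto_minus[OF pow_grad_right_limit[OF assms, of "- t" "- z"]] by simp
qed

lemma pow_grad_mono:
  assumes "1 \<le> p" "z \<le> z'" shows "pow_grad p 0 z \<le> pow_grad p 0 z'"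
proof -
  have "pow_slope p z \<ge> 0" "pow_slope p z' \<ge> 0" using pow_slope_nonneg[OF assms(1)] by auto
  moreover have "\<bar>z\<bar> \<le> \<bar>z'\<bar> \<Longrightarrow> pow_slope p z \<le> pow_slope p z'" "\<bar>z'\<bar> \<le> \<bar>z\<bar> \<Longrightarrow> pow_slope p z' \<le> pow_slope p z"
    using pow_slope_mono[OF assms(1)] by auto
  ultimately show ?thesis
    using assms(2) by (cases "z > 0"; cases "z' > 0"; cases "z = 0"; cases "z' = 0") (auto simp: pow_grad_def sgn_if)
qed

text \<open>The shift \<open>a\<close> is the point where the monotone function \<open>L\<close> changes sign. For \<open>p = 1\<close> it may jump there,
  and \<open>t\<close> interpolates between the one-sided limits.\<close>

lemma balancing_shift:
  fixes h :: "real \<Rightarrow> real"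
  assumes p: "1 \<le> p" and [measurable]: "h \<in> borel_measurable borel" and h: "\<And>s. \<bar>h s\<bar> \<le> 1"
  obtains a t where "\<bar>a\<bar> \<le> 2" "\<bar>t\<bar> \<le> 1" "(LINT s|unif_interval. pow_grad p t (h s + a)) = 0"
proof -
  define L where "L a = (LINT s|unif_interval. pow_grad p 0 (h s + a))" for a
  \<comment> \<open>The shift is sought in [-2,2], but one-sided limits there also use shifts up to
    3 in absolute value; together with |h| \<le> 1 this gives 4.\<close>
  have bd: "\<bar>pow_grad p t (h s + a)\<bar> \<le> pow_slope p 4 + 1" if "\<bar>a\<bar> \<le> 3" "\<bar>t\<bar> \<le> 1" for a s t
    using h[of s] that p by (intro abs_pow_grad_le) auto
  have int: "integrable unif_interval (\<lambda>s. pow_grad p t (h s + a))" if "\<bar>a\<bar> \<le> 3" "\<bar>t\<bar> \<le> 1" for a t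
    using bd[OF that] by (intro integrable_unif_interval_bounded) auto
  have L_mono: "L a \<le> L b" if "a \<le> b" "\<bar>a\<bar> \<le> 3" "\<bar>b\<bar> \<le> 3" for a b
    unfolding L_def using that by (intro integral_mono int pow_grad_mono p) auto
  \<comment> \<open>A shift by 2 outweighs |h| \<le> 1, so the gradient has constant sign. This
    brackets the change of sign of \<open>L\<close> in [-2,2].\<close>
  have L2: "0 \<le> L 2"
  proof -
    have "0 \<le> pow_grad p 0 (h s + 2)" for s
      using h[of s] pow_slope_nonneg[OF p, of "h s + 2"] by (simp add: pow_grad_def sgn_if)
    then show ?thesis unfolding L_def by (intro integral_nonneg_AE AE_I2)
  qed
  have "L (- 2) \<le> (LINT s|unif_interval. 0)"
    unfolding L_def
  proof (rule integral_mono)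
    show "pow_grad p 0 (h s + (- 2)) \<le> 0" for s
      using h[of s] pow_slope_nonneg[OF p, of "h s + (- 2)"] by (simp add: pow_grad_def sgn_if)
  qed (rule int, simp_all)
  then have "L (- 2) \<le> 0" by simp
  define S where "S = {a. \<bar>a\<bar> \<le> 2 \<and> L a \<le> 0}"
  have S: "- 2 \<in> S" "bdd_above S" using \<open>L (- 2) \<le> 0\<close> by (auto simp: S_def intro!: bdd_aboveI[of _ 2])
  define a where "a = Sup S"
  have "a \<le> 2"
    unfolding a_def by (rule cSup_least) (use S(1) in blast, auto simp: S_def abs_le_iff)
  moreover have "- 2 \<le> a"
    unfolding a_def by (rule cSup_upper[OF S])
  ultimately have a: "\<bar>a\<bar> \<le> 2" by simp
  define e where "e n = inverse (real (Suc n))" for n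
  have e: "0 < e n" "e n \<le> 1" for n by (auto simp: e_def field_simps)
  have right: "0 \<le> L (a + e n)" for n
  proof (cases "a + e n \<le> 2")
    case True
    have "a + e n \<notin> S" using cSup_upper[OF _ S(2), of "a + e n"] e[of n] by (auto simp: a_def)
    then show ?thesis using True a e[of n] by (auto simp: S_def abs_le_iff)
  next
    case False
    moreover have "\<bar>a + e n\<bar> \<le> 3" using a e[of n] by linarith
    ultimately show ?thesis using L_mono[of 2 "a + e n"] L2 by auto
  qed
  have left: "L (a - e n) \<le> 0" for n
  proof -
    have "a - e n < Sup S" using e[of n] by (simp add: a_def)
    then obtain b where "b \<in> S" "a - e n < b"
      using less_cSupE[of "a - e n" S] S(1) by blast
    moreover have "\<bar>a - e n\<bar> \<le> 3" using a e[of n] by linarith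
    ultimately show ?thesis using L_mono[of "a - e n" b] by (auto simp: S_def)
  qed
  have limR: "(\<lambda>n. L (a + e n)) \<longlonglongrightarrow> (LINT s|unif_interval. pow_grad p 1 (h s + a))"
    unfolding L_def
  proof (rule integral_dominated_convergence[where w = "\<lambda>_. pow_slope p 4 + 1"])
    show "AE s in unif_interval. (\<lambda>n. pow_grad p 0 (h s + (a + e n))) \<longlonglongrightarrow> pow_grad p 1 (h s + a)"
      using pow_grad_right_limit[OF p, of 0 "h _ + a"] by (simp add: e_def add.assoc)
    have "\<bar>a + e n\<bar> \<le> 3" for n using a e[of n] by linarith
    then show "AE s in unif_interval. norm (pow_grad p 0 (h s + (a + e n))) \<le> pow_slope p 4 + 1" for n
      using bd[of "a + e n" 0] by (intro AE_I2) simp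
  qed auto
  have R: "0 \<le> (LINT s|unif_interval. pow_grad p 1 (h s + a))"
    by (rule LIMSEQ_le_const[OF limR]) (use right in blast)
  have limL: "(\<lambda>n. L (a - e n)) \<longlonglongrightarrow> (LINT s|unif_interval. pow_grad p (- 1) (h s + a))"
    unfolding L_def
  proof (rule integral_dominated_convergence[where w = "\<lambda>_. pow_slope p 4 + 1"])
    show "AE s in unif_interval. (\<lambda>n. pow_grad p 0 (h s + (a - e n))) \<longlonglongrightarrow> pow_grad p (- 1) (h s + a)"
      using pow_grad_left_limit[OF p, of 0 "h _ + a"] by (simp add: e_def add_diff_eq)
    have "\<bar>a - e n\<bar> \<le> 3" for n using a e[of n] by linarith
    then show "AE s in unif_interval. norm (pow_grad p 0 (h s + (a - e n))) \<le> pow_slope p 4 + 1" for n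
      using bd[of "a - e n" 0] by (intro AE_I2) simp
  qed auto
  have Lf: "(LINT s|unif_interval. pow_grad p (- 1) (h s + a)) \<le> 0"
    by (rule LIMSEQ_le_const2[OF limL]) (use left in blast)
  \<comment> \<open>For p = 1 this is the measure of the zero set of \<open>h + a\<close>, otherwise
    0. The integral of the gradient is affine in \<open>t\<close> with slope \<open>m\<close>,
    nonnegative at t = 1 and nonpositive at t = -1, so it vanishes for some \<open>t\<close> in
    between.\<close>
  define m where "m = (LINT s|unif_interval. (if p = 1 \<and> h s + a = 0 then 1 else 0 :: real))"
  have J: "(LINT s|unif_interval. pow_grad p t (h s + a)) = L a + t * m" for t :: real
  proof -
    have "(LINT s|unif_interval. pow_grad p t (h s + a)) =
        (LINT s|unif_interval. pow_grad p 0 (h s + a) + t * (if p = 1 \<and> h s + a = 0 then 1 else 0))"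
      by (intro Bochner_Integration.integral_cong) (auto simp: pow_grad_def)
    also have "\<dots> = L a + t * m"
    proof (subst Bochner_Integration.integral_add)
      show "integrable unif_interval (\<lambda>s. pow_grad p 0 (h s + a))"
        using a by (intro int) auto
      show "integrable unif_interval (\<lambda>s. t * (if p = 1 \<and> h s + a = 0 then 1 else 0))"
        by (intro integrable_mult_right integrable_unif_interval_bounded[where B = 1]) auto
    qed (simp add: L_def m_def)
    finally show ?thesis .
  qed
  have "L a + m \<ge> 0" "L a - m \<le> 0" using R Lf J[of 1] J[of "- 1"] by auto
  show ?thesis
  proof (cases "m = 0")
    case True
    then show ?thesis using that[of a 0] a J[of 0] \<open>L a + m \<ge> 0\<close> \<open>L a - m \<le> 0\<close> by simp
  next
    case False
    then have "m > 0" using \<open>L a + m \<ge> 0\<close> \<open>L a - m \<le> 0\<close> by simp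
    then show ?thesis
      using that[of a "- L a / m"] a J[of "- L a / m"] \<open>L a + m \<ge> 0\<close> \<open>L a - m \<le> 0\<close>
      by (simp add: abs_le_iff field_simps)
  qed
qed

section \<open>Lp norms\<close>

lemma Lp_norm_le_iff:
  assumes "1 \<le> r" "0 \<le> D"
  shows "Lp_norm (ennreal r) M f \<le> ennreal D \<longleftrightarrow>
    (\<integral>\<^sup>+x. ennreal (\<bar>f x\<bar> powr r) \<partial>M) \<le> ennreal (D powr r)"
proof (cases "(\<integral>\<^sup>+x. ennreal (\<bar>f x\<bar> powr r) \<partial>M)")
  case (real i)
  have "i powr (1 / r) \<le> D \<longleftrightarrow> i \<le> D powr r"
  proof
    assume "i powr (1 / r) \<le> D"
    then have "(i powr (1 / r)) powr r \<le> D powr r" using assms by (intro powr_mono2) auto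
    then show "i \<le> D powr r" using assms real by (simp add: powr_powr)
  next
    assume "i \<le> D powr r"
    then have "i powr (1 / r) \<le> (D powr r) powr (1 / r)" using assms real by (intro powr_mono2) auto
    then show "i powr (1 / r) \<le> D" using assms by (simp add: powr_powr)
  qed
  then show ?thesis using assms real by (simp add: Lp_norm_def ennreal_le_iff)
next
  case top
  then show ?thesis using assms by (simp add: Lp_norm_def top_unique)
qed

lemma Lp_norm_infinity_le_iff:
  assumes "f \<in> borel_measurable M" "0 \<le> D"
  shows "Lp_norm \<infinity> M f \<le> ennreal D \<longleftrightarrow> (AE x in M. \<bar>f x\<bar> \<le> D)"
proof
  assume *: "Lp_norm \<infinity> M f \<le> ennreal D"
  have "AE x in M. ennreal \<bar>f x\<bar> \<le> esssup M (\<lambda>x. ennreal \<bar>f x\<bar>)" by (rule esssup_AE)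
  then show "AE x in M. \<bar>f x\<bar> \<le> D"
  proof eventually_elim
    case (elim x)
    then have "ennreal \<bar>f x\<bar> \<le> ennreal D"
      using * by (auto simp: Lp_norm_def intro: order_trans)
    then show ?case using assms(2) by (simp add: ennreal_le_iff)
  qed
next
  assume "AE x in M. \<bar>f x\<bar> \<le> D"
  then have "AE x in M. ennreal \<bar>f x\<bar> \<le> ennreal D"
    by eventually_elim (rule ennreal_leI)
  then show "Lp_norm \<infinity> M f \<le> ennreal D"
    using assms(1) by (auto simp: Lp_norm_def intro!: esssup_I)
qed

section \<open>Conjugate exponents, Hoelder's inequality and large exponents\<close>

lemma ennreal_ge_1_cases:
  fixes p :: ennreal
  assumes "1 \<le> p"
  obtains (infinity) "p = \<infinity>" | (real) r where "p = ennreal r" "1 \<le> r"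
  using assms by (cases p) (auto simp flip: ennreal_1)

lemma holder_conjugate_cases:
  assumes "holder_conjugate p q"
  obtains (infinity) "p = \<infinity>" "q = 1" | (one) "p = 1" "q = \<infinity>"
    | (real) r r' where "p = ennreal r" "q = ennreal r'" "1 < r" "1 < r'" "1 / r + 1 / r' = 1"
proof -
  have pq: "1 \<le> p" "1 \<le> q" "inverse p + inverse q = 1"
    using assms by (auto simp: holder_conjugate_def)
  have inv1: "x = 1" if "inverse x = 1" for x :: ennreal
  proof (cases x)
    case (real u)
    then have "u > 0" using that by (cases "u = 0") auto
    then have "ennreal (inverse u) = ennreal 1" using that real by (simp add: inverse_ennreal)
    then show ?thesis using real \<open>u > 0\<close> by (subst (asm) ennreal_inj) auto
  qed (use that in simp)
  from pq(1) show ?thesis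
  proof (cases rule: ennreal_ge_1_cases)
    case infinity
    then show ?thesis using that(1) pq(3) inv1 by simp
  next
    case p: (real r)
    from pq(2) show ?thesis
    proof (cases rule: ennreal_ge_1_cases)
      case infinity
      then show ?thesis using that(2) pq(3) inv1 by simp
    next
      case q: (real r')
      have "ennreal (inverse r + inverse r') = ennreal 1"
        using pq(3) p q by (simp add: inverse_ennreal)
      then have eq: "1 / r + 1 / r' = 1"
        using p q by (subst (asm) ennreal_inj) (auto simp: inverse_eq_divide)
      have "r \<noteq> 1" "r' \<noteq> 1" using eq p q by auto
      then show ?thesis using that(3) p q eq by auto
    qed
  qed
qed

lemma holder_conjugate_exponent:
  assumes "1 < r" shows "holder_conjugate (ennreal r) (ennreal (r / (r - 1)))"
proof -
  have "inverse (ennreal r) + inverse (ennreal (r / (r - 1))) = ennreal (inverse r + inverse (r / (r - 1)))"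
    using assms by (simp add: inverse_ennreal)
  also have "inverse r + inverse (r / (r - 1)) = 1" using assms by (simp add: field_simps)
  finally show ?thesis
    using assms unfolding holder_conjugate_def by (auto simp: field_simps simp flip: ennreal_1)
qed

text \<open>For finite exponents above 1: Young's inequality pointwise, after dividing
  \<open>h\<close> by the bound \<open>D\<close> on its norm. The constant 1 in place of
  \<open>h\<close> gives integrability of \<open>g\<close>, because the total mass is 1. When
  \<open>D = 0\<close> no rescaling is possible, but then \<open>h\<close> vanishes almost
  everywhere.\<close>

lemma (in prob_space) holder_bound:
  assumes conj: "holder_conjugate p q"
    and g[measurable]: "g \<in> borel_measurable M" "Lp_norm q M g \<le> 1"
    and h[measurable]: "h \<in> borel_measurable M" "Lp_norm p M h \<le> ennreal D" and D: "0 \<le> D"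
    and bdd: "\<And>x. x \<in> space M \<Longrightarrow> \<bar>h x\<bar> \<le> B"
  shows "integrable M g" "(LINT x|M. g x * h x) \<le> D"
proof -
  have nn: "(\<integral>\<^sup>+x. ennreal \<bar>g x\<bar> \<partial>M) \<le> 1 \<and> (\<integral>\<^sup>+x. ennreal \<bar>g x * h x\<bar> \<partial>M) \<le> ennreal D"
    using conj
  proof (cases rule: holder_conjugate_cases)
    case infinity
    have g1: "(\<integral>\<^sup>+x. ennreal \<bar>g x\<bar> \<partial>M) \<le> 1"
      using g(2) Lp_norm_le_iff[of 1 1 M g] infinity by simp
    have "AE x in M. \<bar>h x\<bar> \<le> D" using h(2) Lp_norm_infinity_le_iff[OF h(1) D] infinity by simp
    then have "AE x in M. ennreal \<bar>g x * h x\<bar> \<le> ennreal D * ennreal \<bar>g x\<bar>"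
    proof eventually_elim
      case (elim x)
      then have "\<bar>h x\<bar> * \<bar>g x\<bar> \<le> D * \<bar>g x\<bar>" by (rule mult_right_mono) simp
      then show ?case using D by (simp add: abs_mult mult.commute ennreal_leI flip: ennreal_mult)
    qed
    then have "(\<integral>\<^sup>+x. ennreal \<bar>g x * h x\<bar> \<partial>M) \<le> (\<integral>\<^sup>+x. ennreal D * ennreal \<bar>g x\<bar> \<partial>M)"
      by (rule nn_integral_mono_AE)
    also have "\<dots> \<le> ennreal D * 1"
      using g1 by (simp add: nn_integral_cmult mult_left_mono del: mult_1_right)
    finally show ?thesis using g1 by simp
  next
    case one
    have gAE: "AE x in M. \<bar>g x\<bar> \<le> 1" using g(2) Lp_norm_infinity_le_iff[OF g(1), of 1] one by simp
    from gAE have "AE x in M. ennreal \<bar>g x\<bar> \<le> 1"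
      by eventually_elim simp
    then have "(\<integral>\<^sup>+x. ennreal \<bar>g x\<bar> \<partial>M) \<le> (\<integral>\<^sup>+x. 1 \<partial>M)"
      by (rule nn_integral_mono_AE)
    moreover from gAE have "AE x in M. ennreal \<bar>g x * h x\<bar> \<le> ennreal \<bar>h x\<bar>"
      by eventually_elim (auto simp: abs_mult intro!: ennreal_leI mult_left_le_one_le)
    then have "(\<integral>\<^sup>+x. ennreal \<bar>g x * h x\<bar> \<partial>M) \<le> (\<integral>\<^sup>+x. ennreal \<bar>h x\<bar> \<partial>M)"
      by (rule nn_integral_mono_AE)
    ultimately show ?thesis
      using h(2) Lp_norm_le_iff[of 1 D M h] one D by (simp add: emeasure_space_1)
  next
    case (real r r')
    have gq: "(\<integral>\<^sup>+x. ennreal (\<bar>g x\<bar> powr r') \<partial>M) \<le> 1"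
      using g(2) Lp_norm_le_iff[of r' 1 M g] real by simp
    have hp: "(\<integral>\<^sup>+x. ennreal (\<bar>h x\<bar> powr r) \<partial>M) \<le> ennreal (D powr r)"
      using h(2) Lp_norm_le_iff[of r D M h] real D by simp
    have young: "(\<integral>\<^sup>+x. ennreal \<bar>g x * k x\<bar> \<partial>M) \<le> 1"
      if [measurable]: "k \<in> borel_measurable M" and k: "(\<integral>\<^sup>+x. ennreal (\<bar>k x\<bar> powr r) \<partial>M) \<le> 1" for k
    proof -
      have "(\<integral>\<^sup>+x. ennreal \<bar>g x * k x\<bar> \<partial>M) \<le>
          (\<integral>\<^sup>+x. ennreal (1 / r') * ennreal (\<bar>g x\<bar> powr r') + ennreal (1 / r) * ennreal (\<bar>k x\<bar> powr r) \<partial>M)"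
      proof (rule nn_integral_mono)
        fix x
        have "\<bar>k x\<bar> * \<bar>g x\<bar> \<le> \<bar>k x\<bar> powr r / r + \<bar>g x\<bar> powr r' / r'"
          using real by (intro Youngs_inequality) auto
        then show "ennreal \<bar>g x * k x\<bar> \<le> ennreal (1 / r') * ennreal (\<bar>g x\<bar> powr r') + ennreal (1 / r) * ennreal (\<bar>k x\<bar> powr r)"
          using real by (simp add: abs_mult mult.commute add.commute ennreal_leI flip: ennreal_mult ennreal_plus)
      qed
      also have "\<dots> = ennreal (1 / r') * (\<integral>\<^sup>+x. ennreal (\<bar>g x\<bar> powr r') \<partial>M) + ennreal (1 / r) * (\<integral>\<^sup>+x. ennreal (\<bar>k x\<bar> powr r) \<partial>M)"
        by (simp add: nn_integral_add nn_integral_cmult)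
      also have "\<dots> \<le> ennreal (1 / r') * 1 + ennreal (1 / r) * 1"
        by (intro add_mono mult_left_mono gq k) auto
      also have "\<dots> = 1" using real by (simp add: add.commute flip: ennreal_plus)
      finally show ?thesis .
    qed
    have g1: "(\<integral>\<^sup>+x. ennreal \<bar>g x\<bar> \<partial>M) \<le> 1" using young[of "\<lambda>_. 1"] real by (simp add: emeasure_space_1)
    show ?thesis
    proof (cases "D = 0")
      case True
      then have "(\<integral>\<^sup>+x. ennreal (\<bar>h x\<bar> powr r) \<partial>M) = 0" using hp by simp
      then have "AE x in M. h x = 0" by (subst (asm) nn_integral_0_iff_AE) auto
      then have "AE x in M. ennreal \<bar>g x * h x\<bar> = 0"
        by eventually_elim simp
      then have "(\<integral>\<^sup>+x. ennreal \<bar>g x * h x\<bar> \<partial>M) = (\<integral>\<^sup>+x. 0 \<partial>M)"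
        by (rule nn_integral_cong_AE)
      then show ?thesis using g1 by simp
    next
      case False
      then have "D > 0" using D by simp
      have "(\<integral>\<^sup>+x. ennreal (\<bar>h x / D\<bar> powr r) \<partial>M) = (\<integral>\<^sup>+x. ennreal (1 / D powr r) * ennreal (\<bar>h x\<bar> powr r) \<partial>M)"
        using \<open>D > 0\<close> by (intro nn_integral_cong) (simp add: powr_divide flip: ennreal_mult)
      also have "\<dots> \<le> ennreal (1 / D powr r) * ennreal (D powr r)"
        using hp by (subst nn_integral_cmult) (auto intro: mult_left_mono)
      also have "\<dots> = 1" using \<open>D > 0\<close> by (simp flip: ennreal_mult)
      finally have "(\<integral>\<^sup>+x. ennreal \<bar>g x * (h x / D)\<bar> \<partial>M) \<le> 1" by (intro young) auto
      then have "ennreal D * (\<integral>\<^sup>+x. ennreal \<bar>g x * (h x / D)\<bar> \<partial>M) \<le> ennreal D * 1"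
        by (rule mult_left_mono) simp
      also have "ennreal D * (\<integral>\<^sup>+x. ennreal \<bar>g x * (h x / D)\<bar> \<partial>M) = (\<integral>\<^sup>+x. ennreal \<bar>g x * h x\<bar> \<partial>M)"
        using \<open>D > 0\<close> by (subst nn_integral_cmult[symmetric]) (auto simp: abs_mult simp flip: ennreal_mult)
      finally show ?thesis using g1 by simp
    qed
  qed
  show "integrable M g"
    using nn by (intro integrableI_bounded) (auto intro: le_less_trans)
  have "integrable M (\<lambda>x. g x * h x)"
    using nn by (intro integrableI_bounded) (auto intro: le_less_trans)
  then have "ennreal (LINT x|M. \<bar>g x * h x\<bar>) \<le> ennreal D"
    using nn by (subst nn_integral_eq_integral[symmetric]) auto
  then have "(LINT x|M. \<bar>g x * h x\<bar>) \<le> D" using D by (simp add: ennreal_le_iff)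
  then show "(LINT x|M. g x * h x) \<le> D"
    using integral_abs_bound[of M "\<lambda>x. g x * h x"] by linarith
qed

text \<open>Markov's inequality on the set where |f| exceeds D + 2 e bounds its probability by (D /
  (D + e)) ^ m n, which tends to 0. One \<open>e\<close> is spent on passing from \<open>f\<close>
  to \<open>g n\<close>, the other makes the ratio smaller than 1. Letting \<open>g n\<close> vary
  with \<open>n\<close> accommodates shifts that only converge.\<close>

lemma (in prob_space) AE_bound_of_power_bounds:
  fixes f :: "'a \<Rightarrow> real" and g :: "nat \<Rightarrow> 'a \<Rightarrow> real" and m :: "nat \<Rightarrow> nat"
  assumes [measurable]: "f \<in> borel_measurable M" "\<And>n. g n \<in> borel_measurable M"
    and D: "0 \<le> D" and m: "filterlim m at_top sequentially" "\<And>n. 0 < m n"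
    and g: "\<And>n. (\<integral>\<^sup>+x. ennreal (\<bar>g n x\<bar> powr real (m n)) \<partial>M) \<le> ennreal (D powr real (m n))"
    and fg: "\<And>e. 0 < e \<Longrightarrow> \<forall>\<^sub>F n in sequentially. \<forall>x. \<bar>f x\<bar> \<le> \<bar>g n x\<bar> + e"
  shows "AE x in M. \<bar>f x\<bar> \<le> D"
proof -
  have "AE x in M. \<bar>f x\<bar> \<le> D + 2 * e" if e: "e > 0" for e
  proof -
    define A where "A = {x \<in> space M. D + 2 * e < \<bar>f x\<bar>}"
    have [measurable]: "A \<in> sets M" unfolding A_def by measurable
    have "\<forall>\<^sub>F n in sequentially. prob A \<le> (D / (D + e)) ^ m n"
      using fg[OF e]
    proof eventually_elim
      case (elim n)
      have De: "D + e > 0" using D e by simp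
      have "ennreal ((D + e) powr real (m n)) * emeasure M A = (\<integral>\<^sup>+x. ennreal ((D + e) powr real (m n)) * indicator A x \<partial>M)"
        by (subst nn_integral_cmult_indicator) auto
      also have "\<dots> \<le> (\<integral>\<^sup>+x. ennreal (\<bar>g n x\<bar> powr real (m n)) \<partial>M)"
      proof (rule nn_integral_mono)
        fix x
        show "ennreal ((D + e) powr real (m n)) * indicator A x \<le> ennreal (\<bar>g n x\<bar> powr real (m n))"
        proof (cases "x \<in> A")
          case True
          then have "D + e \<le> \<bar>g n x\<bar>" using elim[THEN spec, of x] by (simp add: A_def)
          then show ?thesis using True De by (simp add: ennreal_leI powr_mono2)
        qed simp
      qed
      also have "\<dots> \<le> ennreal (D powr real (m n))" by (rule g)
      finally have "(D + e) powr real (m n) * prob A \<le> D powr real (m n)"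
        by (simp add: emeasure_eq_measure flip: ennreal_mult)
      moreover have "(D + e) powr real (m n) = (D + e) ^ m n" using De by (simp add: powr_realpow)
      moreover have "D powr real (m n) = D ^ m n" using D m(2)[of n] by (cases "D = 0") (auto simp: powr_realpow)
      ultimately show ?case using De by (simp add: power_divide field_simps)
    qed
    moreover have "(\<lambda>n. (D / (D + e)) ^ m n) \<longlonglongrightarrow> 0"
      using D e by (intro filterlim_compose[OF LIMSEQ_realpow_zero m(1)]) auto
    ultimately have "prob A \<le> 0"
      using tendsto_lowerbound[of "\<lambda>n. (D / (D + e)) ^ m n" 0 sequentially "prob A"] by simp
    then have "prob A = 0" using measure_nonneg[of M A] by simp
    then have "AE x in M. x \<notin> A" by (subst AE_iff_measurable[of A]) (auto simp: A_def emeasure_eq_measure)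
    then show ?thesis by (rule AE_mp) (auto simp: A_def intro!: AE_I2)
  qed
  then have "AE x in M. \<forall>n. \<bar>f x\<bar> \<le> D + 2 * inverse (real (Suc n))"
    by (subst AE_all_countable) simp
  then show ?thesis
  proof eventually_elim
    case (elim x)
    have "(\<lambda>n. D + 2 * inverse (real (Suc n))) \<longlonglongrightarrow> D + 2 * 0"
      by (intro tendsto_intros LIMSEQ_inverse_real_of_nat)
    then show ?case using elim by (intro LIMSEQ_le_const[where x = "D" and a = "\<bar>f x\<bar>"]) auto
  qed
qed

section \<open>The abstract duality argument\<close>

text \<open>The layer-cake formula: f (r x) - f 0 is the integral of \<open>g\<close> over the
  \<open>s\<close> below \<open>r x\<close>, and Fubini turns the average over \<open>x\<close> into
  the tail probability of \<open>r\<close>.\<close>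

lemma expectation_primitive:
  assumes "prob_space M" and r[measurable]: "r \<in> borel_measurable M" "\<And>x. x \<in> space M \<Longrightarrow> r x \<in> {0..<1}"
    and f: "primitive_on {0..<1} f g" and g: "integrable unif_interval g"
  shows "(LINT x|M. f (r x)) = f 0 + (LINT s|unif_interval. g s * (1 - measure M {x\<in>space M. r x \<le> s}))"
    and "integrable M (\<lambda>x. f (r x))"
    and "integrable unif_interval (\<lambda>s. g s * (1 - measure M {x\<in>space M. r x \<le> s}))"
proof -
  interpret M: prob_space M by fact
  interpret pair_sigma_finite M unif_interval
    by (intro pair_sigma_finite.intro unif.sigma_finite_measure_axioms M.sigma_finite_measure_axioms)
  have [measurable]: "(\<lambda>x. x) \<in> borel_measurable unif_interval" "g \<in> borel_measurable unif_interval"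
    using g by (auto intro: measurable_unif_interval)
  define k where "k x s = g s * of_bool (s < r x)" for x s
  have [measurable]: "k x \<in> borel_measurable unif_interval" for x
    unfolding k_def[abs_def] by measurable
  have kx_int: "integrable unif_interval (k x)" for x
    by (rule Bochner_Integration.integrable_bound[OF g]) (auto simp: k_def)
  have k_int: "integrable (M \<Otimes>\<^sub>M unif_interval) (case_prod k)"
  proof (rule Fubini_integrable)
    show "case_prod k \<in> borel_measurable (M \<Otimes>\<^sub>M unif_interval)"
      unfolding k_def by measurable
    show "AE x in M. integrable unif_interval (\<lambda>y. case_prod k (x, y))" using kx_int by simp
    have "integrable M (\<lambda>x. LINT s|unif_interval. \<bar>k x s\<bar>)"
    proof (rule M.integrable_const_bound[where B = "LINT s|unif_interval. \<bar>g s\<bar>"])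
      have "(LINT s|unif_interval. \<bar>k x s\<bar>) \<le> (LINT s|unif_interval. \<bar>g s\<bar>)" for x
        by (rule integral_mono[OF integrable_abs[OF kx_int] integrable_abs[OF g]]) (simp add: k_def)
      then show "AE x in M. norm (LINT s|unif_interval. \<bar>k x s\<bar>) \<le> (LINT s|unif_interval. \<bar>g s\<bar>)"
        by (intro AE_I2) (simp add: integral_nonneg_AE)
      show "(\<lambda>x. LINT s|unif_interval. \<bar>k x s\<bar>) \<in> borel_measurable M"
        unfolding k_def by measurable
    qed
    then show "integrable M (\<lambda>x. LINT y|unif_interval. norm (case_prod k (x, y)))" by simp
  qed
  have inner1: "(LINT s|unif_interval. k x s) = f (r x) - f 0" if "x \<in> space M" for x
  proof -
    have rx: "r x \<in> {0..<1}" using r(2) that .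
    have "(LINT s|unif_interval. k x s) = (LINT s:{0..r x}|lborel. g s)"
      unfolding integral_unif_interval set_lebesgue_integral_def
    proof (rule integral_cong_AE)
      show "(\<lambda>s. indicator {0..<1} s *\<^sub>R k x s) \<in> borel_measurable lborel"
        using kx_int[of x] unfolding integrable_unif_interval set_integrable_def
        by (rule borel_measurable_integrable)
      show "(\<lambda>s. indicator {0..r x} s *\<^sub>R g s) \<in> borel_measurable lborel"
        using primitive_onD(1)[OF f, of 0 "r x"] rx by (auto simp: set_integrable_def)
      show "AE s in lborel. indicator {0..<1} s *\<^sub>R k x s = indicator {0..r x} s *\<^sub>R g s"
        using AE_lborel_singleton[of "r x"]
        by eventually_elim (use rx in \<open>auto simp: k_def indicator_def\<close>)
    qed
    also have "\<dots> = f (r x) - f 0" using primitive_onD(2)[OF f, of 0 "r x"] rx by simp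
    finally show ?thesis .
  qed
  have inner2: "(LINT x|M. k x s) = g s * (1 - measure M {x\<in>space M. r x \<le> s})" for s
  proof -
    have "(LINT x|M. k x s) = (LINT x|M. g s * indicator {x\<in>space M. s < r x} x)"
      by (intro Bochner_Integration.integral_cong) (auto simp: k_def indicator_def)
    also have "\<dots> = g s * measure M {x\<in>space M. s < r x}"
      by simp
    also have "measure M {x\<in>space M. s < r x} = 1 - measure M {x\<in>space M. r x \<le> s}"
      using M.prob_neg[of "\<lambda>x. r x \<le> s"] by (simp add: not_le)
    finally show ?thesis .
  qed
  have i1: "integrable M (\<lambda>x. f (r x) - f 0)"
    using integrable_fst[OF k_int] by (simp add: inner1 cong: Bochner_Integration.integrable_cong)
  then have "integrable M (\<lambda>x. f (r x) - f 0 + f 0)" by (rule Bochner_Integration.integrable_add) simp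
  then show i2: "integrable M (\<lambda>x. f (r x))" by simp
  show "integrable unif_interval (\<lambda>s. g s * (1 - measure M {x\<in>space M. r x \<le> s}))"
    using integrable_snd[OF k_int] by (simp add: inner2)
  have "(LINT x|M. f (r x)) - f 0 = (LINT x|M. f (r x) - f 0)"
    using i2 by (simp add: M.prob_space)
  also have "\<dots> = (LINT x|M. LINT s|unif_interval. k x s)"
    by (intro Bochner_Integration.integral_cong) (simp_all add: inner1)
  also have "\<dots> = (LINT s|unif_interval. LINT x|M. k x s)"
    by (rule Fubini_integral[OF k_int, symmetric])
  finally show "(LINT x|M. f (r x)) = f 0 + (LINT s|unif_interval. g s * (1 - measure M {x\<in>space M. r x \<le> s}))"
    by (simp add: inner2)
qed

lemma measure_unif_interval_le:
  assumes "s \<in> {0..<1}" shows "measure unif_interval {x\<in>space unif_interval. x \<le> s} = s"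
proof -
  have eq: "{x \<in> space unif_interval. x \<le> s} = {0..s}" using assms by auto
  have "measure unif_interval {0..s} = measure lborel {0..s}"
    unfolding unif_interval_def by (rule measure_restrict_space) (use assms in auto)
  then show ?thesis unfolding eq using assms by simp
qed

lemma expectation_difference:
  assumes "prob_space M" and r: "r \<in> borel_measurable M" "\<And>x. x \<in> space M \<Longrightarrow> r x \<in> {0..<1}"
    and f: "primitive_on {0..<1} f g" and g: "integrable unif_interval g"
  shows "(LINT x|M. f (r x)) - (LINT x|unif_interval. f x) =
    (LINT s|unif_interval. g s * (s - measure M {x\<in>space M. r x \<le> s}))"
proof -
  note M = expectation_primitive[OF assms]
  have "(\<lambda>x. x) \<in> borel_measurable unif_interval" by (intro measurable_unif_interval) simp
  note U = expectation_primitive[OF prob_space_unif_interval this _ f g, simplified]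
  have "(LINT x|unif_interval. f x) = f 0 + (LINT s|unif_interval. g s * (1 - measure unif_interval {x\<in>space unif_interval. x \<le> s}))"
    using U(1) by simp
  then have "(LINT x|M. f (r x)) - (LINT x|unif_interval. f x) =
    (LINT s|unif_interval. g s * (1 - measure M {x\<in>space M. r x \<le> s}) - g s * (1 - measure unif_interval {x\<in>space unif_interval. x \<le> s}))"
    using M(1,3) U(3) by (subst Bochner_Integration.integral_diff) simp_all
  also have "\<dots> = (LINT s|unif_interval. g s * (s - measure M {x\<in>space M. r x \<le> s}))"
  proof (rule Bochner_Integration.integral_cong[OF refl])
    fix s assume "s \<in> space unif_interval"
    then have "measure unif_interval {x\<in>space unif_interval. x \<le> s} = s"
      by (intro measure_unif_interval_le) simp
    then show "g s * (1 - measure M {x\<in>space M. r x \<le> s}) - g s * (1 - measure unif_interval {x\<in>space unif_interval. x \<le> s})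
      = g s * (s - measure M {x\<in>space M. r x \<le> s})"
      by (simp only:) (simp add: algebra_simps)
  qed
  finally show ?thesis .
qed

text \<open>Evaluating at \<open>frac s\<close> implements the extension F (s + 1) = F s + 1,
  because s - F s is unchanged by integer translations. This is the function H of the overview
  before the shift \<open>a\<close> is added.\<close>

definition cdf_gap :: "real measure \<Rightarrow> real \<Rightarrow> real" where
  "cdf_gap \<nu> s = frac s - cdf \<nu> (frac s)"

lemma (in real_distribution) cdf_gap_facts:
  shows "cdf_gap M \<in> borel_measurable borel" "\<bar>cdf_gap M s\<bar> \<le> 1" "cdf_gap M (s + 1) = cdf_gap M s"
proof -
  have [measurable]: "cdf M \<in> borel_measurable borel"
    by (intro borel_measurable_mono monoI cdf_nondecreasing)
  show "cdf_gap M \<in> borel_measurable borel"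
    unfolding cdf_gap_def[abs_def] frac_def by measurable
  show "\<bar>cdf_gap M s\<bar> \<le> 1"
    using frac_ge_0[of s] frac_lt_1[of s] cdf_nonneg[of "frac s"] cdf_bounded_prob[of "frac s"]
    unfolding cdf_gap_def by linarith
  show "cdf_gap M (s + 1) = cdf_gap M s"
    by (simp add: cdf_gap_def frac_1_eq)
qed

text \<open>\<open>rep\<close> is the coordinate in \<open>[0,1)\<close>, and \<open>Adm\<close> is the set of admissible shifts: \<open>{0}\<close> for the interval and
  everything for the circle. The condition \<open>\<forall>a\<in>Adm. a * \<integral>g' = 0\<close> is void in the first case, and in the
  second it says that \<open>g'\<close> has mean zero, that is, has a periodic primitive.\<close>

locale unif_transport =
  fixes \<mu> L :: "'a::metric_space measure" and rep :: "'a \<Rightarrow> real"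
    and Dv :: "('a \<Rightarrow> real) \<Rightarrow> ('a \<Rightarrow> real) \<Rightarrow> bool" and Adm :: "real set"
  assumes prob_mu: "prob_space \<mu>" and prob_L: "prob_space L" and sets_L: "sets L = sets \<mu>"
    and rep_measurable: "rep \<in> borel_measurable \<mu>"
    and rep_range: "\<And>x. x \<in> space \<mu> \<Longrightarrow> rep x \<in> {0..<1}"
    and L_rep: "\<And>s. s \<in> {0..<1} \<Longrightarrow> measure L {x\<in>space L. rep x \<le> s} = s"
    and Adm: "Adm = {0} \<or> Adm = UNIV"
    and dist_measurable: "(\<lambda>z. dist (fst z) (snd z)) \<in> borel_measurable (\<mu> \<Otimes>\<^sub>M L)"
    and dist_le_1: "\<And>x y. x \<in> space \<mu> \<Longrightarrow> y \<in> space \<mu> \<Longrightarrow> dist x y \<le> 1"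
    and coupling: "\<And>a. a \<in> Adm \<Longrightarrow> \<exists>\<pi>\<in>couplings \<mu> L. \<forall>r\<ge>1.
      (\<integral>\<^sup>+z. ennreal (dist (fst z) (snd z) powr r) \<partial>\<pi>) \<le>
      (\<integral>\<^sup>+s. ennreal (\<bar>cdf_gap (distr \<mu> borel rep) s + a\<bar> powr r) \<partial>unif_interval)"
    and ball_imp_primitive: "\<And>f q. f \<in> sobolev_ball Dv L q \<Longrightarrow> 1 \<le> q \<Longrightarrow>
      \<exists>f' g'. (\<forall>x\<in>space \<mu>. f x = f' (rep x)) \<and> primitive_on {0..<1} f' g' \<and>
        g' \<in> borel_measurable unif_interval \<and> Lp_norm q unif_interval g' \<le> 1 \<and>
        (\<forall>a\<in>Adm. a * (LINT s|unif_interval. g' s) = 0)"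
    and primitive_imp_ball: "\<And>f' g' C q. primitive_on UNIV f' g' \<Longrightarrow> g' \<in> borel_measurable borel \<Longrightarrow>
      (\<And>s. \<bar>g' s\<bar> \<le> C) \<Longrightarrow> (\<And>s. g' (s + 1) = g' s) \<Longrightarrow>
      (\<forall>a\<in>Adm. a * (LINT s|unif_interval. g' s) = 0) \<Longrightarrow> Lp_norm q unif_interval g' \<le> 1 \<Longrightarrow>
      \<exists>f\<in>sobolev_ball Dv L q. \<forall>x\<in>space \<mu>. f x = f' (rep x)"
    and dist_lift: "\<And>f' g' C x y. primitive_on UNIV f' g' \<Longrightarrow> g' \<in> borel_measurable borel \<Longrightarrow>
      (\<And>s. \<bar>g' s\<bar> \<le> C) \<Longrightarrow> (\<And>s. g' (s + 1) = g' s) \<Longrightarrow>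
      (\<forall>a\<in>Adm. a * (LINT s|unif_interval. g' s) = 0) \<Longrightarrow> x \<in> space \<mu> \<Longrightarrow> y \<in> space \<mu> \<Longrightarrow>
      \<exists>x'. dist x y = \<bar>x' - rep y\<bar> \<and> f' x' = f' (rep x)"
begin

section \<open>Upper bounds for both quantities\<close>

sublocale M: prob_space \<mu> by (rule prob_mu)
sublocale L: prob_space L by (rule prob_L)

abbreviation "gap \<equiv> cdf_gap (distr \<mu> borel rep)"

lemma space_L: "space L = space \<mu>"
  using sets_L by (rule sets_eq_imp_space_eq)

lemma rep_measurable_L: "rep \<in> borel_measurable L"
  using rep_measurable sets_L by (simp cong: measurable_cong_sets)

lemma real_distribution_rep: "real_distribution (distr \<mu> borel rep)"
  using rep_measurable by (intro M.real_distribution_distr)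

lemmas gap_facts = real_distribution.cdf_gap_facts[OF real_distribution_rep]
lemmas gap_measurable[measurable] = gap_facts(1)

lemma gap_eq:
  assumes "s \<in> {0..<1}" shows "gap s = s - measure \<mu> {x\<in>space \<mu>. rep x \<le> s}"
proof -
  have "frac s = s" using assms by (simp add: frac_eq)
  moreover have "cdf (distr \<mu> borel rep) s = measure \<mu> {x\<in>space \<mu>. rep x \<le> s}"
    unfolding cdf_def using rep_measurable
    by (subst measure_distr) (auto simp: vimage_def intro!: arg_cong[where f = "measure \<mu>"])
  ultimately show ?thesis by (simp add: cdf_gap_def)
qed

text \<open>The coordinate has distribution function \<open>s\<close> under \<open>L\<close>, so
  only \<mu> contributes a gap. The shift costs nothing: either it is 0 or the derivative has mean
  zero.\<close>

lemma pairing: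
  assumes f: "\<And>x. x \<in> space \<mu> \<Longrightarrow> f x = f' (rep x)" and prim: "primitive_on {0..<1} f' g'"
    and g: "integrable unif_interval g'" and a: "a * (LINT s|unif_interval. g' s) = 0"
  shows "integral\<^sup>L \<mu> f - integral\<^sup>L L f = (LINT s|unif_interval. g' s * (gap s + a))"
proof -
  have 1: "integral\<^sup>L \<mu> f = (LINT x|\<mu>. f' (rep x))" "integral\<^sup>L L f = (LINT x|L. f' (rep x))"
    using f space_L by (auto intro!: Bochner_Integration.integral_cong)
  have 2: "(LINT x|L. f' (rep x)) - (LINT x|unif_interval. f' x) =
    (LINT s|unif_interval. g' s * (s - measure L {x\<in>space L. rep x \<le> s}))"
    by (rule expectation_difference[OF prob_L rep_measurable_L _ prim g]) (simp only: space_L rep_range)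
  have "\<dots> = (LINT s|unif_interval. 0)"
    by (intro Bochner_Integration.integral_cong) (simp_all add: L_rep)
  then have 3: "(LINT x|L. f' (rep x)) = (LINT x|unif_interval. f' x)" using 2 by simp
  have "(LINT x|\<mu>. f' (rep x)) - (LINT x|unif_interval. f' x) =
    (LINT s|unif_interval. g' s * (s - measure \<mu> {x\<in>space \<mu>. rep x \<le> s}))"
    by (rule expectation_difference[OF prob_mu rep_measurable rep_range prim g])
  also have "\<dots> = (LINT s|unif_interval. g' s * gap s)"
    by (intro Bochner_Integration.integral_cong refl) (simp add: gap_eq)
  also have "\<dots> = (LINT s|unif_interval. g' s * gap s) + a * (LINT s|unif_interval. g' s)"
    using a by simp
  also have "\<dots> = (LINT s|unif_interval. g' s * gap s + a * g' s)"
  proof (subst Bochner_Integration.integral_add)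
    show "integrable unif_interval (\<lambda>s. g' s * gap s)"
    proof (rule Bochner_Integration.integrable_bound[OF g])
      show "(\<lambda>s. g' s * gap s) \<in> borel_measurable unif_interval"
        using g by (intro borel_measurable_times borel_measurable_integrable measurable_unif_interval gap_facts(1))
      show "AE s in unif_interval. norm (g' s * gap s) \<le> norm (g' s)"
        using gap_facts(2) by (intro AE_I2) (simp add: abs_mult mult_left_le)
    qed
  qed (use g in simp_all)
  also have "\<dots> = (LINT s|unif_interval. g' s * (gap s + a))"
    by (intro Bochner_Integration.integral_cong) (simp_all add: algebra_simps)
  finally show ?thesis using 1 3 by simp
qed

lemma dual_norm_le:
  assumes "1 \<le> p" "a \<in> Adm" "0 \<le> D" "Lp_norm p unif_interval (\<lambda>s. gap s + a) \<le> ennreal D"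
  shows "dual_sobolev_norm Dv L p \<mu> \<le> ereal D"
  unfolding dual_sobolev_norm_def
proof (rule Sup_least, clarify)
  fix f q assume pq: "holder_conjugate p q" and f: "f \<in> sobolev_ball Dv L q"
  have "1 \<le> q" using pq by (simp add: holder_conjugate_def)
  from ball_imp_primitive[OF f this] obtain f' g' where f': "\<And>x. x \<in> space \<mu> \<Longrightarrow> f x = f' (rep x)"
    "primitive_on {0..<1} f' g'" "g' \<in> borel_measurable unif_interval" "Lp_norm q unif_interval g' \<le> 1"
    "\<forall>a\<in>Adm. a * (LINT s|unif_interval. g' s) = 0" by blast
  have meas: "(\<lambda>s. gap s + a) \<in> borel_measurable unif_interval" by measurable
  have bdd: "\<bar>gap s + a\<bar> \<le> 1 + \<bar>a\<bar>" for s using gap_facts(2)[of s] by linarith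
  note hb = unif.holder_bound[OF pq f'(3,4) meas assms(4,3) bdd]
  have "integral\<^sup>L \<mu> f - integral\<^sup>L L f = (LINT s|unif_interval. g' s * (gap s + a))"
    by (rule pairing[OF f'(1,2) hb(1)]) (use f'(5) assms(2) in blast)+
  also have "\<dots> \<le> D" by (rule hb(2))
  finally show "ereal (integral\<^sup>L \<mu> f - integral\<^sup>L L f) \<le> ereal D" by simp
qed

lemma coupling_measurable:
  assumes "\<pi> \<in> couplings \<mu> L"
  shows "prob_space \<pi>" "(\<lambda>z. dist (fst z) (snd z)) \<in> borel_measurable \<pi>"
    "fst \<in> measurable \<pi> \<mu>" "snd \<in> measurable \<pi> L" "space \<pi> = space \<mu> \<times> space \<mu>"
proof -
  have s: "sets \<pi> = sets (\<mu> \<Otimes>\<^sub>M L)" and "prob_space \<pi>" using assms by (auto simp: couplings_def)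
  show "prob_space \<pi>" by fact
  show "(\<lambda>z. dist (fst z) (snd z)) \<in> borel_measurable \<pi>" "fst \<in> measurable \<pi> \<mu>" "snd \<in> measurable \<pi> L"
    using dist_measurable by (simp_all add: measurable_cong_sets[OF s refl])
  show "space \<pi> = space \<mu> \<times> space \<mu>"
    using sets_eq_imp_space_eq[OF s] by (simp add: space_pair_measure space_L)
qed

lemma wasserstein_le:
  assumes "1 \<le> p" "a \<in> Adm" "0 \<le> D" "Lp_norm p unif_interval (\<lambda>s. gap s + a) \<le> ennreal D"
  shows "wasserstein p \<mu> L \<le> ennreal D"
proof -
  obtain \<pi> where \<pi>: "\<pi> \<in> couplings \<mu> L" and cost: "\<And>r. 1 \<le> r \<Longrightarrow>
      (\<integral>\<^sup>+z. ennreal (dist (fst z) (snd z) powr r) \<partial>\<pi>) \<le>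
      (\<integral>\<^sup>+s. ennreal (\<bar>gap s + a\<bar> powr r) \<partial>unif_interval)"
    using coupling[OF assms(2)] by blast
  note \<pi>m = coupling_measurable[OF \<pi>]
  interpret \<pi>: prob_space \<pi> by (rule \<pi>m(1))
  have eq: "(\<lambda>(x, y). dist x y) = (\<lambda>z. dist (fst z) (snd z :: 'a))" by auto
  have "Lp_norm p \<pi> (\<lambda>(x, y). dist x y) \<le> ennreal D"
    using assms(1)
  proof (cases rule: ennreal_ge_1_cases)
    case (real r)
    have "(\<integral>\<^sup>+s. ennreal (\<bar>gap s + a\<bar> powr r) \<partial>unif_interval) \<le> ennreal (D powr r)"
      using assms(4) real assms(3) by (simp add: Lp_norm_le_iff)
    then show ?thesis
      using cost[OF real(2)] real assms(3) unfolding eq by (simp add: Lp_norm_le_iff)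
  next
    case infinity
    have "AE s in unif_interval. \<bar>gap s + a\<bar> \<le> D"
      using assms(3,4) infinity by (subst (asm) infinity, subst (asm) Lp_norm_infinity_le_iff) auto
    then have bound: "(\<integral>\<^sup>+s. ennreal (\<bar>gap s + a\<bar> powr r) \<partial>unif_interval) \<le> ennreal (D powr r)" if "1 \<le> r" for r
    proof -
      assume *: "AE s in unif_interval. \<bar>gap s + a\<bar> \<le> D"
      then have "AE s in unif_interval. ennreal (\<bar>gap s + a\<bar> powr r) \<le> ennreal (D powr r)"
        by eventually_elim (use that in \<open>auto intro!: ennreal_leI powr_mono2\<close>)
      then have "(\<integral>\<^sup>+s. ennreal (\<bar>gap s + a\<bar> powr r) \<partial>unif_interval) \<le> (\<integral>\<^sup>+s. ennreal (D powr r) \<partial>unif_interval)"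
        by (rule nn_integral_mono_AE)
      then show ?thesis by (simp add: unif.emeasure_space_1 del: space_unif_interval)
    qed
    \<comment> \<open>The coupling was obtained before the exponent, so its cost is bounded for all
      integer powers at once, and these bounds together control the essential supremum.\<close>
    have "AE z in \<pi>. \<bar>dist (fst z) (snd z)\<bar> \<le> D"
    proof (rule \<pi>.AE_bound_of_power_bounds[where m = Suc and g = "\<lambda>_ z. dist (fst z) (snd z)"])
      show "(\<integral>\<^sup>+z. ennreal (\<bar>dist (fst z) (snd z)\<bar> powr real (Suc n)) \<partial>\<pi>) \<le> ennreal (D powr real (Suc n))" for n
        using order_trans[OF cost bound, of "real (Suc n)"] by simp
    qed (use \<pi>m assms(3) filterlim_Suc in auto)
    then show ?thesis
      unfolding infinity eq using \<pi>m(2) assms(3) by (subst Lp_norm_infinity_le_iff) auto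
  qed
  then show ?thesis
    unfolding wasserstein_def using \<pi> by (rule INF_lower2[rotated])
qed

text \<open>With r' = r / (r - 1) one has (r - 1) r' = r; this proportionality is the equality case
  of Hoelder's inequality.\<close>

lemma pow_grad_powr_conjugate:
  assumes "1 < r"
  shows "\<bar>pow_grad r t z\<bar> powr (r / (r - 1)) = r powr (r / (r - 1)) * \<bar>z\<bar> powr r"
  using assms by (auto simp: pow_grad_def pow_slope_def abs_mult abs_sgn_eq powr_mult powr_powr)

definition gap_norm :: "real \<Rightarrow> real \<Rightarrow> real" where
  "gap_norm r a = (LINT s|unif_interval. \<bar>gap s + a\<bar> powr r) powr (1 / r)"

lemma gap_powr_integrable:
  assumes "1 \<le> r" shows "integrable unif_interval (\<lambda>s. \<bar>gap s + a\<bar> powr r)"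
proof (rule integrable_unif_interval_bounded)
  fix s show "\<bar>\<bar>gap s + a\<bar> powr r\<bar> \<le> (1 + \<bar>a\<bar>) powr r"
    using gap_facts(2)[of s] assms by (auto intro!: powr_mono2)
qed measurable

lemma Lp_norm_gap:
  assumes "1 \<le> r" shows "Lp_norm (ennreal r) unif_interval (\<lambda>s. gap s + a) \<le> ennreal (gap_norm r a)"
proof -
  have "0 \<le> (LINT s|unif_interval. \<bar>gap s + a\<bar> powr r)" by (intro integral_nonneg_AE) auto
  then show ?thesis
    using assms gap_powr_integrable[OF assms, of a]
    by (subst Lp_norm_le_iff) (auto simp: gap_norm_def nn_integral_eq_integral powr_powr)
qed

lemma dual_norm_ge:
  assumes "holder_conjugate p q" "primitive_on UNIV f' g'" "g' \<in> borel_measurable borel"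
    "\<And>s. \<bar>g' s\<bar> \<le> C" "\<And>s. g' (s + 1) = g' s" "Lp_norm q unif_interval g' \<le> 1"
    "\<forall>a\<in>Adm. a * (LINT s|unif_interval. g' s) = 0" "a \<in> Adm"
  shows "ereal (LINT s|unif_interval. g' s * (gap s + a)) \<le> dual_sobolev_norm Dv L p \<mu>"
proof -
  obtain f where f: "f \<in> sobolev_ball Dv L q" "\<And>x. x \<in> space \<mu> \<Longrightarrow> f x = f' (rep x)"
    using primitive_imp_ball[OF assms(2-5,7,6)] by blast
  have "integrable unif_interval g'"
    using assms(3,4) by (intro integrable_unif_interval_bounded measurable_unif_interval) auto
  then have "integral\<^sup>L \<mu> f - integral\<^sup>L L f = (LINT s|unif_interval. g' s * (gap s + a))"
    by (intro pairing[of f f'] f(2) primitive_on_subset[OF assms(2)]) (use assms(7,8) in blast)+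
  then show ?thesis
    unfolding dual_sobolev_norm_def using f(1) assms(1) by (intro Sup_upper) (auto intro!: exI[of _ f])
qed

end

section \<open>Lower bounds with a common optimal shift\<close>

lemma abs_pow_grad_1_le: "\<bar>t\<bar> \<le> 1 \<Longrightarrow> \<bar>pow_grad 1 t z\<bar> \<le> 1"
  by (auto simp: pow_grad_def pow_slope_def abs_mult)

lemma primitive_on_divide:
  assumes "primitive_on S f g" shows "primitive_on S (\<lambda>x. f x / c) (\<lambda>x. g x / c)"
  unfolding primitive_on_def
proof (intro ballI impI conjI)
  fix a b assume ab: "a \<in> S" "b \<in> S" "a \<le> b"
  note p = primitive_onD[OF assms ab]
  show "set_integrable lborel {a..b} (\<lambda>x. g x / c)"
    using p(1) unfolding set_integrable_def by (simp add: divide_inverse flip: mult.assoc)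
  show "f b / c - f a / c = (LINT s:{a..b}|lborel. g s / c)"
    using p(2) unfolding set_lebesgue_integral_def by (simp add: diff_divide_distrib[symmetric])
qed

context unif_transport
begin

lemma gap_shift_le: "\<bar>a\<bar> \<le> 2 \<Longrightarrow> \<bar>gap s + a\<bar> \<le> 3"
  using gap_facts(2)[of s] by linarith

text \<open>Upgrades the assumption on the distribution function to an equality of measures. This is
  needed to integrate \<open>G\<close>, which is known only as a measurable integrable function and
  not as a primitive.\<close>

lemma L_distr: "distr L borel rep = distr unif_interval borel (\<lambda>x. x)"
proof (rule cdf_unique)
  have id[measurable]: "(\<lambda>x. x) \<in> borel_measurable unif_interval" by (intro measurable_unif_interval) simp
  note [measurable] = rep_measurable_L
  show "real_distribution (distr L borel rep)" by (rule L.real_distribution_distr) simp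
  show "real_distribution (distr unif_interval borel (\<lambda>x. x))" by (rule unif.real_distribution_distr) simp
  show "cdf (distr L borel rep) = cdf (distr unif_interval borel (\<lambda>x. x))"
  proof
    fix s
    have e1: "cdf (distr L borel rep) s = measure L {x\<in>space L. rep x \<le> s}"
      unfolding cdf_def by (subst measure_distr) (auto intro!: arg_cong[where f = "measure L"])
    have e2: "cdf (distr unif_interval borel (\<lambda>x. x)) s = measure unif_interval {x\<in>space unif_interval. x \<le> s}"
      unfolding cdf_def by (subst measure_distr[OF id]) (auto intro!: arg_cong[where f = "measure unif_interval"])
    consider "s < 0" | "s \<in> {0..<1}" | "1 \<le> s" by force
    then show "cdf (distr L borel rep) s = cdf (distr unif_interval borel (\<lambda>x. x)) s"
    proof cases
      case 1
      then have "{x\<in>space L. rep x \<le> s} = {}" "{x\<in>space unif_interval. x \<le> s} = {}"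
        using rep_range space_L by force+
      then show ?thesis unfolding e1 e2 by (simp only: measure_empty)
    next
      case 2
      then show ?thesis unfolding e1 e2 by (simp only: L_rep measure_unif_interval_le)
    next
      case 3
      then have "{x\<in>space L. rep x \<le> s} = space L" "{x\<in>space unif_interval. x \<le> s} = space unif_interval"
        using rep_range space_L by force+
      then show ?thesis unfolding e1 e2 by (simp only: L.prob_space unif.prob_space)
    qed
  qed
qed

lemma coupling_integrals:
  fixes f :: "'a \<Rightarrow> real"
  assumes \<pi>: "\<pi> \<in> couplings \<mu> L"
  shows "integrable \<mu> f \<Longrightarrow> has_bochner_integral \<pi> (\<lambda>z. f (fst z)) (integral\<^sup>L \<mu> f)"
    and "integrable L f \<Longrightarrow> has_bochner_integral \<pi> (\<lambda>z. f (snd z)) (integral\<^sup>L L f)"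
proof -
  note m = coupling_measurable[OF \<pi>]
  have marg: "distr \<pi> \<mu> fst = \<mu>" "distr \<pi> L snd = L" using \<pi> by (auto simp: couplings_def)
  show "has_bochner_integral \<pi> (\<lambda>z. f (fst z)) (integral\<^sup>L \<mu> f)" if "integrable \<mu> f"
    using integrable_distr_eq[OF m(3), of f] integral_distr[OF m(3), of f] that marg(1)
    by (simp add: has_bochner_integral_iff borel_measurable_integrable)
  show "has_bochner_integral \<pi> (\<lambda>z. f (snd z)) (integral\<^sup>L L f)" if "integrable L f"
    using integrable_distr_eq[OF m(4), of f] integral_distr[OF m(4), of f] that marg(2)
    by (simp add: has_bochner_integral_iff borel_measurable_integrable)
qed

text \<open>One shift serves both lower bounds, because the same primitive \<Phi> is, after scaling,
  a test function for the dual norm and a potential for the transport problem. The bound 2 supplies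
  the compactness used for p = \<infinity>.\<close>

lemma optimal_shift:
  assumes r: "1 \<le> r"
  obtains a where "a \<in> Adm" "\<bar>a\<bar> \<le> 2"
    "ereal (gap_norm r a) \<le> dual_sobolev_norm Dv L (ennreal r) \<mu>"
    "ennreal (gap_norm r a) \<le> wasserstein (ennreal r) \<mu> L"
proof -
  have "\<exists>a t. a \<in> Adm \<and> \<bar>a\<bar> \<le> 2 \<and> \<bar>t\<bar> \<le> 1 \<and>
      (\<forall>b\<in>Adm. b * (LINT s|unif_interval. pow_grad r t (gap s + a)) = 0)"
    using Adm
  proof
    assume "Adm = {0}"
    then show ?thesis by (intro exI[of _ 0] exI[of _ 0]) simp
  next
    assume U: "Adm = UNIV"
    obtain a t where "\<bar>a\<bar> \<le> 2" "\<bar>t\<bar> \<le> 1" "(LINT s|unif_interval. pow_grad r t (gap s + a)) = 0"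
      using balancing_shift[OF r gap_facts(1,2)] by blast
    then show ?thesis using U by (intro exI[of _ a] exI[of _ t]) simp
  qed
  then obtain a t where a: "a \<in> Adm" "\<bar>a\<bar> \<le> 2" and t: "\<bar>t\<bar> \<le> 1"
    and bal: "\<forall>b\<in>Adm. b * (LINT s|unif_interval. pow_grad r t (gap s + a)) = 0" by blast
  define H where "H s = gap s + a" for s
  define \<kappa> where "\<kappa> s = pow_grad r t (H s)" for s
  define S where "S = (LINT s|unif_interval. \<bar>H s\<bar> powr r)"
  have [measurable]: "H \<in> borel_measurable borel" unfolding H_def[abs_def] by measurable
  have H_per: "H (s + 1) = H s" for s by (simp add: H_def gap_facts(3))
  have H_le: "\<bar>H s\<bar> \<le> 3" for s using gap_shift_le[OF a(2)] by (simp add: H_def)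
  have \<kappa>_meas[measurable]: "\<kappa> \<in> borel_measurable borel" unfolding \<kappa>_def[abs_def] by measurable
  have \<kappa>_per: "\<kappa> (s + 1) = \<kappa> s" for s by (simp add: \<kappa>_def H_per)
  have \<kappa>_le: "\<bar>\<kappa> s\<bar> \<le> pow_slope r 3 + 1" for s
    unfolding \<kappa>_def by (rule abs_pow_grad_le[OF r t H_le])
  have \<kappa>_bal: "\<forall>b\<in>Adm. b * (LINT s|unif_interval. \<kappa> s) = 0" using bal by (simp add: \<kappa>_def H_def)
  obtain \<Phi> where \<Phi>: "primitive_on UNIV \<Phi> \<kappa>"
    using primitive_exists[OF \<kappa>_meas \<kappa>_le] by blast
  have \<kappa>_int: "integrable unif_interval \<kappa>"
    using \<kappa>_le by (intro integrable_unif_interval_bounded measurable_unif_interval) auto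
  have Hr_int: "integrable unif_interval (\<lambda>s. \<bar>H s\<bar> powr r)"
    using gap_powr_integrable[OF r] by (simp add: H_def)
  have \<kappa>H: "(LINT s|unif_interval. \<kappa> s * (gap s + a)) = r * S"
    unfolding S_def by (simp add: \<kappa>_def pow_grad_mult flip: H_def)
  have S: "0 \<le> S" unfolding S_def by (intro integral_nonneg_AE) auto
  have norm_eq: "gap_norm r a = S powr (1 / r)" by (simp add: gap_norm_def S_def H_def)
  have dual: "ereal (gap_norm r a) \<le> dual_sobolev_norm Dv L (ennreal r) \<mu>"
  proof (cases "r = 1")
    case True
    have "Lp_norm \<infinity> unif_interval \<kappa> \<le> ennreal 1"
      using abs_pow_grad_1_le[OF t] True
      by (subst Lp_norm_infinity_le_iff) (auto simp: \<kappa>_def intro!: AE_I2 measurable_unif_interval)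
    moreover have "holder_conjugate (ennreal r) \<infinity>" using True by (simp add: holder_conjugate_def)
    ultimately have "ereal (LINT s|unif_interval. \<kappa> s * (gap s + a)) \<le> dual_sobolev_norm Dv L (ennreal r) \<mu>"
      using \<kappa>_bal a by (intro dual_norm_ge[OF _ \<Phi> \<kappa>_meas \<kappa>_le \<kappa>_per]) auto
    moreover have "gap_norm r a = r * S" using True S norm_eq by simp
    ultimately show ?thesis by (simp only: \<kappa>H)
  next
    case False
    then have r1: "1 < r" using r by simp
    define r' where "r' = r / (r - 1)"
    have r': "1 < r'" "1 / r' = 1 - 1 / r" using r1 by (auto simp: r'_def field_simps)
    have conj: "holder_conjugate (ennreal r) (ennreal r')"
      unfolding r'_def by (rule holder_conjugate_exponent[OF r1])
    \<comment> \<open>The norm of \<kappa> in the conjugate exponent. If it is 0, division by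
      \<open>c\<close> gives the zero function and both claims about \<open>?g\<close> hold
      trivially.\<close>
    define c where "c = r * S powr (1 / r')"
    have c: "0 \<le> c" using S r by (simp add: c_def)
    let ?g = "\<lambda>s. \<kappa> s / c"
    have "(S powr (1 / r')) powr r' = S" using r'(1) S by (simp add: powr_powr)
    then have cr: "c powr r' = r powr r' * S"
      using r S by (simp add: c_def powr_mult)
    have "(\<integral>\<^sup>+s. ennreal (\<bar>?g s\<bar> powr r') \<partial>unif_interval) \<le> 1"
    proof (cases "c = 0")
      case True
      then show ?thesis by simp
    next
      case False
      then have "c powr r' > 0" by simp
      then have Spos: "S > 0" using cr r S by (cases "S = 0") auto
      have "\<bar>?g s\<bar> powr r' = \<bar>H s\<bar> powr r / S" for s
        using pow_grad_powr_conjugate[OF r1, of t "H s"] c cr r Spos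
        by (simp add: \<kappa>_def abs_divide powr_divide r'_def)
      moreover have "(\<integral>\<^sup>+s. ennreal (\<bar>H s\<bar> powr r / S) \<partial>unif_interval) = ennreal (LINT s|unif_interval. \<bar>H s\<bar> powr r / S)"
        using Hr_int S by (intro nn_integral_eq_integral) auto
      moreover have "(LINT s|unif_interval. \<bar>H s\<bar> powr r / S) = S / S" by (simp add: S_def)
      ultimately have "(\<integral>\<^sup>+s. ennreal (\<bar>?g s\<bar> powr r') \<partial>unif_interval) = ennreal (S / S)" by simp
      then show ?thesis using Spos by simp
    qed
    then have "Lp_norm (ennreal r') unif_interval ?g \<le> ennreal 1"
      using r' by (subst Lp_norm_le_iff) auto
    moreover have "\<bar>?g s\<bar> \<le> (pow_slope r 3 + 1) / c" for s
      using \<kappa>_le[of s] c by (simp add: abs_divide divide_right_mono)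
    moreover have "\<forall>b\<in>Adm. b * (LINT s|unif_interval. ?g s) = 0" using \<kappa>_bal by auto
    ultimately have "ereal (LINT s|unif_interval. ?g s * (gap s + a)) \<le> dual_sobolev_norm Dv L (ennreal r) \<mu>"
      using a \<kappa>_per by (intro dual_norm_ge[OF conj primitive_on_divide[OF \<Phi>]]) auto
    moreover have "(LINT s|unif_interval. ?g s * (gap s + a)) = r * S / c"
      using \<kappa>H by simp
    moreover have "r * S / c = S powr (1 / r)"
    proof (cases "S = 0")
      case False
      then have "S powr (1 / r') * S powr (1 / r) = S" using S r'(2) by (simp flip: powr_add)
      then show ?thesis using r False S by (simp add: c_def field_simps)
    qed simp
    ultimately show ?thesis by (simp add: norm_eq)
  qed
  have "ennreal (gap_norm r a) \<le> wasserstein (ennreal r) \<mu> L"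
    unfolding wasserstein_def
  proof (rule INF_greatest)
    fix \<pi> assume \<pi>: "\<pi> \<in> couplings \<mu> L"
    note \<pi>m = coupling_measurable[OF \<pi>]
    interpret \<pi>: prob_space \<pi> by (rule \<pi>m(1))
    have \<Phi>': "primitive_on UNIV \<Phi> (\<lambda>s. pow_grad r t (H s))" using \<Phi> by (simp add: \<kappa>_def[abs_def])
    obtain G where G: "integrable unif_interval G" "\<And>x y. \<Phi> x - \<Phi> y \<le> \<bar>x - y\<bar> powr r + G y"
      "(LINT y|unif_interval. G y) = (r - 1) * S" "G \<in> borel_measurable borel"
      using transport_potential[OF r _ H_per H_le t \<Phi>'] unfolding S_def by auto
    show "ennreal (gap_norm r a) \<le> Lp_norm (ennreal r) \<pi> (\<lambda>(x, y). dist x y)"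
    proof -
      let ?d = "\<lambda>z :: 'a \<times> 'a. dist (fst z) (snd z)"
      have prim01: "primitive_on {0..<1} \<Phi> \<kappa>" by (rule primitive_on_subset[OF \<Phi>]) simp
      have i\<mu>: "integrable \<mu> (\<lambda>x. \<Phi> (rep x))"
        by (rule expectation_primitive(2)[OF prob_mu rep_measurable rep_range prim01 \<kappa>_int])
      have iL: "integrable L (\<lambda>x. \<Phi> (rep x))"
        by (rule expectation_primitive(2)[OF prob_L rep_measurable_L _ prim01 \<kappa>_int]) (simp only: space_L rep_range)
      have idm: "(\<lambda>x. x) \<in> borel_measurable unif_interval" by (intro measurable_unif_interval) simp
      have "integrable (distr L borel rep) G" "integral\<^sup>L (distr L borel rep) G = (r - 1) * S"
        using G integrable_distr_eq[OF idm, of G] integral_distr[OF idm, of G] by (simp_all add: L_distr)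
      then have iG: "integrable L (\<lambda>y. G (rep y))" "(LINT y|L. G (rep y)) = (r - 1) * S"
        using G(4) integrable_distr_eq[OF rep_measurable_L, of G] integral_distr[OF rep_measurable_L, of G] by simp_all
      note h1 = coupling_integrals(1)[OF \<pi> i\<mu>] and h2 = coupling_integrals(2)[OF \<pi> iL] and h3 = coupling_integrals(2)[OF \<pi> iG(1)]
      have d1: "integrable \<pi> (\<lambda>z. ?d z powr r)"
      proof (rule \<pi>.integrable_const_bound[where B = 1])
        show "AE z in \<pi>. norm (?d z powr r) \<le> 1"
          using dist_le_1 r by (intro AE_I2) (auto simp: \<pi>m(5) intro!: powr_le1)
        show "(\<lambda>z. ?d z powr r) \<in> borel_measurable \<pi>" using \<pi>m(2) by measurable
      qed
      have "(LINT x|\<mu>. \<Phi> (rep x)) - (LINT x|L. \<Phi> (rep x)) = (LINT s|unif_interval. \<kappa> s * (gap s + a))"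
        by (rule pairing[OF refl prim01 \<kappa>_int]) (use \<kappa>_bal a in blast)
      then have "r * S = (LINT z|\<pi>. \<Phi> (rep (fst z)) - \<Phi> (rep (snd z)))"
        using h1 h2 by (simp add: \<kappa>H has_bochner_integral_iff)
      also have "\<dots> \<le> (LINT z|\<pi>. ?d z powr r + G (rep (snd z)))"
      proof (rule integral_mono)
        show "integrable \<pi> (\<lambda>z. \<Phi> (rep (fst z)) - \<Phi> (rep (snd z)))"
          by (rule Bochner_Integration.integrable_diff[OF integrable.intros[OF h1] integrable.intros[OF h2]])
        show "integrable \<pi> (\<lambda>z. ?d z powr r + G (rep (snd z)))"
          by (rule Bochner_Integration.integrable_add[OF d1 integrable.intros[OF h3]])
        fix z assume "z \<in> space \<pi>"
        then have z: "fst z \<in> space \<mu>" "snd z \<in> space \<mu>" by (simp_all add: \<pi>m(5) mem_Times_iff)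
        \<comment> \<open>The potential inequality lives on the line. A lift of the first point is
          taken whose distance to the coordinate of the second is the distance in the space; \<Phi>
          takes the same value at this lift as at the coordinate.\<close>
        obtain x' where "?d z = \<bar>x' - rep (snd z)\<bar>" "\<Phi> x' = \<Phi> (rep (fst z))"
          using dist_lift[OF \<Phi> \<kappa>_meas \<kappa>_le \<kappa>_per \<kappa>_bal z] by blast
        then show "\<Phi> (rep (fst z)) - \<Phi> (rep (snd z)) \<le> ?d z powr r + G (rep (snd z))"
          using G(2)[of x' "rep (snd z)"] by simp
      qed
      also have "\<dots> = (LINT z|\<pi>. ?d z powr r) + (r - 1) * S"
        using h3 d1 iG(2) by (simp add: has_bochner_integral_iff)
      finally have "S \<le> (LINT z|\<pi>. ?d z powr r)" by (simp add: algebra_simps)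
      then have "S powr (1 / r) \<le> (LINT z|\<pi>. ?d z powr r) powr (1 / r)"
        using S r by (intro powr_mono2) auto
      moreover have "Lp_norm (ennreal r) \<pi> (\<lambda>(x, y). dist x y) = ennreal ((LINT z|\<pi>. ?d z powr r) powr (1 / r))"
      proof -
        have "(\<integral>\<^sup>+z. ennreal (\<bar>case z of (x, y) \<Rightarrow> dist x y\<bar> powr r) \<partial>\<pi>) = ennreal (LINT z|\<pi>. ?d z powr r)"
          using d1 by (subst nn_integral_eq_integral[symmetric]) (auto simp: case_prod_beta)
        moreover have "0 \<le> (LINT z|\<pi>. ?d z powr r)" by (intro integral_nonneg_AE) auto
        ultimately show ?thesis using r by (simp add: Lp_norm_def)
      qed
      ultimately show ?thesis by (simp add: norm_eq ennreal_leI)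
    qed
  qed
  then show ?thesis using that a dual by blast
qed

text \<open>The exponent conjugate to \<infinity> is 1, and on a probability space the unit ball of
  L^q lies in that of L^1: Hoelder's inequality against \<open>sgn \<circ> g\<close>. The supremum
  for \<infinity> thus runs over a larger set.\<close>

lemma dual_norm_le_infinity:
  "dual_sobolev_norm Dv L (ennreal r) \<mu> \<le> dual_sobolev_norm Dv L \<infinity> \<mu>"
proof -
  have "f \<in> sobolev_ball Dv L 1" if conj: "holder_conjugate (ennreal r) q" and f: "f \<in> sobolev_ball Dv L q" for f q
  proof -
    obtain g where g: "Dv f g" "g \<in> borel_measurable L" "Lp_norm q L g \<le> 1"
      using f by (auto simp: sobolev_ball_def)
    have r: "1 \<le> r" using conj by (simp add: holder_conjugate_def)
    have sg: "(\<lambda>x. sgn (g x)) \<in> borel_measurable L" using g(2) by measurable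
    have "(\<integral>\<^sup>+x. ennreal (\<bar>sgn (g x)\<bar> powr r) \<partial>L) \<le> (\<integral>\<^sup>+x. 1 \<partial>L)"
      by (intro nn_integral_mono) (simp add: abs_sgn_eq)
    then have "Lp_norm (ennreal r) L (\<lambda>x. sgn (g x)) \<le> ennreal 1"
      using r by (subst Lp_norm_le_iff) (auto simp: L.emeasure_space_1)
    note hb = L.holder_bound[OF conj g(2,3) sg this, of 1]
    have gi: "integrable L g" "(LINT x|L. g x * sgn (g x)) \<le> 1"
      by (rule hb; simp add: abs_sgn_eq)+
    have "(\<integral>\<^sup>+x. ennreal (\<bar>g x\<bar> powr 1) \<partial>L) = ennreal (LINT x|L. \<bar>g x\<bar>)"
      using gi(1) by (subst nn_integral_eq_integral[symmetric]) auto
    also have "\<dots> \<le> ennreal 1"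
      using gi(2) by (intro ennreal_leI) (simp add: mult_sgn_abs sgn_mult_self_eq linordered_idom_class.abs_sgn)
    finally have "Lp_norm (ennreal 1) L g \<le> ennreal 1"
      by (subst Lp_norm_le_iff) auto
    then show ?thesis using g(1,2) by (auto simp: sobolev_ball_def)
  qed
  moreover have "holder_conjugate \<infinity> 1" by (simp add: holder_conjugate_def)
  ultimately show ?thesis
    unfolding dual_sobolev_norm_def by (intro Sup_subset_mono) blast
qed

lemma wasserstein_le_infinity:
  assumes r: "1 \<le> r"
  shows "wasserstein (ennreal r) \<mu> L \<le> wasserstein \<infinity> \<mu> L"
  unfolding wasserstein_def
proof (rule INF_mono)
  fix \<pi> assume \<pi>: "\<pi> \<in> couplings \<mu> L"
  note \<pi>m = coupling_measurable[OF \<pi>]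
  interpret \<pi>: prob_space \<pi> by (rule \<pi>m(1))
  have eq: "(\<lambda>(x, y). dist x y) = (\<lambda>z. dist (fst z) (snd z :: 'a))" by auto
  have "Lp_norm (ennreal r) \<pi> (\<lambda>(x, y). dist x y) \<le> Lp_norm \<infinity> \<pi> (\<lambda>(x, y). dist x y)"
  proof (cases "Lp_norm \<infinity> \<pi> (\<lambda>(x, y). dist x y)")
    case (real D)
    then have "AE z in \<pi>. \<bar>dist (fst z) (snd z)\<bar> \<le> D"
      using Lp_norm_infinity_le_iff[OF \<pi>m(2), of D] unfolding eq by simp
    then have "AE z in \<pi>. ennreal (\<bar>dist (fst z) (snd z)\<bar> powr r) \<le> ennreal (D powr r)"
      by eventually_elim (use r in \<open>auto intro!: ennreal_leI powr_mono2\<close>)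
    then have "(\<integral>\<^sup>+z. ennreal (\<bar>dist (fst z) (snd z)\<bar> powr r) \<partial>\<pi>) \<le> (\<integral>\<^sup>+z. ennreal (D powr r) \<partial>\<pi>)"
      by (rule nn_integral_mono_AE)
    then show ?thesis
      unfolding real(2) unfolding eq using r real(1) by (subst Lp_norm_le_iff) (auto simp: \<pi>.emeasure_space_1)
  qed simp
  then show "\<exists>\<pi>'\<in>couplings \<mu> L. Lp_norm (ennreal r) \<pi>' (\<lambda>(x, y). dist x y) \<le> Lp_norm \<infinity> \<pi> (\<lambda>(x, y). dist x y)"
    using \<pi> by blast
qed

lemma gap_norm_le_3:
  assumes "1 \<le> r" "\<bar>a\<bar> \<le> 2" shows "gap_norm r a \<le> 3"
proof -
  have "(LINT s|unif_interval. \<bar>gap s + a\<bar> powr r) \<le> (LINT s|unif_interval. 3 powr r)"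
    using gap_shift_le[OF assms(2)] assms(1)
    by (intro integral_mono gap_powr_integrable) (auto intro!: powr_mono2)
  then have "(LINT s|unif_interval. \<bar>gap s + a\<bar> powr r) \<le> 3 powr r"
    by (simp add: unif.prob_space del: space_unif_interval)
  then have "gap_norm r a \<le> (3 powr r) powr (1 / r)"
    unfolding gap_norm_def using assms by (intro powr_mono2 integral_nonneg_AE) auto
  then show ?thesis using assms by (simp add: powr_powr)
qed

theorem wasserstein_eq_dual_norm:
  assumes "1 \<le> p"
  shows "enn2ereal (wasserstein p \<mu> L) = dual_sobolev_norm Dv L p \<mu>"
  using assms
proof (cases rule: ennreal_ge_1_cases)
  case (real r)
  obtain a where a: "a \<in> Adm" "ereal (gap_norm r a) \<le> dual_sobolev_norm Dv L (ennreal r) \<mu>"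
    "ennreal (gap_norm r a) \<le> wasserstein (ennreal r) \<mu> L"
    using optimal_shift[OF real(2)] by blast
  have nonneg: "0 \<le> gap_norm r a" by (simp add: gap_norm_def)
  have "wasserstein p \<mu> L = ennreal (gap_norm r a)"
    unfolding real(1)
    by (rule antisym[OF wasserstein_le[OF _ a(1) nonneg Lp_norm_gap[OF real(2)]] a(3)]) (use real(2) in auto)
  moreover have "dual_sobolev_norm Dv L p \<mu> = ereal (gap_norm r a)"
    unfolding real(1)
    by (rule antisym[OF dual_norm_le[OF _ a(1) nonneg Lp_norm_gap[OF real(2)]] a(2)]) (use real(2) in auto)
  ultimately show ?thesis using nonneg by simp
next
  case infinity
  have "\<exists>a\<in>Adm. \<bar>a\<bar> \<le> 2 \<and> ereal (gap_norm (real (Suc n)) a) \<le> dual_sobolev_norm Dv L \<infinity> \<mu> \<and>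
    ennreal (gap_norm (real (Suc n)) a) \<le> wasserstein \<infinity> \<mu> L" for n
  proof -
    have n: "1 \<le> real (Suc n)" by simp
    show ?thesis
      by (rule optimal_shift[OF n])
        (blast intro: order_trans dual_norm_le_infinity wasserstein_le_infinity[OF n])
  qed
  then obtain A where A: "\<And>n. A n \<in> Adm" "\<And>n. \<bar>A n\<bar> \<le> 2"
    "\<And>n. ereal (gap_norm (real (Suc n)) (A n)) \<le> dual_sobolev_norm Dv L \<infinity> \<mu>"
    "\<And>n. ennreal (gap_norm (real (Suc n)) (A n)) \<le> wasserstein \<infinity> \<mu> L" by metis
  have "seq_compact {-2..2::real}" by (simp add: compact_imp_seq_compact)
  moreover have "\<forall>n. A n \<in> {-2..2}" using A(2) by (auto simp: abs_le_iff minus_le_iff)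
  ultimately obtain l \<rho> where \<rho>: "strict_mono \<rho>" "(A \<circ> \<rho>) \<longlonglongrightarrow> l"
    unfolding seq_compact_def by blast
  have "closed Adm" using Adm by auto
  then have l: "l \<in> Adm" using closed_sequentially[of Adm "A \<circ> \<rho>" l] A(1) \<rho>(2) by simp
  \<comment> \<open>The supremum over all \<open>n\<close>, not only along the subsequence: the
    upper bounds need just a common bound along \<rho>, while the lower bounds hold for every
    \<open>n\<close>, so the two meet at \<open>D\<close>.\<close>
  define D where "D = (SUP n. gap_norm (real (Suc n)) (A n))"
  have bdd: "bdd_above (range (\<lambda>n. gap_norm (real (Suc n)) (A n)))"
    using gap_norm_le_3 A(2) by (intro bdd_aboveI[of _ 3]) auto
  have D_ge: "gap_norm (real (Suc n)) (A n) \<le> D" for n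
    unfolding D_def by (rule cSUP_upper[OF _ bdd]) simp
  have D0: "0 \<le> D" using order_trans[OF _ D_ge[of 0]] by (simp add: gap_norm_def)
  have "AE s in unif_interval. \<bar>gap s + l\<bar> \<le> D"
  proof (rule unif.AE_bound_of_power_bounds[where m = "\<lambda>n. Suc (\<rho> n)" and g = "\<lambda>n s. gap s + A (\<rho> n)"])
    show "filterlim (\<lambda>n. Suc (\<rho> n)) at_top sequentially"
      by (rule filterlim_compose[OF filterlim_Suc filterlim_subseq[OF \<rho>(1)]])
    show "(\<integral>\<^sup>+s. ennreal (\<bar>gap s + A (\<rho> n)\<bar> powr real (Suc (\<rho> n))) \<partial>unif_interval) \<le> ennreal (D powr real (Suc (\<rho> n)))" for n
    proof -
      have "Lp_norm (ennreal (real (Suc (\<rho> n)))) unif_interval (\<lambda>s. gap s + A (\<rho> n)) \<le> ennreal D"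
        by (rule order_trans[OF Lp_norm_gap ennreal_leI[OF D_ge]]) simp
      then show ?thesis by (subst (asm) Lp_norm_le_iff) (use D0 in auto)
    qed
    fix e :: real assume "0 < e"
    then have "\<forall>\<^sub>F n in sequentially. dist ((A \<circ> \<rho>) n) l < e" using \<rho>(2) by (rule tendstoD[rotated])
    then show "\<forall>\<^sub>F n in sequentially. \<forall>s. \<bar>gap s + l\<bar> \<le> \<bar>gap s + A (\<rho> n)\<bar> + e"
    proof eventually_elim
      case (elim n)
      then have "\<bar>A (\<rho> n) - l\<bar> < e" by (simp add: dist_real_def)
      then show ?case by (smt (verit))
    qed
  qed (use D0 in simp_all)
  then have norm: "Lp_norm \<infinity> unif_interval (\<lambda>s. gap s + l) \<le> ennreal D"
    using D0 by (subst Lp_norm_infinity_le_iff) auto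
  have 1: "1 \<le> (\<infinity>::ennreal)" by simp
  have "dual_sobolev_norm Dv L \<infinity> \<mu> = ereal D"
  proof (rule antisym[OF dual_norm_le[OF 1 l D0 norm]])
    show "ereal D \<le> dual_sobolev_norm Dv L \<infinity> \<mu>"
    proof (rule ccontr)
      assume "\<not> ereal D \<le> dual_sobolev_norm Dv L \<infinity> \<mu>"
      \<comment> \<open>Excludes the value - \<infinity>, so that a dual norm below \<open>D\<close>
        is a real number.\<close>
      moreover have "ereal 0 \<le> dual_sobolev_norm Dv L \<infinity> \<mu>"
        using order_trans[OF _ A(3)[of 0], of "ereal 0"] by (simp add: gap_norm_def)
      ultimately obtain d where d: "dual_sobolev_norm Dv L \<infinity> \<mu> = ereal d" "d < D"
        by (cases "dual_sobolev_norm Dv L \<infinity> \<mu>") auto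
      then obtain n where "d < gap_norm (real (Suc n)) (A n)"
        unfolding D_def using less_cSUP_iff[OF _ bdd] by auto
      then show False using A(3)[of n] d by simp
    qed
  qed
  moreover have "wasserstein \<infinity> \<mu> L = ennreal D"
  proof (rule antisym[OF wasserstein_le[OF 1 l D0 norm]])
    show "ennreal D \<le> wasserstein \<infinity> \<mu> L"
    proof (rule ccontr)
      assume "\<not> ennreal D \<le> wasserstein \<infinity> \<mu> L"
      then obtain d where d: "wasserstein \<infinity> \<mu> L = ennreal d" "d < D" "0 \<le> d"
        by (cases "wasserstein \<infinity> \<mu> L") (auto simp: not_le ennreal_less_iff)
      then obtain n where "d < gap_norm (real (Suc n)) (A n)"
        unfolding D_def using less_cSUP_iff[OF _ bdd] by auto
      then show False using A(4)[of n] d by (simp add: ennreal_le_iff2)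
    qed
  qed
  ultimately show ?thesis using D0 infinity by simp
qed

end

section \<open>The monotone coupling and the interval\<close>

lemma holder_conjugate_exists:
  assumes "1 \<le> q" obtains p where "holder_conjugate p q"
  using assms
proof (cases rule: ennreal_ge_1_cases)
  case infinity
  then show ?thesis using that[of 1] by (simp add: holder_conjugate_def)
next
  case (real r)
  show ?thesis
  proof (cases "r = 1")
    case True
    then show ?thesis using that[of \<infinity>] real by (simp add: holder_conjugate_def)
  next
    case False
    then show ?thesis
      using holder_conjugate_exponent[of r] real that[of "ennreal (r / (r - 1))"]
      by (auto simp: holder_conjugate_def add.commute)
  qed
qed

text \<open>Hoelder's inequality with the zero function as partner, of which only the integrability
  statement is kept.\<close>

lemma (in prob_space) integrable_of_Lp_norm:
  assumes "1 \<le> q" "g \<in> borel_measurable M" "Lp_norm q M g \<le> 1"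
  shows "integrable M g"
proof -
  obtain p where p: "holder_conjugate p q" using holder_conjugate_exists[OF assms(1)] .
  have "1 \<le> p" using p by (simp add: holder_conjugate_def)
  then have "Lp_norm p M (\<lambda>_. 0) \<le> ennreal 0"
  proof (cases rule: ennreal_ge_1_cases)
    case infinity
    then show ?thesis using Lp_norm_infinity_le_iff[of "\<lambda>_. 0" M 0] by simp
  next
    case (real r)
    then show ?thesis using Lp_norm_le_iff[of r 0 M "\<lambda>_. 0"] by simp
  qed
  then show ?thesis
    by (rule holder_bound(1)[OF p assms(2,3) borel_measurable_const, where B = 0]) auto
qed

lemma measurable_frac: "frac \<in> borel_measurable (borel :: real measure)"
  unfolding frac_def[abs_def] by measurable

text \<open>The value outside \<open>{0<..<1}\<close> is arbitrary, except that it has to lie in \<open>{0..<1}\<close>.\<close>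

definition quantile :: "real measure \<Rightarrow> real \<Rightarrow> real" where
  "quantile \<nu> y = (if y \<in> {0<..<1} then Inf {x. y \<le> cdf \<nu> x} else 0)"

context
  fixes \<nu> :: "real measure"
  assumes \<nu>: "real_distribution \<nu>" and supp: "measure \<nu> {0..<1} = 1"
begin

interpretation \<nu>: cdf_distribution \<nu>
  using \<nu> by (simp add: cdf_distribution_def)

text \<open>Right continuity of the distribution function makes the infimum a minimum, so both
  functions form a Galois connection.\<close>

lemma quantile_le_iff:
  assumes "y \<in> {0<..<1}" shows "quantile \<nu> y \<le> x \<longleftrightarrow> y \<le> cdf \<nu> x"
  using \<nu>.pseudoinverse[of y x] assms by (simp add: quantile_def)

lemma quantile_range: "quantile \<nu> y \<in> {0..<1}"
proof (cases "y \<in> {0<..<1}")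
  case True
  have neg: "cdf \<nu> x = 0" if "x < 0" for x
  proof -
    have "measure \<nu> {..x} + measure \<nu> {0..<1} = measure \<nu> ({..x} \<union> {0..<1})"
      using that by (intro \<nu>.finite_measure_Union[symmetric]) auto
    also have "\<dots> \<le> 1" by (rule \<nu>.prob_le_1)
    finally show ?thesis using supp measure_nonneg[of \<nu> "{..x}"] by (simp add: cdf_def)
  qed
  have "0 \<le> quantile \<nu> y"
  proof (rule ccontr)
    assume "\<not> 0 \<le> quantile \<nu> y"
    then show False using quantile_le_iff[OF True, of "quantile \<nu> y"] neg[of "quantile \<nu> y"] True by simp
  qed
  moreover have "quantile \<nu> y < 1"
  proof -
    \<comment> \<open>The coordinate 1 itself must be avoided: all mass lies strictly below 1, so
      the left limit of the distribution function at 1 exceeds \<open>y\<close> and some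
      \<open>x < 1\<close> already reaches level \<open>y\<close>.\<close>
    have "(cdf \<nu> \<longlongrightarrow> measure \<nu> {..<1}) (at_left 1)" by (rule \<nu>.cdf_at_left)
    moreover have "measure \<nu> {0..<1} \<le> measure \<nu> {..<1}" by (intro \<nu>.finite_measure_mono) auto
    then have "y < measure \<nu> {..<1}" using supp True by simp
    ultimately have "\<forall>\<^sub>F x in at_left 1. y < cdf \<nu> x" by (rule order_tendstoD(1))
    moreover have "\<forall>\<^sub>F x in at_left (1::real). x < 1" by (simp add: eventually_at_filter)
    ultimately have "\<forall>\<^sub>F x in at_left (1::real). quantile \<nu> y < 1"
    proof eventually_elim
      case (elim x)
      then have "quantile \<nu> y \<le> x" using quantile_le_iff[OF True, of x] by simp
      then show ?case using elim by simp
    qed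
    then show ?thesis by (simp add: eventually_const_iff)
  qed
  ultimately show ?thesis by simp
qed (auto simp: quantile_def)

lemma measurable_quantile: "quantile \<nu> \<in> borel_measurable borel"
proof -
  have "\<nu>.I \<in> borel_measurable (restrict_space borel {0<..<1})" by (rule \<nu>.measurable_CI)
  then have "(\<lambda>x. if x \<in> {0<..<1} then \<nu>.I x else 0) \<in> borel_measurable borel"
    by (subst (asm) measurable_restrict_space_iff[where c = 0]) auto
  then show ?thesis by (simp add: quantile_def[abs_def])
qed

lemma measurable_quantile_shift: "(\<lambda>y. quantile \<nu> (frac (y + a))) \<in> borel_measurable borel"
  by (rule measurable_compose[OF measurable_compose[OF _ measurable_frac] measurable_quantile]) measurable

text \<open>Rotation preserves the uniform measure, so the shift can be undone by periodicity; what
  remains is sampling by the inverse distribution function.\<close>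

lemma distr_quantile: "distr unif_interval borel (\<lambda>y. quantile \<nu> (frac (y + a))) = \<nu>"
proof (rule measure_eqI)
  note [measurable] = measurable_quantile measurable_frac
  show "sets (distr unif_interval borel (\<lambda>y. quantile \<nu> (frac (y + a)))) = sets \<nu>" by simp
  fix A assume "A \<in> sets (distr unif_interval borel (\<lambda>y. quantile \<nu> (frac (y + a))))"
  then have A[measurable]: "A \<in> sets borel" by simp
  have "emeasure (distr unif_interval borel (\<lambda>y. quantile \<nu> (frac (y + a)))) A =
      (\<integral>\<^sup>+x. indicator A x \<partial>distr unif_interval borel (\<lambda>y. quantile \<nu> (frac (y + a))))"
    by simp
  also have "\<dots> = (\<integral>\<^sup>+y. indicator A (quantile \<nu> (frac (y + a))) \<partial>unif_interval)"
    by (rule nn_integral_distr) (auto intro!: measurable_unif_interval)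
  also have "\<dots> = (\<integral>\<^sup>+y. indicator A (quantile \<nu> (frac y)) \<partial>unif_interval)"
    by (rule nn_integral_periodic_shift[of "\<lambda>y. indicator A (quantile \<nu> (frac y))"]) (measurable, simp add: frac_1_eq)
  also have "\<dots> = (\<integral>\<^sup>+y. indicator A (quantile \<nu> (frac y)) * indicator {0..<1} y \<partial>lborel)"
    by (rule nn_integral_unif_interval)
  also have "\<dots> = (\<integral>\<^sup>+y. indicator A (\<nu>.I y) * indicator {0<..<1} y \<partial>lborel)"
  proof (rule nn_integral_cong_AE)
    show "AE y in lborel. indicator A (quantile \<nu> (frac y)) * indicator {0..<1} y = indicator A (\<nu>.I y) * (indicator {0<..<1} y :: ennreal)"
      using AE_lborel_singleton[of 0]
    proof eventually_elim
      case (elim y)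
      show ?case
      proof (cases "y \<in> {0<..<1}")
        case True
        then have "frac y = y" by (simp add: frac_eq)
        then show ?thesis using True by (simp add: quantile_def)
      qed (use elim in \<open>auto simp: indicator_def\<close>)
    qed
  qed
  also have "\<dots> = (\<integral>\<^sup>+y. indicator A (\<nu>.I y) \<partial>restrict_space lborel {0<..<1})"
    by (rule nn_integral_restrict_space[symmetric]) simp
  also have "\<dots> = (\<integral>\<^sup>+x. indicator A x \<partial>distr (restrict_space lborel {0<..<1}) borel \<nu>.I)"
    using \<nu>.measurable_CI by (intro nn_integral_distr[symmetric]) (simp_all cong: measurable_cong_sets add: sets_restrict_space)
  also have "\<dots> = emeasure \<nu> A" unfolding \<nu>.distr_I_eq_M by simp
  finally show "emeasure (distr unif_interval borel (\<lambda>y. quantile \<nu> (frac (y + a)))) A = emeasure \<nu> A" .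
qed

text \<open>With F extended to the line, the map sends \<open>y\<close> to the least
  \<open>s\<close> with F s \<ge> y + a, up to null sets. It is the generalized inverse of s - H s =
  F s - a for H = \<open>cdf_gap \<nu>\<close> + a.\<close>

lemma quantile_cost_le:
  assumes "1 \<le> r"
  shows "(\<integral>\<^sup>+y. ennreal (\<bar>of_int \<lfloor>y + a\<rfloor> + quantile \<nu> (frac (y + a)) - y\<bar> powr r) \<partial>unif_interval)
    \<le> (\<integral>\<^sup>+s. ennreal (\<bar>cdf_gap \<nu> s + a\<bar> powr r) \<partial>unif_interval)"
proof (rule transport_cost_le[OF assms])
  show "(\<lambda>s. cdf_gap \<nu> s + a) \<in> borel_measurable borel"
    using \<nu>.cdf_gap_facts(1) by measurable
  show "cdf_gap \<nu> (s + 1) + a = cdf_gap \<nu> s + a" for s by (simp add: \<nu>.cdf_gap_facts(3))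
  \<comment> \<open>The discarded \<open>y\<close> are those with \<open>y + a\<close> an integer,
    where \<open>frac (y + a) = 0\<close> falls outside the range in which \<open>quantile\<close>
    inverts the distribution function.\<close>
  have "countable (range (\<lambda>k::int. of_int k - a))" by simp
  then have "range (\<lambda>k::int. of_int k - a) \<in> null_sets lborel" by (rule countable_imp_null_set_lborel)
  then have "AE y in lborel. y \<notin> range (\<lambda>k::int. of_int k - a)" by (rule AE_not_in)
  then have "AE y in unif_interval. y \<notin> range (\<lambda>k::int. of_int k - a)" by (rule AE_unif_interval)
  then show "AE y in unif_interval.
      (\<forall>s. y < s \<longrightarrow> s < of_int \<lfloor>y + a\<rfloor> + quantile \<nu> (frac (y + a)) \<longrightarrow> s - y \<le> cdf_gap \<nu> s + a) \<and>
      (\<forall>s. of_int \<lfloor>y + a\<rfloor> + quantile \<nu> (frac (y + a)) < s \<longrightarrow> s < y \<longrightarrow> cdf_gap \<nu> s + a \<le> s - y)"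
  proof eventually_elim
    case (elim y)
    define w where "w = frac (y + a)"
    define n where "n = \<lfloor>y + a\<rfloor>"
    have y: "y = of_int n + w - a" by (simp add: w_def n_def frac_def)
    have "w \<noteq> 0" using elim y by (auto simp: image_iff)
    then have w: "w \<in> {0<..<1}"
      using frac_ge_0[of "y + a"] frac_lt_1[of "y + a"] unfolding w_def by auto
    have gap: "cdf_gap \<nu> s = s - of_int \<lfloor>s\<rfloor> - cdf \<nu> (frac s)" for s
      by (simp add: cdf_gap_def frac_def)
    have q: "0 \<le> quantile \<nu> w" "quantile \<nu> w < 1" using quantile_range[of w] by auto
    have c: "0 \<le> cdf \<nu> x" "cdf \<nu> x \<le> 1" for x by (rule \<nu>.cdf_nonneg, rule \<nu>.cdf_bounded_prob)
    have s: "s = of_int \<lfloor>s\<rfloor> + frac s" "0 \<le> frac s" "frac s < 1" for s :: real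
      by (simp_all add: frac_def frac_lt_1) linarith
    have "s - y \<le> cdf_gap \<nu> s + a" if "s < of_int n + quantile \<nu> w" for s
    proof (cases "\<lfloor>s\<rfloor> = n")
      case True
      then have "frac s < quantile \<nu> w" using that s(1)[of s] by simp
      then have "cdf \<nu> (frac s) < w" using quantile_le_iff[OF w, of "frac s"] by simp
      then show ?thesis using True y gap[of s] by simp
    next
      case False
      \<comment> \<open>Here \<open>s\<close> lies in an earlier period, and cdf \<le> 1 alone gives
        F s \<le> n \<le> y + a.\<close>
      have "s < of_int (n + 1)" using that q(2) by simp
      then have "\<lfloor>s\<rfloor> < n + 1" by (simp only: floor_less_iff)
      then have "\<lfloor>s\<rfloor> + 1 \<le> n" using False by simp
      then have "of_int \<lfloor>s\<rfloor> + 1 \<le> (of_int n :: real)" by (metis of_int_1 of_int_add of_int_le_iff)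
      then show ?thesis using c(2)[of "frac s"] w y gap[of s] by simp
    qed
    moreover have "cdf_gap \<nu> s + a \<le> s - y" if "of_int n + quantile \<nu> w < s" for s
    proof (cases "\<lfloor>s\<rfloor> = n")
      case True
      then have "quantile \<nu> w \<le> frac s" using that s(1)[of s] by simp
      then have "w \<le> cdf \<nu> (frac s)" using quantile_le_iff[OF w, of "frac s"] by simp
      then show ?thesis using True y gap[of s] by simp
    next
      case False
      have "of_int n \<le> s" using that q(1) by simp
      then have "n \<le> \<lfloor>s\<rfloor>" by (simp only: le_floor_iff)
      then have "n + 1 \<le> \<lfloor>s\<rfloor>" using False by simp
      then have "of_int n + 1 \<le> (of_int \<lfloor>s\<rfloor> :: real)" by (metis of_int_1 of_int_add of_int_le_iff)
      then show ?thesis using c(1)[of "frac s"] w y gap[of s] by simp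
    qed
    ultimately show ?case unfolding w_def[symmetric] n_def[symmetric] by blast
  qed
qed

end

section \<open>Couplings induced by maps, and the interval\<close>

lemma map_coupling:
  fixes X P :: "real \<Rightarrow> 'a::metric_space"
  assumes X: "X \<in> measurable unif_interval \<mu>" "distr unif_interval \<mu> X = \<mu>"
    and P: "P \<in> measurable unif_interval L" "distr unif_interval L P = L"
    and d: "(\<lambda>z. dist (fst z) (snd z)) \<in> borel_measurable (\<mu> \<Otimes>\<^sub>M L)"
  shows "distr unif_interval (\<mu> \<Otimes>\<^sub>M L) (\<lambda>y. (X y, P y)) \<in> couplings \<mu> L"
    and "(\<integral>\<^sup>+z. ennreal (dist (fst z) (snd z) powr r) \<partial>distr unif_interval (\<mu> \<Otimes>\<^sub>M L) (\<lambda>y. (X y, P y))) =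
      (\<integral>\<^sup>+y. ennreal (dist (X y) (P y) powr r) \<partial>unif_interval)"
proof -
  have XP: "(\<lambda>y. (X y, P y)) \<in> measurable unif_interval (\<mu> \<Otimes>\<^sub>M L)"
    using X(1) P(1) by (rule measurable_Pair)
  show "distr unif_interval (\<mu> \<Otimes>\<^sub>M L) (\<lambda>y. (X y, P y)) \<in> couplings \<mu> L"
    using X P by (auto simp: couplings_def distr_distr[OF _ XP] comp_def unif.prob_space_distr[OF XP])
  have "(\<lambda>z. ennreal (dist (fst z) (snd z) powr r)) \<in> borel_measurable (\<mu> \<Otimes>\<^sub>M L)"
    using d by measurable
  then show "(\<integral>\<^sup>+z. ennreal (dist (fst z) (snd z) powr r) \<partial>distr unif_interval (\<mu> \<Otimes>\<^sub>M L) (\<lambda>y. (X y, P y))) =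
      (\<integral>\<^sup>+y. ennreal (dist (X y) (P y) powr r) \<partial>unif_interval)"
    by (simp add: nn_integral_distr[OF XP])
qed

text \<open>No mass can cross the end points, so 0 is the only admissible shift; accordingly
  derivatives carry no mean condition and the lift of a point is the point itself.\<close>

lemma unif_transport_interval:
  assumes \<mu>: "prob_space \<mu>" "sets \<mu> = sets (restrict_space borel {0..<1::real})"
  shows "unif_transport \<mu> unif_interval (\<lambda>x. x) weak_deriv_interval {0}"
proof -
  have sp: "space \<mu> = {0..<1}" using sets_eq_imp_space_eq[OF \<mu>(2)] by (simp add: space_restrict_space)
  have sets_eq: "sets unif_interval = sets \<mu>" using \<mu>(2) sets_unif_interval by simp
  have id\<mu>: "(\<lambda>x. x) \<in> borel_measurable \<mu>"
    unfolding measurable_cong_sets[OF \<mu>(2) refl] by (rule measurable_restrict_space1) simp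
  have idU: "(\<lambda>x. x) \<in> borel_measurable unif_interval" by (intro measurable_unif_interval) simp
  have dist_meas: "(\<lambda>z. dist (fst z) (snd z)) \<in> borel_measurable (\<mu> \<Otimes>\<^sub>M unif_interval)"
    using measurable_compose[OF measurable_fst id\<mu>] measurable_compose[OF measurable_snd idU]
    by (rule borel_measurable_dist)
  interpret M: prob_space \<mu> by (rule \<mu>(1))
  define \<nu> where "\<nu> = distr \<mu> borel (\<lambda>x. x)"
  have \<nu>: "real_distribution \<nu>" unfolding \<nu>_def using id\<mu> by (rule M.real_distribution_distr)
  have supp: "measure \<nu> {0..<1} = 1"
    unfolding \<nu>_def using id\<mu> M.prob_space by (subst measure_distr) (auto simp: sp)
  show ?thesis
  proof
    show "\<exists>\<pi>\<in>couplings \<mu> unif_interval. \<forall>r\<ge>1.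
        (\<integral>\<^sup>+z. ennreal (dist (fst z) (snd z) powr r) \<partial>\<pi>) \<le>
        (\<integral>\<^sup>+s. ennreal (\<bar>cdf_gap (distr \<mu> borel (\<lambda>x. x)) s + a\<bar> powr r) \<partial>unif_interval)"
      if "a \<in> {0}" for a
    proof -
      define X where "X y = quantile \<nu> (frac (y + a))" for y
      have range: "X y \<in> {0..<1}" for y unfolding X_def by (rule quantile_range[OF \<nu> supp])
      have Xb: "X \<in> borel_measurable unif_interval"
        unfolding X_def[abs_def] by (intro measurable_unif_interval measurable_quantile_shift[OF \<nu> supp])
      then have X: "X \<in> measurable unif_interval \<mu>"
        unfolding measurable_cong_sets[OF refl \<mu>(2)] using range by (intro measurable_restrict_space2) auto
      have dX: "distr unif_interval \<mu> X = \<mu>"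
      proof (rule measure_eqI)
        fix A assume "A \<in> sets (distr unif_interval \<mu> X)"
        then have A: "A \<in> sets \<mu>" by simp
        then have Ab: "A \<in> sets borel" "A \<subseteq> {0..<1}" using \<mu>(2) by (auto simp: sets_restrict_space_iff)
        have "emeasure (distr unif_interval \<mu> X) A = emeasure (distr unif_interval borel X) A"
          using A Ab X Xb by (simp add: emeasure_distr)
        also have "\<dots> = emeasure \<nu> A" unfolding X_def[abs_def] by (simp only: distr_quantile[OF \<nu> supp])
        also have "\<dots> = emeasure \<mu> A"
          unfolding \<nu>_def using Ab id\<mu> sp by (subst emeasure_distr) (auto intro!: arg_cong[where f = "emeasure \<mu>"])
        finally show "emeasure (distr unif_interval \<mu> X) A = emeasure \<mu> A" .
      qed simp
      have idU': "(\<lambda>x. x) \<in> measurable unif_interval unif_interval" "distr unif_interval unif_interval (\<lambda>x. x) = unif_interval"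
        using distr_id[of unif_interval] by (simp_all add: id_def)
      note mc = map_coupling[OF X dX idU' dist_meas]
      have "(\<integral>\<^sup>+y. ennreal (dist (X y) y powr r) \<partial>unif_interval) \<le>
          (\<integral>\<^sup>+s. ennreal (\<bar>cdf_gap \<nu> s + a\<bar> powr r) \<partial>unif_interval)" if "1 \<le> r" for r
      proof -
        have "dist (X y) y = \<bar>of_int \<lfloor>y + a\<rfloor> + quantile \<nu> (frac (y + a)) - y\<bar>" if "y \<in> space unif_interval" for y
        proof -
          have "\<lfloor>y + a\<rfloor> = 0" using that \<open>a \<in> {0}\<close> by (simp add: floor_eq_iff)
          then show ?thesis by (simp add: X_def dist_real_def)
        qed
        then have "(\<integral>\<^sup>+y. ennreal (dist (X y) y powr r) \<partial>unif_interval) =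
            (\<integral>\<^sup>+y. ennreal (\<bar>of_int \<lfloor>y + a\<rfloor> + quantile \<nu> (frac (y + a)) - y\<bar> powr r) \<partial>unif_interval)"
          by (intro nn_integral_cong) simp
        then show ?thesis using quantile_cost_le[OF \<nu> supp that, of a] by simp
      qed
      then show ?thesis
        using mc unfolding \<nu>_def by (intro bexI[OF _ mc(1)] allI impI) (simp only: mc(2))
    qed
    show "\<exists>f' g'. (\<forall>x\<in>space \<mu>. f x = f' x) \<and> primitive_on {0..<1} f' g' \<and>
        g' \<in> borel_measurable unif_interval \<and> Lp_norm q unif_interval g' \<le> 1 \<and>
        (\<forall>a\<in>{0}. a * (LINT s|unif_interval. g' s) = 0)"
      if f: "f \<in> sobolev_ball weak_deriv_interval unif_interval q" and q: "1 \<le> q" for f q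
    proof -
      obtain g where g: "weak_deriv_interval f g" "g \<in> borel_measurable unif_interval" "Lp_norm q unif_interval g \<le> 1"
        using f by (auto simp: sobolev_ball_def)
      have gi: "set_integrable lborel {0..<1} g"
        using unif.integrable_of_Lp_norm[OF q g(2,3)] by (simp add: integrable_unif_interval)
      have c: "continuous_on {0..<1} f" and w: "has_weak_deriv_on {0<..<1} f g"
        using g(1) by (auto simp: weak_deriv_interval_def)
      have "{0<..<1} \<subseteq> {0..<1::real}" by auto
      then have "primitive_on {0<..<1} f g"
        by (rule weak_deriv_imp_primitive[OF open_greaterThanLessThan is_interval_oo continuous_on_subset[OF c] w])
      then have "primitive_on {0..<1} f g" by (rule primitive_on_extend_0[OF c _ gi])
      then show ?thesis using g by (intro exI[of _ f] exI[of _ g]) simp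
    qed
    show "\<exists>f\<in>sobolev_ball weak_deriv_interval unif_interval q. \<forall>x\<in>space \<mu>. f x = f' x"
      if "primitive_on UNIV f' g'" "g' \<in> borel_measurable borel" "\<And>s. \<bar>g' s\<bar> \<le> C" "\<And>s. g' (s + 1) = g' s"
        "\<forall>a\<in>{0}. a * (LINT s|unif_interval. g' s) = 0" "Lp_norm q unif_interval g' \<le> 1" for f' g' C q
    proof -
      have "has_weak_deriv_on {0<..<1} f' g'"
        by (rule primitive_imp_weak_deriv[OF _ _ primitive_on_subset[OF that(1)] that(2,3)]) (auto simp: is_interval_oo)
      moreover have "continuous_on {0..<1} f'"
        by (rule continuous_on_subset[OF primitive_continuous_on[OF that(1,3)]]) simp
      ultimately have "f' \<in> sobolev_ball weak_deriv_interval unif_interval q"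
        using that(2,6) by (auto simp: sobolev_ball_def weak_deriv_interval_def intro!: exI[of _ g'] measurable_unif_interval)
      then show ?thesis by blast
    qed
  qed (use \<mu>(1) sp sets_eq id\<mu> dist_meas prob_space_unif_interval measure_unif_interval_le in
      \<open>auto simp: dist_real_def abs_le_iff\<close>)
qed

section \<open>The circle\<close>

lemma circle_proj_eq_iff: "circle_proj s = circle_proj t \<longleftrightarrow> s - t \<in> \<int>"
  by transfer (simp add: int_apart_def)

lemma dist_circle_proj: "dist (circle_proj s) (circle_proj t) = arc_dist s t"
  by transfer simp

lemma circle_proj_add_int: "circle_proj (t + of_int k) = circle_proj t"
  by (simp add: circle_proj_eq_iff)

lemma circle_proj_surj: "\<exists>t. circle_proj t = c"
proof transfer
  fix c :: real
  show "\<exists>t. int_apart t c" by (rule exI[of _ c]) (simp add: int_apart_def)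
qed

text \<open>Applying \<open>frac\<close> makes the arbitrary choice harmless: all representatives of
  a point share their fractional part.\<close>

definition circle_rep :: "circle \<Rightarrow> real" where
  "circle_rep c = frac (SOME t. circle_proj t = c)"

lemma circle_proj_frac: "circle_proj (frac t) = circle_proj t"
  using circle_proj_add_int[of "frac t" "\<lfloor>t\<rfloor>"] by (simp add: frac_def)

lemma circle_proj_rep[simp]: "circle_proj (circle_rep c) = c"
  unfolding circle_rep_def circle_proj_frac by (rule someI_ex[OF circle_proj_surj])

lemma circle_rep_range: "circle_rep c \<in> {0..<1}"
  by (simp add: circle_rep_def frac_lt_1)

lemma frac_eq_of_diff_Ints: "s - t \<in> \<int> \<Longrightarrow> frac s = frac (t :: real)"
proof -
  assume "s - t \<in> \<int>"
  then obtain k where "s - t = of_int k" by (auto elim: Ints_cases)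
  then have "s = t + of_int k" by simp
  then show "frac s = frac t" by (simp add: frac_def)
qed

lemma circle_rep_proj: "circle_rep (circle_proj t) = frac t"
proof -
  have "circle_rep (circle_proj t) - t \<in> \<int>" by (simp flip: circle_proj_eq_iff)
  then have "frac (circle_rep (circle_proj t)) = frac t" by (rule frac_eq_of_diff_Ints)
  then show ?thesis using circle_rep_range[of "circle_proj t"] by (simp add: frac_eq)
qed

lemma arc_dist_le_abs: "arc_dist s t \<le> \<bar>s - t\<bar>"
  using arc_dist_le[of s t 0] by simp

lemma continuous_on_circle_proj: "continuous_on S circle_proj"
proof (rule lipschitz_on_continuous_on)
  show "1-lipschitz_on S circle_proj"
    by (intro lipschitz_onI) (simp_all add: dist_circle_proj arc_dist_le_abs dist_real_def)
qed

lemma measurable_circle_proj[measurable]: "circle_proj \<in> borel_measurable borel"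
  by (rule borel_measurable_continuous_onI) (rule continuous_on_circle_proj)

text \<open>The coordinate jumps at the image of 0, but its sublevel sets are continuous images of
  compact intervals [0,b], hence closed, apart from the trivial ones.\<close>

lemma measurable_circle_rep[measurable]: "circle_rep \<in> borel_measurable borel"
proof (rule borel_measurable_iff_le[THEN iffD2], rule allI)
  fix b :: real
  have "{c. circle_rep c \<le> b} \<in> sets borel"
  proof -
    consider "b < 0" | "1 \<le> b" | "0 \<le> b" "b < 1" by linarith
    then show ?thesis
    proof cases
      case 1
      then have "\<not> circle_rep c \<le> b" for c using circle_rep_range[of c] by simp
      then have "{c. circle_rep c \<le> b} = {}" by blast
      then show ?thesis by simp
    next
      case 2
      then have "circle_rep c \<le> b" for c using circle_rep_range[of c] by simp
      then have "{c. circle_rep c \<le> b} = UNIV" by blast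
      then show ?thesis by simp
    next
      case 3
      have "{c. circle_rep c \<le> b} = circle_proj ` {0..b}"
      proof safe
        fix c assume "circle_rep c \<le> b"
        then show "c \<in> circle_proj ` {0..b}"
          using circle_rep_range[of c] by (intro image_eqI[of _ _ "circle_rep c"]) auto
      next
        fix t assume "t \<in> {0..b}"
        then have "frac t = t" using 3 by (simp add: frac_eq)
        then show "circle_rep (circle_proj t) \<le> b" using \<open>t \<in> {0..b}\<close> by (simp add: circle_rep_proj)
      qed
      also have "closed (circle_proj ` {0..b})"
        by (intro compact_imp_closed compact_continuous_image continuous_on_circle_proj) simp
      finally show ?thesis by (rule borel_closed)
    qed
  qed
  then show "{w \<in> space borel. circle_rep w \<le> b} \<in> sets borel" by simp
qed

lemma arc_dist_eq_round: "arc_dist x y = \<bar>x - y - of_int (round (x - y))\<bar>"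
proof -
  obtain k where k: "arc_dist x y = \<bar>x - y + of_int k\<bar>" using arc_dist_attained by blast
  show ?thesis
    using arc_dist_le[of x y "- round (x - y)"] round_diff_minimal[of "x - y" "- k"] k by simp
qed

text \<open>In coordinates the distance is built from subtraction, rounding and absolute value, so
  it is measurable for the product sigma-algebra itself.\<close>

lemma measurable_dist_circle:
  "(\<lambda>z. dist (fst z) (snd z)) \<in> borel_measurable (borel \<Otimes>\<^sub>M (borel :: circle measure))"
proof -
  have "dist (fst z) (snd z) = arc_dist (circle_rep (fst z)) (circle_rep (snd z))" for z :: "circle \<times> circle"
    by (simp flip: dist_circle_proj)
  then show ?thesis
    unfolding arc_dist_eq_round round_def by simp
qed

text \<open>For p = \<infinity> the essential supremum depends only on the measures of the
  superlevel sets, and these are preserved under push-forward.\<close>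

lemma Lp_norm_distr:
  assumes T: "T \<in> measurable M N" and f[measurable]: "f \<in> borel_measurable N"
  shows "Lp_norm p (distr M N T) f = Lp_norm p M (\<lambda>x. f (T x))"
proof (cases "p = \<infinity>")
  case True
  have "esssup (distr M N T) (\<lambda>x. ennreal \<bar>f x\<bar>) = esssup M (\<lambda>x. ennreal \<bar>f (T x)\<bar>)"
  proof -
    have "(\<lambda>x. ennreal \<bar>f (T x)\<bar>) \<in> borel_measurable M"
      by (rule measurable_compose[OF T]) measurable
    moreover have "emeasure (distr M N T) {x \<in> space (distr M N T). z < ennreal \<bar>f x\<bar>} =
        emeasure M {x \<in> space M. z < ennreal \<bar>f (T x)\<bar>}" for z
      using T measurable_space[OF T] by (subst emeasure_distr) (auto intro!: arg_cong[where f = "emeasure M"])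
    ultimately show ?thesis by (subst (1 2) esssup_eq) simp_all
  qed
  then show ?thesis using True by (simp add: Lp_norm_def)
next
  case False
  have "(\<integral>\<^sup>+x. ennreal (\<bar>f x\<bar> powr enn2real p) \<partial>distr M N T) = (\<integral>\<^sup>+x. ennreal (\<bar>f (T x)\<bar> powr enn2real p) \<partial>M)"
    by (rule nn_integral_distr[OF T]) measurable
  then show ?thesis using False by (simp add: Lp_norm_def)
qed

lemma set_integral_0_1_eq_unif:
  fixes g :: "real \<Rightarrow> real"
  assumes "set_integrable lborel {0..1} g" "g \<in> borel_measurable borel"
  shows "(LINT s:{0..1}|lborel. g s) = (LINT s|unif_interval. g s)"
  unfolding integral_unif_interval set_lebesgue_integral_def
proof (rule integral_cong_AE)
  show "AE s in lborel. indicator {0..1} s *\<^sub>R g s = indicator {0..<1} s *\<^sub>R g s"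
    using AE_lborel_singleton[of 1] by eventually_elim (auto simp: indicator_def)
qed (use assms(2) in measurable)

text \<open>Periodicity of \<open>g\<close> makes the increment of \<open>f\<close> over a period
  independent of its starting point, and over [0,1] it equals the mean of \<open>g\<close>.\<close>

lemma primitive_periodic:
  assumes prim: "primitive_on UNIV f g" and g: "g \<in> borel_measurable borel" "\<And>s. \<bar>g s\<bar> \<le> C"
    and per: "\<And>s. g (s + 1) = g s" and mean: "(LINT s|unif_interval. g s) = 0"
  shows "f (x + 1) = f x"
proof -
  note p = primitive_onD(2)[OF prim UNIV_I UNIV_I]
  have shift: "(LINT s:{a + 1..b + 1}|lborel. g s) = (LINT s:{a..b}|lborel. g s)" for a b
    unfolding set_lebesgue_integral_def
    using lborel_integral_real_affine[of 1 "\<lambda>s. indicator {a + 1..b + 1} s *\<^sub>R g s" 1] per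
    by (simp add: add.commute[of 1] indicator_def)
  have const: "f (b + 1) - f b = f (a + 1) - f a" if "a \<le> b" for a b
    using p[of a b] p[of "a + 1" "b + 1"] shift[of a b] that by simp
  have "f (0 + 1) - f 0 = 0"
    using p[of 0 1] set_integral_0_1_eq_unif[OF set_integrable_bounded_Icc[OF g] g(1)] mean by simp
  then show ?thesis using const[of 0 x] const[of x 0] by (cases "0 \<le> x") auto
qed

text \<open>The jump of \<open>circle_rep\<close> is repaired by translating the coordinate of the
  nearby point by the integer that realizes the arc length; \<open>f\<close> does not notice the
  translation.\<close>

lemma continuous_on_circle_lift:
  fixes f :: "real \<Rightarrow> real"
  assumes "continuous_on UNIV f" and per: "\<And>x. f (x + 1) = f x"
  shows "continuous_on UNIV (\<lambda>c. f (circle_rep c))"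
  unfolding continuous_on_iff
proof (intro ballI allI impI)
  fix c :: circle and e :: real assume "0 < e"
  then obtain d where d: "d > 0" "\<And>t. \<bar>t - circle_rep c\<bar> < d \<Longrightarrow> \<bar>f t - f (circle_rep c)\<bar> < e"
    using assms(1) unfolding continuous_on_iff dist_real_def by (metis UNIV_I)
  have "\<bar>f (circle_rep c') - f (circle_rep c)\<bar> < e" if "dist c' c < d" for c'
  proof -
    have "dist c' c = arc_dist (circle_rep c') (circle_rep c)" by (simp flip: dist_circle_proj)
    then obtain k where "dist c' c = \<bar>circle_rep c' - circle_rep c + of_int k\<bar>" using arc_dist_attained by metis
    then have "\<bar>(circle_rep c' + of_int k) - circle_rep c\<bar> < d" using that by (simp add: algebra_simps)
    from d(2)[OF this] show ?thesis by (simp add: periodic_add_int[of f, OF per])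
  qed
  then show "\<exists>d>0. \<forall>x'\<in>UNIV. dist x' c < d \<longrightarrow> dist (f (circle_rep x')) (f (circle_rep c)) < e"
    using d(1) by (auto simp: dist_real_def)
qed

text \<open>All shifts are admissible because rotations preserve the uniform measure. Quantifying
  the mean condition over all of them forces the derivative to have integral 0, which is exactly
  what a periodic primitive requires.\<close>

lemma unif_transport_circle:
  assumes \<mu>: "prob_space \<mu>" "sets \<mu> = sets (borel :: circle measure)"
  shows "unif_transport \<mu> unif_circle circle_rep weak_deriv_circle UNIV"
proof -
  have sp: "space \<mu> = UNIV" using sets_eq_imp_space_eq[OF \<mu>(2)] by simp
  have proj: "circle_proj \<in> measurable unif_interval borel" by (intro measurable_unif_interval measurable_circle_proj)
  have prob_L: "prob_space unif_circle" unfolding unif_circle_def by (rule unif.prob_space_distr[OF proj])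
  have sets_L: "sets unif_circle = sets borel" "space unif_circle = UNIV" by (simp_all add: unif_circle_def)
  have rep\<mu>: "circle_rep \<in> borel_measurable \<mu>"
    unfolding measurable_cong_sets[OF \<mu>(2) refl] by (rule measurable_circle_rep)
  interpret M: prob_space \<mu> by (rule \<mu>(1))
  define \<nu> where "\<nu> = distr \<mu> borel circle_rep"
  have \<nu>: "real_distribution \<nu>" unfolding \<nu>_def using rep\<mu> by (rule M.real_distribution_distr)
  have "circle_rep -` {0..<1} = UNIV" using circle_rep_range by auto
  then have supp: "measure \<nu> {0..<1} = 1"
    unfolding \<nu>_def using rep\<mu> M.prob_space by (subst measure_distr) (auto simp: sp)
  have dist_meas: "(\<lambda>z. dist (fst z) (snd z)) \<in> borel_measurable (\<mu> \<Otimes>\<^sub>M unif_circle)"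
    using measurable_dist_circle \<mu>(2) sets_L(1)
    by (subst measurable_cong_sets[OF sets_pair_measure_cong refl]) auto
  have g_proj: "(\<lambda>t. g (circle_proj t)) \<in> borel_measurable borel" if "g \<in> borel_measurable unif_circle" for g :: "circle \<Rightarrow> real"
    using that unfolding unif_circle_def by (intro measurable_compose[OF measurable_circle_proj]) simp
  show ?thesis
  proof (rule unif_transport.intro)
    show "measure unif_circle {x \<in> space unif_circle. circle_rep x \<le> s} = s" if "s \<in> {0..<1}" for s
    proof -
      have "measure unif_circle {x \<in> space unif_circle. circle_rep x \<le> s} =
          measure unif_interval (circle_proj -` {x. circle_rep x \<le> s} \<inter> space unif_interval)"
        unfolding unif_circle_def by (subst measure_distr[OF proj]) auto
      also have "circle_proj -` {x. circle_rep x \<le> s} \<inter> space unif_interval = {x \<in> space unif_interval. x \<le> s}"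
      proof -
        have "frac x = x" if "x \<in> {0..<1}" for x :: real using that by (simp add: frac_eq)
        then show ?thesis by (auto simp: circle_rep_proj)
      qed
      also have "measure unif_interval \<dots> = s" by (rule measure_unif_interval_le[OF that])
      finally show ?thesis .
    qed
    show "dist x y \<le> 1" if "x \<in> space \<mu>" "y \<in> space \<mu>" for x y
    proof -
      have "dist x y = arc_dist (circle_rep x) (circle_rep y)" by (simp flip: dist_circle_proj)
      also have "\<dots> \<le> \<bar>circle_rep x - circle_rep y\<bar>" by (rule arc_dist_le_abs)
      also have "\<dots> \<le> 1" using circle_rep_range[of x] circle_rep_range[of y] by auto
      finally show ?thesis .
    qed
    show "\<exists>\<pi>\<in>couplings \<mu> unif_circle. \<forall>r\<ge>1.
        (\<integral>\<^sup>+z. ennreal (dist (fst z) (snd z) powr r) \<partial>\<pi>) \<le>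
        (\<integral>\<^sup>+s. ennreal (\<bar>cdf_gap (distr \<mu> borel circle_rep) s + a\<bar> powr r) \<partial>unif_interval)" for a
    proof -
      define Q where "Q y = quantile \<nu> (frac (y + a))" for y
      define X where "X y = circle_proj (Q y)" for y
      have Q: "Q \<in> borel_measurable unif_interval"
        unfolding Q_def[abs_def] by (intro measurable_unif_interval measurable_quantile_shift[OF \<nu> supp])
      have X: "X \<in> measurable unif_interval \<mu>"
        unfolding measurable_cong_sets[OF refl \<mu>(2)] X_def[abs_def]
        by (rule measurable_compose[OF Q measurable_circle_proj])
      have dX: "distr unif_interval \<mu> X = \<mu>"
      proof -
        have "distr unif_interval \<mu> X = distr unif_interval borel X"
          using \<mu>(2) by (intro distr_cong) auto
        also have "\<dots> = distr (distr unif_interval borel Q) borel circle_proj"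
          using Q by (subst distr_distr) (auto simp: comp_def X_def[abs_def])
        also have "distr unif_interval borel Q = \<nu>"
          unfolding Q_def[abs_def] by (rule distr_quantile[OF \<nu> supp])
        also have "distr \<nu> borel circle_proj = distr \<mu> borel (\<lambda>c. c)"
          unfolding \<nu>_def using rep\<mu> by (subst distr_distr) (auto simp: comp_def)
        also have "\<dots> = \<mu>" using \<mu>(2) distr_id2[of borel \<mu>] by simp
        finally show ?thesis .
      qed
      have P: "circle_proj \<in> measurable unif_interval unif_circle" "distr unif_interval unif_circle circle_proj = unif_circle"
        unfolding measurable_cong_sets[OF refl sets_L(1)]
        using proj distr_cong[OF refl sets_L(1) refl, of unif_interval circle_proj] by (simp_all add: unif_circle_def)
      note mc = map_coupling[OF X dX P dist_meas]
      have "(\<integral>\<^sup>+y. ennreal (dist (X y) (circle_proj y) powr r) \<partial>unif_interval) \<le>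
          (\<integral>\<^sup>+s. ennreal (\<bar>cdf_gap \<nu> s + a\<bar> powr r) \<partial>unif_interval)" if "1 \<le> r" for r
      proof -
        \<comment> \<open>The integer \<open>\<lfloor>y + a\<rfloor>\<close> is one competitor in
          the minimum that defines the arc length, so the cost on the line dominates the cost on the
          circle.\<close>
        have "dist (X y) (circle_proj y) \<le> \<bar>of_int \<lfloor>y + a\<rfloor> + Q y - y\<bar>" for y
          using arc_dist_le[of "Q y" y "\<lfloor>y + a\<rfloor>"] by (simp add: X_def dist_circle_proj algebra_simps)
        then have "(\<integral>\<^sup>+y. ennreal (dist (X y) (circle_proj y) powr r) \<partial>unif_interval) \<le>
            (\<integral>\<^sup>+y. ennreal (\<bar>of_int \<lfloor>y + a\<rfloor> + quantile \<nu> (frac (y + a)) - y\<bar> powr r) \<partial>unif_interval)"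
          using that unfolding Q_def[symmetric] by (intro nn_integral_mono ennreal_leI powr_mono2) auto
        also have "\<dots> \<le> (\<integral>\<^sup>+s. ennreal (\<bar>cdf_gap \<nu> s + a\<bar> powr r) \<partial>unif_interval)"
          by (rule quantile_cost_le[OF \<nu> supp that])
        finally show ?thesis .
      qed
      then show ?thesis
        unfolding \<nu>_def by (intro bexI[OF _ mc(1)] allI impI) (simp only: mc(2))
    qed
    show "\<exists>f' g'. (\<forall>x\<in>space \<mu>. f x = f' (circle_rep x)) \<and> primitive_on {0..<1} f' g' \<and>
        g' \<in> borel_measurable unif_interval \<and> Lp_norm q unif_interval g' \<le> 1 \<and>
        (\<forall>a\<in>UNIV. a * (LINT s|unif_interval. g' s) = 0)"
      if f: "f \<in> sobolev_ball weak_deriv_circle unif_circle q" and q: "1 \<le> q" for f q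
    proof -
      obtain g where g: "weak_deriv_circle f g" "g \<in> borel_measurable unif_circle" "Lp_norm q unif_circle g \<le> 1"
        using f by (auto simp: sobolev_ball_def)
      define f' where "f' t = f (circle_proj t)" for t
      define g' where "g' t = g (circle_proj t)" for t
      have c: "continuous_on UNIV f'" and w: "has_weak_deriv_on UNIV f' g'"
        using g(1) continuous_on_compose2[OF _ continuous_on_circle_proj, of UNIV f UNIV]
        by (auto simp: weak_deriv_circle_def f'_def[abs_def] g'_def[abs_def] comp_def)
      have prim: "primitive_on UNIV f' g'"
        by (rule weak_deriv_imp_primitive[OF open_UNIV is_interval_univ c w])
      have gm: "g' \<in> borel_measurable borel" unfolding g'_def[abs_def] using g(2) by (rule g_proj)
      have "Lp_norm q unif_interval g' \<le> 1"
        using g(2,3) Lp_norm_distr[OF proj, of g q] by (simp add: unif_circle_def g'_def[abs_def])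
      moreover have "(LINT s|unif_interval. g' s) = 0"
      proof -
        have "f' 1 - f' 0 = (LINT s:{0..1}|lborel. g' s)" by (rule primitive_onD(2)[OF prim]) auto
        \<comment> \<open>The lift of a function on the circle returns to its value after one turn,
          which is where the mean condition comes from.\<close>
        moreover have "f' 1 = f' 0" using circle_proj_add_int[of 0 1] by (simp add: f'_def)
        moreover have "set_integrable lborel {0..1} g'" by (rule primitive_onD(1)[OF prim]) auto
        ultimately show ?thesis using set_integral_0_1_eq_unif[of g'] gm by simp
      qed
      moreover have "f x = f' (circle_rep x)" for x by (simp add: f'_def)
      ultimately show ?thesis
        using primitive_on_subset[OF prim, of "{0..<1}"] measurable_unif_interval[OF gm]
        by (intro exI[of _ f'] exI[of _ g']) simp
    qed
    show "\<exists>f\<in>sobolev_ball weak_deriv_circle unif_circle q. \<forall>x\<in>space \<mu>. f x = f' (circle_rep x)"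
      if "primitive_on UNIV f' g'" "g' \<in> borel_measurable borel" "\<And>s. \<bar>g' s\<bar> \<le> C" "\<And>s. g' (s + 1) = g' s"
        "\<forall>a\<in>UNIV. a * (LINT s|unif_interval. g' s) = 0" "Lp_norm q unif_interval g' \<le> 1" for f' g' C q
    proof -
      have mean: "(LINT s|unif_interval. g' s) = 0" using that(5) by (metis UNIV_I mult_1)
      have per: "f' (x + 1) = f' x" for x by (rule primitive_periodic[OF that(1-4) mean])
      have frac: "h (frac t) = h t" if "\<And>s. h (s + 1) = h s" for h :: "real \<Rightarrow> real" and t
        using periodic_add_int[of h "frac t" "\<lfloor>t\<rfloor>", OF that] by (simp add: frac_def)
      let ?f = "\<lambda>c. f' (circle_rep c)" and ?g = "\<lambda>c. g' (circle_rep c)"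
      have lift: "?f \<circ> circle_proj = f'" "?g \<circ> circle_proj = g'"
        using frac[of f', OF per] frac[of g', OF that(4)] by (auto simp: circle_rep_proj)
      have "has_weak_deriv_on UNIV f' g'"
        by (rule primitive_imp_weak_deriv[OF open_UNIV is_interval_univ that(1-3)])
      moreover have "continuous_on UNIV ?f"
        by (rule continuous_on_circle_lift[OF primitive_continuous_on[OF that(1,3)] per])
      ultimately have wd: "weak_deriv_circle ?f ?g" by (simp add: weak_deriv_circle_def lift)
      have gm: "?g \<in> borel_measurable borel"
        by (rule measurable_compose[OF measurable_circle_rep that(2)])
      then have "?g \<in> borel_measurable unif_circle" by (simp add: unif_circle_def)
      moreover have "Lp_norm q unif_circle ?g \<le> 1"
        using that(6) Lp_norm_distr[OF proj gm, of q] lift(2) by (simp add: unif_circle_def comp_def)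
      ultimately have "?f \<in> sobolev_ball weak_deriv_circle unif_circle q"
        using wd by (auto simp: sobolev_ball_def)
      then show ?thesis by (rule bexI[rotated]) simp
    qed
    show "\<exists>x'. dist x y = \<bar>x' - circle_rep y\<bar> \<and> f' x' = f' (circle_rep x)"
      if "primitive_on UNIV f' g'" "g' \<in> borel_measurable borel" "\<And>s. \<bar>g' s\<bar> \<le> C" "\<And>s. g' (s + 1) = g' s"
        "\<forall>a\<in>UNIV. a * (LINT s|unif_interval. g' s) = 0" for f' g' C x y
    proof -
      have mean: "(LINT s|unif_interval. g' s) = 0" using that(5) by (metis UNIV_I mult_1)
      have per: "f' (x + 1) = f' x" for x by (rule primitive_periodic[OF that(1-4) mean])
      have "dist x y = arc_dist (circle_rep x) (circle_rep y)" by (simp flip: dist_circle_proj)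
      then obtain k where "dist x y = \<bar>circle_rep x - circle_rep y + of_int k\<bar>" using arc_dist_attained by metis
      then show ?thesis
        using periodic_add_int[of f' "circle_rep x" k, OF per]
        by (intro exI[of _ "circle_rep x + of_int k"]) (simp add: algebra_simps)
    qed
    show "sets unif_circle = sets \<mu>" using sets_L(1) \<mu>(2) by simp
    show "UNIV = {0::real} \<or> UNIV = (UNIV :: real set)" by simp
  qed (rule \<mu>(1) prob_L rep\<mu> circle_rep_range dist_meas)+
qed

theorem proposition1p2:
  fixes p :: ennreal
  assumes "1 \<le> p"
  shows "(\<forall>\<mu> :: real measure.
            prob_space \<mu> \<and> sets \<mu> = sets (restrict_space borel {0..<1}) \<longrightarrow>
            enn2ereal (wasserstein p \<mu> unif_interval) =
              dual_sobolev_norm weak_deriv_interval unif_interval p \<mu>) \<and>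
         (\<forall>\<mu> :: circle measure.
            prob_space \<mu> \<and> sets \<mu> = sets borel \<longrightarrow>
            enn2ereal (wasserstein p \<mu> unif_circle) =
              dual_sobolev_norm weak_deriv_circle unif_circle p \<mu>)"
  using unif_transport.wasserstein_eq_dual_norm[OF unif_transport_interval assms]
    unif_transport.wasserstein_eq_dual_norm[OF unif_transport_circle assms]
  by blast

end
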